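(* Let $d,n\ge 1$ be integers and, for $j\in\{1,\dots,d\}$ and $U\in\mathbb{R}^n$, let $A_j(U)$ be a real symmetric $n\times n$ matrix whose entries are polynomial functions of $U$. Let $s>d/2+1$ and $M>0$. There exist $C>0$ and $T>0$, depending only on $s$ and $M$, such that for every $N\in\mathbb{N}$ and every $U^0\in H^s((2\pi\mathbb{T})^d)^n$ with $|U^0|_{H^s}\le M$, there exists a unique maximal-in-time classical solution $U_N\in\mathcal{C}(I_N;H^s((2\pi\mathbb{T})^d)^n)$ to $$\partial_t U_N+\mathsf{P}_N\Big(\sum_{j=1}^d A_j(U_N)\partial_{x_j}U_N\Big)=0,\qquad U_N|_{t=0}=\mathsf{P}_N U^0.$$ The open time interval $I_N$ satisfies $I_N\supset[0,T/|U^0|_{H^s}]$ and for all $0\le t\le T/|U^0|_{H^s}$, $$|U_N(t,\cdot)|_{H^s}\le |U^0|_{H^s}\exp(C|U^0|_{H^s}t)\le 2|U^0|_{H^s}.$$ Moreover, for any $s'\ge s$, one has $U_N\in\mathcal{C}^1(I_N;H^{s'}((2\pi\mathbb{T})^d)^n)$, and for any $0<T^*\in I_N$ and $M^*>0$ such that $\sup_{t\in[0,T^*]}|U_N(t,\cdot)|_{H^s}\le M^*$, there exists $C^*>0$ depending only on $s$, $s'$ and $M^*$ such that for all $0\le t\le T^*$, $$|U_N(t,\cdot)|_{H^{s'}}\le |U^0|_{H^{s'}}\exp(C^*M^*t).$$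
   Context: $(2\pi\mathbb{T})^d$ is the torus of period $2\pi$ in each of the $d$ variables; functions on it are real-valued. For real $s\ge0$, $H^s((2\pi\mathbb{T})^d)^n$ is the space of $U\in L^2((2\pi\mathbb{T})^d)^n$ with $|U|_{H^s}^2=\sum_{k\in\mathbb{Z}^d}\langle k\rangle^{2s}|\widehat U_k|^2<\infty$, where $\widehat U_k$ is the $k$-th Fourier coefficient and $\langle k\rangle=(1+|k|^2)^{1/2}$; $|U^0|_{H^{s'}}=+\infty$ if $U^0\notin H^{s'}$. $\mathcal{C}(I;X)$, $\mathcal{C}^1(I;X)$ denote continuous, resp. continuously differentiable, functions on the interval $I$ with values in the Banach space $X$. $\mathbb{N}$ denotes the positive integers. $\mathsf{P}_N$ (sharp low-pass filter) acts componentwise as the Fourier multiplier with symbol $\mathbf{1}_{\{-N,\dots,N\}^d}$, i.e. $\widehat{(\mathsf{P}_NU)}_k=\widehat U_k$ if $\max_j|k_j|\le N$ and $0$ otherwise. A maximal-in-time classical solution in $\mathcal{C}(I;H^s)$ is a solution on an open interval $I\ni0$ which cannot be extended to a solution in the same class on a strictly larger interval. If $U^0=0$, $[0,T/|U^0|_{H^s}]$ is read as $[0,\infty)$. Constants said to depend "only" on certain quantities may also depend on the fixed data $d,n,A_1,\dots,A_d$, but never on $N$. *)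

theory Defs
  imports "HOL-Analysis.Analysis"
begin

section \<open>Functions on the torus and their Fourier coefficients\<close>

text \<open>Functions on the torus of period \<open>2\<pi>\<close> in each of the \<open>d = CARD('d)\<close> variables are
  \<open>2\<pi>\<close>-periodic functions on \<open>real^'d\<close>; \<open>L\<^sup>2\<close> classes are represented by their members.\<close>

definition torus_periodic :: "(real^'d \<Rightarrow> 'b) \<Rightarrow> bool" where
  "torus_periodic f \<longleftrightarrow> (\<forall>x j. f (x + axis j (2 * pi)) = f x)"

definition torus_cell :: "(real^'d) set" where
  "torus_cell = cbox 0 (\<chi> j. 2 * pi)"

definition torus_L2 :: "(real^'d \<Rightarrow> real^'n) set" where
  "torus_L2 = {U. torus_periodic U \<and> U \<in> borel_measurable lebesgue \<and>
     set_integrable lebesgue torus_cell (\<lambda>x. (norm (U x))\<^sup>2)}"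

definition freq_dot :: "int^'d \<Rightarrow> real^'d \<Rightarrow> real" where
  "freq_dot k x = (\<Sum>j\<in>UNIV. of_int (k $ j) * x $ j)"

text \<open>Normalised so that \<open>U = \<Sum>\<^sub>k (fourier_coeff U k) exp(i k\<cdot>x)\<close>.\<close>

definition fourier_coeff :: "(real^'d \<Rightarrow> real^'n) \<Rightarrow> int^'d \<Rightarrow> complex^'n" where
  "fourier_coeff U k = (\<chi> i. (LINT x:torus_cell|lebesgue.
      exp (- \<i> * of_real (freq_dot k x)) * of_real (U x $ i)) / of_real ((2 * pi) ^ CARD('d)))"

definition japanese_bracket :: "int^'d \<Rightarrow> real" where
  "japanese_bracket k = sqrt (1 + (\<Sum>j\<in>UNIV. (of_int (k $ j))\<^sup>2))"

section \<open>Sobolev spaces\<close>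

definition sobolev :: "real \<Rightarrow> (real^'d \<Rightarrow> real^'n) set" where
  "sobolev s = {U \<in> torus_L2.
     (\<lambda>k. japanese_bracket k powr (2 * s) * (norm (fourier_coeff U k))\<^sup>2) summable_on UNIV}"

text \<open>Meaningful for \<open>U \<in> sobolev s\<close> only; \<open>sobolev_enorm\<close> takes the value \<open>\<infinity>\<close> elsewhere.\<close>

definition sobolev_norm :: "real \<Rightarrow> (real^'d \<Rightarrow> real^'n) \<Rightarrow> real" where
  "sobolev_norm s U =
     sqrt (\<Sum>\<^sub>\<infinity>k. japanese_bracket k powr (2 * s) * (norm (fourier_coeff U k))\<^sup>2)"

definition sobolev_enorm :: "real \<Rightarrow> (real^'d \<Rightarrow> real^'n) \<Rightarrow> ereal" where
  "sobolev_enorm s U = (if U \<in> sobolev s then ereal (sobolev_norm s U) else \<infinity>)"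

definition sobolev_C0 :: "real \<Rightarrow> real set \<Rightarrow> (real \<Rightarrow> real^'d \<Rightarrow> real^'n) \<Rightarrow> bool" where
  "sobolev_C0 s I U \<longleftrightarrow> (\<forall>t\<in>I. U t \<in> sobolev s) \<and>
     (\<forall>t\<in>I. ((\<lambda>r. sobolev_norm s (\<lambda>x. U r x - U t x)) \<longlongrightarrow> 0) (at t within I))"

definition sobolev_C1 :: "real \<Rightarrow> real set \<Rightarrow> (real \<Rightarrow> real^'d \<Rightarrow> real^'n) \<Rightarrow> bool" where
  "sobolev_C1 s I U \<longleftrightarrow> (\<forall>t\<in>I. U t \<in> sobolev s) \<and>
     (\<exists>V. sobolev_C0 s I V \<and>
       (\<forall>t\<in>I. ((\<lambda>r. sobolev_norm s (\<lambda>x. (1 / (r - t)) *\<^sub>R (U r x - U t x) - V t x)) \<longlongrightarrow> 0)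
                (at t within I)))"

section \<open>The filtered system\<close>

text \<open>The real part only casts to the reals: since \<open>U\<close> is real-valued and the set of
  frequencies is symmetric, the sum is real.\<close>

definition low_pass :: "nat \<Rightarrow> (real^'d \<Rightarrow> real^'n) \<Rightarrow> real^'d \<Rightarrow> real^'n" where
  "low_pass N U x = (\<chi> i. Re (\<Sum>k\<in>{k. \<forall>j. \<bar>k $ j\<bar> \<le> int N}.
      fourier_coeff U k $ i * exp (\<i> * of_real (freq_dot k x))))"

definition partial_deriv :: "'d \<Rightarrow> (real^'d \<Rightarrow> real^'n) \<Rightarrow> real^'d \<Rightarrow> real^'n" where
  "partial_deriv j f x = frechet_derivative f (at x) (axis j 1)"

definition quasilinear_term ::
    "('d \<Rightarrow> real^'n \<Rightarrow> real^'n^'n) \<Rightarrow> (real^'d \<Rightarrow> real^'n) \<Rightarrow> real^'d \<Rightarrow> real^'n" where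
  "quasilinear_term A U x = (\<Sum>j\<in>UNIV. A j (U x) *v partial_deriv j U x)"

text \<open>All derivatives in the equation are classical ones and the equation holds at every point
  \<open>(t, x)\<close>. For \<open>s > d/2 + 1\<close> this selects the continuous representative of \<open>U t \<in> sobolev s\<close>,
  which is differentiable by Sobolev embedding. Only the values of \<open>U\<close> at times in \<open>I\<close> matter.\<close>

definition classical_solution ::
    "('d \<Rightarrow> real^'n \<Rightarrow> real^'n^'n) \<Rightarrow> real \<Rightarrow> nat \<Rightarrow> (real^'d \<Rightarrow> real^'n) \<Rightarrow>
     real set \<Rightarrow> (real \<Rightarrow> real^'d \<Rightarrow> real^'n) \<Rightarrow> bool" where
  "classical_solution A s N U0 I U \<longleftrightarrow>
     open I \<and> is_interval I \<and> 0 \<in> I \<and>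
     sobolev_C0 s I U \<and>
     (\<forall>t\<in>I. \<forall>x. U t differentiable (at x)) \<and>
     (\<forall>t\<in>I. \<forall>x. ((\<lambda>r. U r x) has_vector_derivative
        - low_pass N (quasilinear_term A (U t)) x) (at t)) \<and>
     U 0 = low_pass N U0"

definition maximal_solution ::
    "('d \<Rightarrow> real^'n \<Rightarrow> real^'n^'n) \<Rightarrow> real \<Rightarrow> nat \<Rightarrow> (real^'d \<Rightarrow> real^'n) \<Rightarrow>
     real set \<Rightarrow> (real \<Rightarrow> real^'d \<Rightarrow> real^'n) \<Rightarrow> bool" where
  "maximal_solution A s N U0 I U \<longleftrightarrow> classical_solution A s N U0 I U \<and>
     \<not> (\<exists>J V. classical_solution A s N U0 J V \<and> I \<subset> J \<and> (\<forall>t\<in>I. V t = U t))"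

definition existence_interval :: "real \<Rightarrow> real \<Rightarrow> real set" where
  "existence_interval T r = (if r = 0 then {0..} else {0..T / r})"

end

theory Submission
  imports Defs
begin

text \<open>
  The filter confines the solution to real trigonometric polynomials with frequencies in the box
  \<open>{-N..N}\<^sup>d\<close>, so for fixed \<open>N\<close> the equation is an ordinary differential equation with a polynomial,
  hence locally Lipschitz, right-hand side. Picard iteration gives existence, a connectedness argument
  gives uniqueness, the union of all solutions is the maximal one, and it can stop in finite time only if it
  becomes unbounded (\<open>ode_maximal\<close>, \<open>ode_continuation\<close>). On trigonometric polynomials of bounded
  degree all norms are equivalent, so continuity and differentiability in time hold in every Sobolev space.

  Everything quantitative is in one estimate that does not see \<open>N\<close> (\<open>filtered_energy_estimate\<close>):
  for a real trigonometric polynomial \<open>U\<close> the pairing of \<open>\<Sum>\<^sub>j A\<^sub>j(U) \<partial>\<^sub>j U\<close> with \<open>U\<close> in \<open>H\<^sup>\<sigma>\<close> is at most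
  \<open>C |U|\<^sub>s |U|\<^sub>\<sigma>\<^sup>2\<close>, with \<open>C\<close> depending on an upper bound for \<open>|U|\<^sub>s\<close>. In that pairing the filter
  disappears, because it is self-adjoint, commutes with Fourier multipliers and leaves \<open>U\<close> unchanged. With \<open>c\<^sub>k\<close>
  the Fourier coefficients of \<open>U\<close> and \<open>B\<close> those of an entry of \<open>A\<^sub>j(U)\<close>, the pairing consists of the terms
  \<open>\<langle>k\<rangle>\<^sup>2\<^sup>\<sigma> c\<^sub>k\<^sup>* B(k-m) (i m\<^sub>j) c\<^sub>m\<close>. One weight \<open>\<langle>k\<rangle>\<^sup>\<sigma>\<close> goes to \<open>c\<^sub>k\<close>; replacing the other one by
  \<open>\<langle>m\<rangle>\<^sup>\<sigma>\<close> leaves a form whose real part, by the symmetry of \<open>A\<^sub>j\<close>, only contains \<open>m\<^sub>j - k\<^sub>j\<close>, so that the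
  derivative falls on \<open>A\<^sub>j(U)\<close>. The error \<open>\<langle>k\<rangle>\<^sup>\<sigma> - \<langle>m\<rangle>\<^sup>\<sigma>\<close> is bounded by
  \<open>|k-m| (\<langle>m\<rangle>\<^sup>\<sigma>\<^sup>-\<^sup>1 + \<langle>k-m\<rangle>\<^sup>\<sigma>\<^sup>-\<^sup>1)\<close>: it moves at least one derivative onto \<open>A\<^sub>j(U)\<close>, and when it moves all
  \<open>\<sigma>\<close> of them, only one is left on the remaining factor \<open>U\<close> (\<open>commutator_estimate\<close>). All sums
  are then convolutions, bounded by Young's inequality from the summability of \<open>|k| |c\<^sub>k|\<close>, which
  follows from \<open>s > d/2 + 1\<close> (\<open>sobolev_wiener_embedding\<close>). Since \<open>A\<^sub>j\<close> is polynomial, the coefficients of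
  \<open>A\<^sub>j(U)\<close> obey the same bounds as those of \<open>U\<close>, away from the frequency zero
  (\<open>tame_bound_polynomial\<close>); omitting that frequency is what makes the estimate linear in \<open>|U|\<^sub>s\<close> and hence
  the growth rate proportional to the size of the data.

  For \<open>\<sigma> = s\<close> the estimate and a bootstrap (\<open>quadratic_growth_bootstrap\<close>) bound the \<open>H\<^sup>s\<close> norm by twice its
  initial value on a time \<open>T/|U\<^sup>0|\<^sub>s\<close>, which keeps the solution alive that long. For \<open>\<sigma> = s'\<close> it is
  linear in \<open>|U|\<^sub>s\<^sub>'\<^sup>2\<close>, and Gronwall's inequality gives the second claim.

  A classical solution is only assumed to satisfy the equation pointwise in \<open>x\<close>. That it is
  a trigonometric polynomial at all times, and a differentiable curve in the supremum norm, follows by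
  comparison with its trigonometric interpolation at finitely many points
  (\<open>classical_solution_trig_vec\<close>, \<open>classical_imp_ode_solution\<close>); uniqueness for the differential
  equation then applies to it.
\<close>

section \<open>Ordinary differential equations in Banach spaces\<close>

definition lipschitz_on_balls :: "('e::real_normed_vector \<Rightarrow> 'f::real_normed_vector) \<Rightarrow> bool" where
  "lipschitz_on_balls G \<longleftrightarrow> (\<forall>R. \<exists>L. L-lipschitz_on (cball 0 R) G)"

definition ode_solution :: "('e::banach \<Rightarrow> 'e) \<Rightarrow> 'e \<Rightarrow> real set \<Rightarrow> (real \<Rightarrow> 'e) \<Rightarrow> bool" where
  "ode_solution G u0 J u \<longleftrightarrow> open J \<and> is_interval J \<and> 0 \<in> J \<and> u 0 = u0 \<and>
     (\<forall>t\<in>J. (u has_vector_derivative G (u t)) (at t))"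

lemma lipschitz_on_balls_bounded:
  assumes "lipschitz_on_balls G"
  obtains B where "B > 0" "\<And>x. x \<in> cball 0 R \<Longrightarrow> norm (G x) \<le> B"
proof -
  obtain L where L: "L-lipschitz_on (cball 0 (max R 0)) G"
    using assms unfolding lipschitz_on_balls_def by blast
  have "norm (G x) \<le> norm (G 0) + L * max R 0 + 1" if "x \<in> cball 0 R" for x
  proof -
    have "dist (G x) (G 0) \<le> L * dist x 0"
      by (rule lipschitz_onD[OF L]) (use that in auto)
    also have "\<dots> \<le> L * max R 0"
      using lipschitz_on_nonneg[OF L] that by (intro mult_left_mono) auto
    finally have "dist (G x) (G 0) \<le> L * max R 0" .
    then show ?thesis
      using norm_triangle_ineq2[of "G x" "G 0"] by (simp add: dist_norm)
  qed
  moreover have "norm (G 0) + L * max R 0 + 1 > 0"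
    using lipschitz_on_nonneg[OF L] by (simp add: add_nonneg_pos)
  ultimately show ?thesis using that by blast
qed

lemma lipschitz_on_balls_continuous:
  assumes "lipschitz_on_balls G"
  shows "continuous_on S G"
proof -
  have "isCont G x" for x
  proof -
    obtain L where L: "L-lipschitz_on (cball 0 (norm x + 1)) G"
      using assms unfolding lipschitz_on_balls_def by blast
    have "continuous_on (ball 0 (norm x + 1)) G"
      by (rule continuous_on_subset[OF lipschitz_on_continuous_on[OF L]]) auto
    then show ?thesis
      by (simp add: continuous_on_eq_continuous_at)
  qed
  then show ?thesis by (simp add: continuous_at_imp_continuous_on)
qed

text \<open>The existence time depends on the size of the initial value only and not on the initial time. This
  uniformity is what turns a bound on a solution into its continuation.\<close>

lemma picard_local_existence:
  fixes G :: "'e::banach \<Rightarrow> 'e"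
  assumes G: "lipschitz_on_balls G"
  obtains \<delta> where "\<delta> > 0"
    "\<And>t0 u0. norm u0 \<le> R \<Longrightarrow> \<exists>u. u t0 = u0 \<and>
       (\<forall>t\<in>{t0-\<delta><..<t0+\<delta>}. (u has_vector_derivative G (u t)) (at t))"
proof -
  obtain L where L: "L-lipschitz_on (cball 0 (R+1)) G"
    using G unfolding lipschitz_on_balls_def by blast
  obtain B where B: "B > 0" "\<And>x. x \<in> cball 0 (R+1) \<Longrightarrow> norm (G x) \<le> B"
    using lipschitz_on_balls_bounded[OF G] by blast
  have L0: "L \<ge> 0" using lipschitz_on_nonneg[OF L] .
  \<comment> \<open>The integral from \<open>0\<close> to \<open>t\<close> is written as a difference of integrals starting at \<open>-d\<close>, of lengths at most \<open>2d\<close>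
    and \<open>d\<close>: this gives the factor \<open>3\<close> in the two conditions.\<close>
  define d where "d = 1 / (4 * (B + L + 1))"
  have d0: "d > 0" unfolding d_def using B L0 by simp
  have dB: "3 * d * B \<le> 1" and dL: "3 * d * L \<le> 3/4"
    unfolding d_def using B L0 by (auto simp: field_simps)
  have main: "\<exists>u. u 0 = u0 \<and> (\<forall>t\<in>{-d<..<d}. (u has_vector_derivative G (u t)) (at t))"
    if u0: "norm u0 \<le> R" for u0
  proof -
    \<comment> \<open>Functions are extended constantly outside \<open>[-d, d]\<close>, so that iterates are bounded on the whole line.\<close>
    define c where "c = (\<lambda>t. max (-d) (min d t))"
    have c: "c t \<in> {-d..d}" for t unfolding c_def using d0 by auto
    have c_id: "c t = t" if "t \<in> {-d..d}" for t using that unfolding c_def by auto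
    have cont_c: "continuous_on S c" for S unfolding c_def by (intro continuous_intros)
    define S where "S = PiC UNIV (\<lambda>_::real. cball u0 1)"
    have S_iff: "u \<in> S \<longleftrightarrow> (\<forall>t. apply_bcontfun u t \<in> cball u0 1)" for u
      unfolding S_def by (auto simp: mem_PiC_iff)
    have in_ball: "apply_bcontfun u t \<in> cball 0 (R+1)" if "u \<in> S" for u t
    proof -
      have "dist u0 (apply_bcontfun u t) \<le> 1" using that by (simp add: S_iff)
      then show ?thesis using u0 norm_triangle_ineq2[of "apply_bcontfun u t" u0]
        by (simp add: dist_norm norm_minus_commute)
    qed
    define T where "T = (\<lambda>u t. u0 + integral {-d..c t} (\<lambda>r. G (apply_bcontfun u r))
        - integral {-d..0} (\<lambda>r. G (apply_bcontfun u r)))"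
    have contG: "continuous_on X (\<lambda>r. G (apply_bcontfun u r))" for X u
      using continuous_on_compose2[OF lipschitz_on_balls_continuous[OF G, of UNIV]
          continuous_on_apply_bcontfun] by blast
    have intG: "(\<lambda>r. G (apply_bcontfun u r)) integrable_on {a..b}" for a b :: real and u
      using contG by (rule integrable_continuous_real)
    have T_cont: "continuous_on UNIV (T u)" for u
    proof -
      have "continuous_on {-d..d} (\<lambda>t. integral {-d..t} (\<lambda>r. G (apply_bcontfun u r)))"
        by (intro indefinite_integral_continuous_1 intG)
      then have "continuous_on UNIV (\<lambda>t. integral {-d..c t} (\<lambda>r. G (apply_bcontfun u r)))"
        by (rule continuous_on_compose2[OF _ cont_c]) (use c in auto)
      then show ?thesis unfolding T_def by (intro continuous_intros)
    qed
    have T_near: "T u t \<in> cball u0 1" if "u \<in> S" for u t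
    proof -
      have b: "norm (integral {-d..x} (\<lambda>r. G (apply_bcontfun u r))) \<le> B * (x + d)"
        if "x \<in> {-d..d}" for x
        using integral_bound[of "-d" x "\<lambda>r. G (apply_bcontfun u r)" B] contG that
          B(2)[OF in_ball[OF \<open>u \<in> S\<close>]] by auto
      have "norm (T u t - u0) = norm (integral {-d..c t} (\<lambda>r. G (apply_bcontfun u r))
          - integral {-d..0} (\<lambda>r. G (apply_bcontfun u r)))"
        unfolding T_def by (simp add: algebra_simps)
      also have "\<dots> \<le> B * (c t + d) + B * (0 + d)"
        by (rule order_trans[OF norm_triangle_ineq4 add_mono[OF b[OF c[of t]] b[of 0]]]) (use d0 in simp)
      also have "\<dots> \<le> B * (2*d) + B * d"
        using c[of t] B(1) by (intro add_mono mult_left_mono) auto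
      also have "\<dots> \<le> 1" using dB by (simp add: algebra_simps)
      finally show ?thesis by (simp add: dist_norm norm_minus_commute)
    qed
    have T_bc: "T u \<in> bcontfun" if "u \<in> S" for u
      by (rule bcontfun_normI[where b="norm u0 + 1"])
        (use T_cont T_near[OF that] in \<open>auto simp: dist_norm norm_minus_commute
            intro: order_trans[OF norm_triangle_sub[of _ u0]]\<close>)
    define P where "P = (\<lambda>u. Bcontfun (T u))"
    have P_apply: "apply_bcontfun (P u) t = T u t" if "u \<in> S" for u t
      unfolding P_def using T_bc[OF that] by (simp add: Bcontfun_inverse)
    have contr: "dist (P u) (P v) \<le> 3/4 * dist u v" if uv: "u \<in> S" "v \<in> S" for u v
    proof (rule dist_bound)
      fix t
      have b: "norm (integral {-d..x} (\<lambda>r. G (apply_bcontfun u r)) - integral {-d..x} (\<lambda>r. G (apply_bcontfun v r)))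
            \<le> (L * dist u v) * (x + d)" if "x \<in> {-d..d}" for x
      proof -
        have "norm (integral {-d..x} (\<lambda>r. G (apply_bcontfun u r) - G (apply_bcontfun v r)))
            \<le> (L * dist u v) * (x - (-d))"
        proof (rule integral_bound)
          fix r
          have "dist (G (apply_bcontfun u r)) (G (apply_bcontfun v r))
             \<le> L * dist (apply_bcontfun u r) (apply_bcontfun v r)"
            by (rule lipschitz_onD[OF L]) (use in_ball uv in auto)
          also have "\<dots> \<le> L * dist u v" using L0 dist_bounded by (intro mult_left_mono)
          finally show "norm (G (apply_bcontfun u r) - G (apply_bcontfun v r)) \<le> L * dist u v"
            by (simp add: dist_norm)
        next
          show "continuous_on {- d..x} (\<lambda>r. G (apply_bcontfun u r) - G (apply_bcontfun v r))"
            by (rule continuous_on_diff[OF contG contG])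
        qed (use that in auto)
        then show ?thesis by (simp add: integral_diff intG)
      qed
      have "dist (T u t) (T v t) = norm ((integral {-d..c t} (\<lambda>r. G (apply_bcontfun u r)) - integral {-d..c t} (\<lambda>r. G (apply_bcontfun v r)))
        - (integral {-d..0} (\<lambda>r. G (apply_bcontfun u r)) - integral {-d..0} (\<lambda>r. G (apply_bcontfun v r))))"
        unfolding T_def dist_norm by (simp add: algebra_simps)
      also have "\<dots> \<le> (L * dist u v) * (c t + d) + (L * dist u v) * (0 + d)"
        by (rule order_trans[OF norm_triangle_ineq4 add_mono[OF b[OF c[of t]] b[of 0]]]) (use d0 in simp)
      also have "\<dots> \<le> (L * dist u v) * (2*d) + (L * dist u v) * d"
        using c[of t] L0 by (intro add_mono mult_left_mono) auto
      also have "\<dots> = (3 * d * L) * dist u v" by (simp add: algebra_simps)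
      also have "\<dots> \<le> 3/4 * dist u v" using dL by (intro mult_right_mono) auto
      finally show "dist (apply_bcontfun (P u) t) (apply_bcontfun (P v) t) \<le> 3/4 * dist u v"
        by (simp add: P_apply uv)
    qed
    have "\<exists>!u\<in>S. P u = u"
    proof (rule Banach_fix[where c="3/4"])
      show "complete S" unfolding S_def complete_eq_closed by (intro closed_PiC) auto
      show "S \<noteq> {}"
        using S_iff[of "const_bcontfun u0"] by (auto simp: const_bcontfun.rep_eq)
      show "P ` S \<subseteq> S" using T_near by (auto simp: S_iff P_apply)
    qed (use contr in auto)
    then obtain u where u: "u \<in> S" "P u = u" by blast
    have eq: "apply_bcontfun u t = T u t" for t using P_apply[OF u(1)] u(2) by simp
    have "apply_bcontfun u 0 = u0" unfolding eq using c_id[of 0] d0 by (simp add: T_def)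
    moreover have "(apply_bcontfun u has_vector_derivative G (apply_bcontfun u t)) (at t)"
      if t: "t \<in> {-d<..<d}" for t
    proof -
      have "((\<lambda>t. integral {-d..t} (\<lambda>r. G (apply_bcontfun u r))) has_vector_derivative
          G (apply_bcontfun u t)) (at t within {-d..d})"
        by (rule integral_has_vector_derivative) (use contG t in auto)
      then have "((\<lambda>t. integral {-d..t} (\<lambda>r. G (apply_bcontfun u r))) has_vector_derivative
          G (apply_bcontfun u t)) (at t)"
        using t at_within_Icc_at[of "-d" t d] by auto
      then have "((\<lambda>t. u0 + integral {-d..t} (\<lambda>r. G (apply_bcontfun u r))
          - integral {-d..0} (\<lambda>r. G (apply_bcontfun u r))) has_vector_derivative
          G (apply_bcontfun u t)) (at t)"
        by (auto intro!: derivative_eq_intros)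
      moreover have "u0 + integral {-d..x} (\<lambda>r. G (apply_bcontfun u r))
          - integral {-d..0} (\<lambda>r. G (apply_bcontfun u r)) = apply_bcontfun u x"
        if "x \<in> {-d<..<d}" for x
        using that c_id[of x] unfolding eq[of x] T_def by simp
      ultimately show ?thesis
        by (rule has_vector_derivative_transform_within_open[OF _ open_greaterThanLessThan t])
    qed
    ultimately show ?thesis by blast
  qed
  have "\<exists>u. u t0 = u0 \<and> (\<forall>t\<in>{t0-d<..<t0+d}. (u has_vector_derivative G (u t)) (at t))"
    if u0: "norm u0 \<le> R" for u0 t0
  proof -
    obtain u where u: "u 0 = u0" "\<And>t. t\<in>{-d<..<d} \<Longrightarrow> (u has_vector_derivative G (u t)) (at t)"
      using main[OF u0] by blast
    have "((\<lambda>t. u (t - t0)) has_vector_derivative G (u (t - t0))) (at t)" if "t\<in>{t0-d<..<t0+d}" for t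
    proof -
      have "((u \<circ> (\<lambda>t. t - t0)) has_vector_derivative 1 *\<^sub>R G (u (t - t0))) (at t)"
        by (rule vector_diff_chain_at) (use that u(2)[of "t - t0"] in \<open>auto intro!: derivative_eq_intros\<close>)
      then show ?thesis by (simp add: o_def)
    qed
    then show ?thesis using u(1) by (intro exI[of _ "\<lambda>t. u (t - t0)"]) auto
  qed
  then show ?thesis using that d0 by blast
qed

text \<open>The largest distance \<open>m\<close> of the two solutions on an interval of radius \<open>a\<close> satisfies
  \<open>m \<le> a L m\<close> by the mean value inequality, hence vanishes when \<open>a L < 1\<close>.\<close>

lemma ode_agree_near:
  fixes G :: "'e::banach \<Rightarrow> 'e"
  assumes G: "lipschitz_on_balls G" and J: "open J" "t0 \<in> J"
    and u: "\<And>t. t \<in> J \<Longrightarrow> (u has_vector_derivative G (u t)) (at t)"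
    and v: "\<And>t. t \<in> J \<Longrightarrow> (v has_vector_derivative G (v t)) (at t)"
    and eq: "u t0 = v t0"
  shows "\<exists>\<delta>>0. \<forall>t. \<bar>t - t0\<bar> \<le> \<delta> \<longrightarrow> u t = v t"
proof -
  define R where "R = norm (u t0) + 1"
  obtain L where L: "L-lipschitz_on (cball 0 R) G"
    using G unfolding lipschitz_on_balls_def by blast
  have L0: "L \<ge> 0" using lipschitz_on_nonneg[OF L] .
  obtain e where e: "e > 0" "cball t0 e \<subseteq> J" using J open_contains_cball by blast
  have cu: "continuous_on J u" "continuous_on J v"
    by (intro continuous_at_imp_continuous_on ballI, rule has_vector_derivative_continuous,
        rule u v, assumption)+
  have cont: "isCont u t0" "isCont v t0"
    by (rule has_vector_derivative_continuous[OF u[OF J(2)]],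
        rule has_vector_derivative_continuous[OF v[OF J(2)]])
  obtain d1 where d1: "d1 > 0" "\<And>t. dist t t0 < d1 \<Longrightarrow> dist (u t) (u t0) < 1"
    using cont(1) zero_less_one unfolding continuous_at_eps_delta by blast
  obtain d2 where d2: "d2 > 0" "\<And>t. dist t t0 < d2 \<Longrightarrow> dist (v t) (v t0) < 1"
    using cont(2) zero_less_one unfolding continuous_at_eps_delta by blast
  note d = d1(1) d2(1) d1(2) d2(2)
  define a where "a = min (min e (1 / (2*(L+1)))) (min (d1/2) (d2/2))"
  have a: "a > 0" "a \<le> e" "a < d1" "a < d2" "a \<le> 1 / (2*(L+1))"
    unfolding a_def using e d L0 by auto
  have aL: "a * L \<le> 1/2"
  proof -
    have "a * L \<le> 1 / (2*(L+1)) * L" using a L0 by (intro mult_right_mono) auto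
    also have "\<dots> \<le> 1/2" using L0 by (simp add: field_simps)
    finally show ?thesis .
  qed
  have inball: "u t \<in> cball 0 R \<and> v t \<in> cball 0 R" if "\<bar>t - t0\<bar> \<le> a" for t
  proof -
    have "dist (u t) (u t0) < 1" "dist (v t) (u t0) < 1"
      using d(3,4)[of t] that a eq by (auto simp: dist_real_def)
    then show ?thesis unfolding R_def
      using norm_triangle_ineq2[of "u t" "u t0"] norm_triangle_ineq2[of "v t" "u t0"]
      by (simp add: dist_norm)
  qed
  let ?I = "cball t0 a"
  have IJ: "?I \<subseteq> J" using a e by auto
  have "continuous_on ?I (\<lambda>t. norm (u t - v t))"
    by (intro continuous_intros continuous_on_subset[OF cu(1) IJ] continuous_on_subset[OF cu(2) IJ])
  then obtain tm where tm: "tm \<in> ?I" "\<And>t. t \<in> ?I \<Longrightarrow> norm (u t - v t) \<le> norm (u tm - v tm)"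
    using continuous_attains_sup[of ?I "\<lambda>t. norm (u t - v t)"] a by auto
  define m where "m = norm (u tm - v tm)"
  have "norm ((\<lambda>t. u t - v t) tm - (\<lambda>t. u t - v t) t0) \<le> (L * m) * norm (tm - t0)"
  proof (rule differentiable_bound[where S="?I" and f'="\<lambda>t h. h *\<^sub>R (G (u t) - G (v t))"])
    fix t assume t: "t \<in> ?I"
    then show "((\<lambda>t. u t - v t) has_derivative (\<lambda>h. h *\<^sub>R (G (u t) - G (v t)))) (at t within ?I)"
      using has_vector_derivative_diff[OF u[of t] v[of t]] IJ
      unfolding has_vector_derivative_def by (blast intro: has_derivative_at_withinI)
    have "norm (G (u t) - G (v t)) \<le> L * norm (u t - v t)"
      using lipschitz_onD[OF L, of "u t" "v t"] inball[of t] t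
      by (auto simp: dist_norm dist_real_def abs_minus_commute)
    also have "\<dots> \<le> L * m" using tm(2)[OF t] L0 unfolding m_def by (intro mult_left_mono)
    finally have "norm (G (u t) - G (v t)) \<le> L * m" .
    then show "onorm (\<lambda>h. h *\<^sub>R (G (u t) - G (v t))) \<le> L * m"
      by (intro onorm_le) (auto simp: mult.commute intro: mult_left_mono)
  qed (use tm(1) a in auto)
  also have "\<dots> \<le> (L * m) * a"
    using tm(1) L0 unfolding m_def by (intro mult_left_mono) (auto simp: dist_real_def abs_minus_commute)
  also have "\<dots> \<le> m / 2" using mult_right_mono[OF aL, of m] unfolding m_def by (simp add: algebra_simps)
  finally have "m \<le> 0" using eq unfolding m_def by simp
  then have "u t = v t" if "\<bar>t - t0\<bar> \<le> a" for t
    using tm(2)[of t] that unfolding m_def by (auto simp: dist_real_def abs_minus_commute)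
  then show ?thesis using a(1) by blast
qed

text \<open>The set of times at which the two solutions agree is closed, open by \<open>ode_agree_near\<close>, and not empty, hence all
  of the connected set \<open>J\<close>.\<close>

lemma ode_unique:
  fixes G :: "'e::banach \<Rightarrow> 'e"
  assumes G: "lipschitz_on_balls G" and J: "open J" "is_interval J" "t0 \<in> J"
    and u: "\<And>t. t \<in> J \<Longrightarrow> (u has_vector_derivative G (u t)) (at t)"
    and v: "\<And>t. t \<in> J \<Longrightarrow> (v has_vector_derivative G (v t)) (at t)"
    and eq: "u t0 = v t0" and t: "t \<in> J"
  shows "u t = v t"
proof -
  let ?E = "{t \<in> J. u t = v t}"
  have "continuous_on J u" "continuous_on J v"
    by (intro continuous_at_imp_continuous_on ballI, rule has_vector_derivative_continuous,
        rule u v, assumption)+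
  then have "closedin (top_of_set J) {t \<in> J. u t - v t = 0}"
    by (intro continuous_closedin_preimage_constant continuous_intros)
  then have cl: "closedin (top_of_set J) ?E" by simp
  have "open ?E" unfolding open_dist
  proof safe
    fix x assume x: "x \<in> J" "u x = v x"
    obtain d where d: "d > 0" "\<And>t. \<bar>t - x\<bar> \<le> d \<Longrightarrow> u t = v t"
      using ode_agree_near[OF G J(1) x(1) u v x(2)] by blast
    obtain e where e: "e > 0" "ball x e \<subseteq> J" using J(1) x(1) open_contains_ball by blast
    show "\<exists>e>0. \<forall>y. dist y x < e \<longrightarrow> y \<in> ?E"
      using d e by (intro exI[of _ "min d e"]) (auto simp: dist_commute dist_real_def subset_iff)
  qed
  then have op: "openin (top_of_set J) ?E" by (simp add: open_openin_trans openin_open_eq J(1)) 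
  have "connected J" using J(2) is_interval_connected by blast
  then have "?E = {} \<or> ?E = J" using cl op connected_clopen by blast
  then show ?thesis using J(3) eq t by blast
qed

text \<open>By uniqueness any two solutions agree where both are defined, so all solutions through \<open>u0\<close> can
  be glued together.\<close>

lemma ode_maximal:
  fixes G :: "'e::banach \<Rightarrow> 'e"
  assumes G: "lipschitz_on_balls G"
  obtains I u where "ode_solution G u0 I u"
    "\<And>J v. ode_solution G u0 J v \<Longrightarrow> J \<subseteq> I \<and> (\<forall>t\<in>J. v t = u t)"
proof -
  define Sol where "Sol = {(J, v). ode_solution G u0 J v}"
  define I where "I = \<Union>(fst ` Sol)"
  have agree: "v t = w t" if "(J, v) \<in> Sol" "(K, w) \<in> Sol" "t \<in> J" "t \<in> K" for J K v w t
    by (rule ode_unique[OF G, of "J \<inter> K" 0])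
      (use that is_interval_Int in \<open>auto simp: Sol_def ode_solution_def\<close>)
  define u where "u t = (SOME x. \<exists>J v. (J, v) \<in> Sol \<and> t \<in> J \<and> x = v t)" for t
  have u_eq: "u t = v t" if "(J, v) \<in> Sol" "t \<in> J" for J v t
  proof -
    have "\<exists>x J v. (J, v) \<in> Sol \<and> t \<in> J \<and> x = v t" using that by blast
    from someI_ex[OF this] obtain K w where "(K, w) \<in> Sol" "t \<in> K" "u t = w t"
      unfolding u_def by auto
    then show ?thesis using agree[of K w J v t] that by simp
  qed
  obtain \<delta> where \<delta>: "\<delta> > 0" "\<And>t0 v. norm v \<le> norm u0 \<Longrightarrow> \<exists>u. u t0 = v \<and>
       (\<forall>t\<in>{t0-\<delta><..<t0+\<delta>}. (u has_vector_derivative G (u t)) (at t))"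
    using picard_local_existence[OF G] by blast
  obtain w where w: "w 0 = u0" "\<And>t. t \<in> {0-\<delta><..<0+\<delta>} \<Longrightarrow> (w has_vector_derivative G (w t)) (at t)"
    using \<delta>(2)[of u0 0] by auto
  have wS: "({-\<delta><..<\<delta>}, w) \<in> Sol"
    using w \<delta>(1) by (auto simp: Sol_def ode_solution_def is_interval_oo)
  have "ode_solution G u0 I u"
    unfolding ode_solution_def
  proof (intro conjI ballI)
    show "open I" unfolding I_def Sol_def ode_solution_def by auto
    show "0 \<in> I" using wS \<delta>(1) unfolding I_def by force
    show "u 0 = u0" using u_eq[OF wS] \<delta>(1) w(1) by auto
    have "connected I" unfolding I_def
      by (rule connected_Union) (auto simp: Sol_def ode_solution_def is_interval_connected)
    then show "is_interval I" using is_interval_connected_1 by blast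
    fix t assume "t \<in> I"
    then obtain J v where Jv: "(J, v) \<in> Sol" "t \<in> J" unfolding I_def by auto
    then have "open J" "(v has_vector_derivative G (v t)) (at t)"
      unfolding Sol_def ode_solution_def by auto
    then have "(u has_vector_derivative G (v t)) (at t)"
      using has_vector_derivative_transform_within_open[of v _ t J u] u_eq[OF Jv(1)] Jv(2) by simp
    then show "(u has_vector_derivative G (u t)) (at t)" using u_eq Jv by simp
  qed
  moreover have "J \<subseteq> I \<and> (\<forall>t\<in>J. v t = u t)" if "ode_solution G u0 J v" for J v
    using that u_eq[of J v] unfolding I_def Sol_def by force
  ultimately show ?thesis using that by blast
qed

text \<open>If the solution stopped before \<open>b\<close> while staying bounded, one could restart it close to the end point:
  the restarted solution lives for a time that depends on the bound alone and passes the end point.\<close>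

lemma ode_continuation:
  fixes G :: "'e::banach \<Rightarrow> 'e"
  assumes G: "lipschitz_on_balls G" and sol: "ode_solution G u0 I u"
    and max: "\<And>J v. ode_solution G u0 J v \<Longrightarrow> J \<subseteq> I"
    and bound: "\<And>t. t \<in> I \<Longrightarrow> 0 \<le> t \<Longrightarrow> t \<le> b \<Longrightarrow> norm (u t) \<le> R"
    and b: "b \<ge> 0"
  shows "{0..b} \<subseteq> I"
proof (rule ccontr)
  assume "\<not> {0..b} \<subseteq> I"
  then obtain x where x: "0 \<le> x" "x \<le> b" "x \<notin> I" by (meson atLeastAtMost_iff subsetI)
  have I: "open I" "is_interval I" "0 \<in> I" "u 0 = u0"
    and u: "\<And>t. t \<in> I \<Longrightarrow> (u has_vector_derivative G (u t)) (at t)"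
    using sol unfolding ode_solution_def by auto
  obtain \<delta> where \<delta>: "\<delta> > 0" "\<And>t0 v. norm v \<le> R \<Longrightarrow> \<exists>u. u t0 = v \<and>
       (\<forall>t\<in>{t0-\<delta><..<t0+\<delta>}. (u has_vector_derivative G (u t)) (at t))"
    using picard_local_existence[OF G] by blast
  have Iless: "t < x" if "t \<in> I" for t
  proof (rule ccontr)
    assume "\<not> t < x"
    then have "x \<in> I" using mem_is_interval_1_I[OF I(2,3) that] x by auto
    then show False using x by blast
  qed
  define \<beta> where "\<beta> = Sup I"
  have bdd: "bdd_above I" by (rule bdd_aboveI[of _ x]) (use Iless in force)
  have ne: "I \<noteq> {}" using I by auto
  have \<beta>x: "\<beta> \<le> x" unfolding \<beta>_def using Iless ne by (intro cSup_least less_imp_le)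
  obtain e where e: "e > 0" "ball 0 e \<subseteq> I" using I open_contains_ball by blast
  have \<beta>0: "\<beta> > 0"
  proof -
    have "e/2 \<in> I" using e by auto
    then show ?thesis using cSup_upper[OF _ bdd] e(1) unfolding \<beta>_def by force
  qed
  \<comment> \<open>Restart within \<open>\<delta>/2\<close> of the end point.\<close>
  have "\<exists>t\<in>I. max 0 (\<beta> - \<delta>/2) < t"
    using less_cSup_iff[OF ne bdd, of "max 0 (\<beta> - \<delta>/2)"] \<beta>0 \<delta>(1) unfolding \<beta>_def by auto
  then obtain t1 where t1: "t1 \<in> I" "t1 > 0" "t1 > \<beta> - \<delta>/2" by auto
  have "norm (u t1) \<le> R" using bound[of t1] t1 Iless[of t1] x by auto
  then obtain w where w: "w t1 = u t1"
    "\<And>t. t \<in> {t1-\<delta><..<t1+\<delta>} \<Longrightarrow> (w has_vector_derivative G (w t)) (at t)"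
    using \<delta>(2)[of "u t1" t1] by auto
  let ?J = "{t1-\<delta><..<t1+\<delta>}"
  have int: "is_interval (I \<inter> ?J)" using I(2) is_interval_Int is_interval_oo by blast
  have agree: "u t = w t" if "t \<in> I \<inter> ?J" for t
  proof (rule ode_unique[OF G _ int, of t1])
    show "open (I \<inter> ?J)" using I(1) by (simp add: open_Int)
    show "t1 \<in> I \<inter> ?J" using t1 \<delta>(1) by simp
  qed (use u w that in simp_all)
  define v where "v t = (if t \<in> I then u t else w t)" for t
  have vw: "v t = w t" if "t \<in> ?J" for t using that agree[of t] unfolding v_def by auto
  have "ode_solution G u0 (I \<union> ?J) v"
    unfolding ode_solution_def
  proof (intro conjI ballI)
    show "open (I \<union> ?J)" using I by auto
    show "0 \<in> I \<union> ?J" using I by auto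
    show "v 0 = u0" using I by (simp add: v_def)
    have "connected (I \<union> ?J)"
      by (rule connected_Un) (use I(2) t1 \<delta>(1) in \<open>auto simp: is_interval_connected\<close>)
    then show "is_interval (I \<union> ?J)" using is_interval_connected_1 by blast
    fix t assume "t \<in> I \<union> ?J"
    then consider "t \<in> I" | "t \<in> ?J" by blast
    then show "(v has_vector_derivative G (v t)) (at t)"
    proof cases
      case 1
      then have "(v has_vector_derivative G (u t)) (at t)"
        using has_vector_derivative_transform_within_open[OF u[OF 1] I(1) 1, of v] by (simp add: v_def)
      then show ?thesis using 1 by (simp add: v_def)
    next
      case 2
      then have "(v has_vector_derivative G (w t)) (at t)"
        using has_vector_derivative_transform_within_open[OF w(2)[OF 2], of ?J v] vw by auto
      then show ?thesis using vw[OF 2] by simp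
    qed
  qed
  then have "?J \<subseteq> I" using max by blast
  moreover have "t1 + \<delta>/2 \<in> ?J" using \<delta>(1) by auto
  ultimately have "t1 + \<delta>/2 \<le> \<beta>" using cSup_upper[OF _ bdd] unfolding \<beta>_def by blast
  then show False using t1(3) by simp
qed

section \<open>Waves on the torus\<close>

definition wave :: "int^'d \<Rightarrow> real^'d \<Rightarrow> complex" where
  "wave k x = exp (\<i> * of_real (freq_dot k x))"

lemma freq_dot_simps:
  "freq_dot (k + m) x = freq_dot k x + freq_dot m x"
  "freq_dot (k - m) x = freq_dot k x - freq_dot m x"
  "freq_dot (- k) x = - freq_dot k x"
  "freq_dot 0 x = 0"
  "freq_dot k (x + y) = freq_dot k x + freq_dot k y"
  by (simp_all add: freq_dot_def algebra_simps sum.distrib sum_subtractf sum_negf)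

lemma freq_dot_axis: "freq_dot k (axis j a) = of_int (k $ j) * a"
  unfolding freq_dot_def axis_def by (simp add: if_distrib cong: if_cong)

lemma bounded_linear_freq_dot: "bounded_linear (freq_dot k)"
  unfolding freq_dot_def
  by (intro bounded_linear_sum bounded_linear_compose[OF bounded_linear_mult_right] bounded_linear_vec_nth)

lemma wave_add: "wave (k + m) x = wave k x * wave m x"
  by (simp add: wave_def freq_dot_simps distrib_left exp_add)

lemma wave_0 [simp]: "wave 0 x = 1"
  by (simp add: wave_def freq_dot_simps)

lemma wave_uminus: "wave (- k) x = cnj (wave k x)"
  by (simp add: wave_def freq_dot_simps exp_cnj)

lemma norm_wave [simp]: "norm (wave k x) = 1"
  by (simp add: wave_def)

lemma wave_periodic: "wave k (x + axis j (2 * pi)) = wave k x"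
proof -
  have "exp (\<i> * of_real (of_int (k $ j) * (2 * pi))) = (1::complex)"
    by (simp add: exp_eq_1)
  then show ?thesis
    by (simp add: wave_def freq_dot_simps freq_dot_axis distrib_left exp_add)
qed

lemma wave_has_derivative:
  "(wave k has_derivative (\<lambda>h. \<i> * of_real (freq_dot k h) * wave k x)) (at x within S)"
proof -
  have "((\<lambda>x. \<i> * complex_of_real (freq_dot k x)) has_derivative (\<lambda>h. \<i> * of_real (freq_dot k h))) (at x within S)"
    by (intro bounded_linear_imp_has_derivative bounded_linear_compose[OF bounded_linear_mult_right]
        bounded_linear_compose[OF bounded_linear_of_real] bounded_linear_freq_dot)
  from has_derivative_compose[OF this DERIV_exp[unfolded has_field_derivative_def]] show ?thesis
    unfolding wave_def by (simp add: mult.commute)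
qed

lemma continuous_on_wave [continuous_intros]: "continuous_on S (wave k)"
  by (rule has_derivative_continuous_on[OF wave_has_derivative])

section \<open>Fourier coefficients of scalar functions\<close>

text \<open>The scalar, complex-valued counterpart of \<open>fourier_coeff\<close>: products and derivatives of single components have
  to be expanded before they are assembled into vectors.\<close>

definition fcoeff :: "(real^'d \<Rightarrow> complex) \<Rightarrow> int^'d \<Rightarrow> complex" where
  "fcoeff g k = (LINT x:torus_cell|lebesgue. wave (- k) x * g x) / of_real ((2 * pi) ^ CARD('d))"

lemma fourier_coeff_nth: "fourier_coeff U k $ i = fcoeff (\<lambda>x. of_real (U x $ i)) k"
  by (simp add: fourier_coeff_def fcoeff_def wave_def freq_dot_simps)

lemma fcoeff_cnj: "fcoeff (\<lambda>x. cnj (g x)) k = cnj (fcoeff g (- k))"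
proof -
  have "(LINT x:torus_cell|lebesgue. wave (- k) x * cnj (g x)) =
      (LINT x|lebesgue. cnj (indicator torus_cell x *\<^sub>R (wave k x * g x)))"
    by (simp add: set_lebesgue_integral_def wave_uminus)
  also have "\<dots> = cnj (LINT x:torus_cell|lebesgue. wave k x * g x)"
    unfolding set_lebesgue_integral_def by (rule Bochner_Integration.integral_cnj)
  finally show ?thesis by (simp add: fcoeff_def)
qed

lemma fcoeff_times_wave: "fcoeff (\<lambda>x. g x * wave m x) k = fcoeff g (k - m)"
proof -
  have "wave (- k) x * (g x * wave m x) = wave (- (k - m)) x * g x" for x
  proof -
    have "- (k - m) = - k + m" by simp
    then have "wave (- (k - m)) x * g x = wave (- k) x * wave m x * g x" by (simp only: wave_add)
    then show ?thesis by (simp only: mult_ac)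
  qed
  then show ?thesis unfolding fcoeff_def by presburger
qed

lemma set_integrable_cell:
  fixes g :: "real^'d \<Rightarrow> 'b::euclidean_space"
  assumes "continuous_on UNIV g"
  shows "set_integrable lebesgue torus_cell g"
  unfolding torus_cell_def
  by (rule absolutely_integrable_continuous) (use assms continuous_on_subset in blast)

lemma set_integrable_fcoeff:
  assumes "continuous_on UNIV g"
  shows "set_integrable lebesgue torus_cell (\<lambda>x. wave (- k) x * g x)"
  by (intro set_integrable_cell continuous_intros assms)

lemma fcoeff_add:
  assumes "continuous_on UNIV f" "continuous_on UNIV g"
  shows "fcoeff (\<lambda>x. f x + g x) k = fcoeff f k + fcoeff g k"
  unfolding fcoeff_def distrib_left
  by (simp add: set_integral_add set_integrable_fcoeff assms add_divide_distrib)

lemma fcoeff_cmult: "fcoeff (\<lambda>x. c * g x) k = c * fcoeff g k"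
  unfolding fcoeff_def by (simp add: mult.left_commute[of _ c])

lemma fcoeff_sum:
  assumes "finite S" "\<And>m. m \<in> S \<Longrightarrow> continuous_on UNIV (f m)"
  shows "fcoeff (\<lambda>x. \<Sum>m\<in>S. f m x) k = (\<Sum>m\<in>S. fcoeff (f m) k)"
  using assms
proof (induction S rule: finite_induct)
  case empty
  then show ?case by (simp add: fcoeff_def)
next
  case (insert a S)
  then show ?case by (simp add: fcoeff_add continuous_on_sum)
qed

lemma integral_lborel_prod:
  fixes f :: "'a::euclidean_space \<Rightarrow> real \<Rightarrow> complex"
  assumes f: "\<And>b. b \<in> Basis \<Longrightarrow> integrable lborel (f b)"
  shows "(LINT x|lborel. (\<Prod>b\<in>Basis. f b (x \<bullet> b))) = (\<Prod>b\<in>Basis. LINT y|lborel. f b y)"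
proof -
  interpret product_sigma_finite "\<lambda>_::'a. lborel::real measure" by standard
  have [measurable]: "f b \<in> borel_measurable borel" if "b \<in> Basis" for b
    using f[OF that] by (simp add: borel_measurable_integrable)
  have "(LINT x|lborel. (\<Prod>b\<in>Basis. f b (x \<bullet> b))) =
      (LINT x|(\<Pi>\<^sub>M b\<in>Basis. lborel). (\<Prod>b\<in>Basis. f b ((\<Sum>c\<in>Basis. x c *\<^sub>R c) \<bullet> b)))"
    by (subst lborel_eq, subst integral_distr) auto
  also have "\<dots> = (LINT x|(\<Pi>\<^sub>M b\<in>Basis. lborel). (\<Prod>b\<in>Basis. f b (x b)))"
    by (intro Bochner_Integration.integral_cong prod.cong) simp_all
  also have "\<dots> = (\<Prod>b\<in>Basis. LINT y|lborel. f b y)"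
    by (rule product_integral_prod) (use f in auto)
  finally show ?thesis .
qed

lemma integral_wave_1d:
  fixes c :: int
  defines "f \<equiv> (\<lambda>y::real. indicator {0..2*pi} y *\<^sub>R exp (\<i> * of_real (of_int c * y)))"
  shows "has_bochner_integral lborel f (if c = 0 then of_real (2*pi) else 0)"
proof (cases "c = 0")
  case True
  have "has_bochner_integral lborel (\<lambda>y. indicator {0..2*pi} y *\<^sub>R (1::complex)) (of_real (2*pi) - of_real 0)"
    by (rule has_bochner_integral_FTC_Icc) (auto intro!: derivative_eq_intros)
  then show ?thesis using True by (simp add: f_def)
next
  case False
  let ?F = "\<lambda>y::real. exp (\<i> * of_int c * of_real y) / (\<i> * of_int c) :: complex"
  have "has_bochner_integral lborel f (?F (2*pi) - ?F 0)"
    unfolding f_def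
  proof (rule has_bochner_integral_FTC_Icc)
    fix y :: real
    have "((\<lambda>z. exp (\<i> * of_int c * z) / (\<i> * of_int c)) has_field_derivative
        exp (\<i> * of_int c * of_real y)) (at (of_real y))"
      using False by (auto intro!: derivative_eq_intros)
    then show "(?F has_vector_derivative exp (\<i> * of_real (of_int c * y))) (at y within {0..2*pi})"
      using has_vector_derivative_real_field has_vector_derivative_at_within by (fastforce simp: mult.assoc)
  qed (auto intro!: continuous_intros)
  moreover have "exp (\<i> * of_int c * of_real (2*pi)) = (1::complex)"
    by (simp add: exp_eq_1)
  ultimately show ?thesis using False by simp
qed

text \<open>Lebesgue measure on the cell is a product measure and a wave is a product of functions of one variable, so
  orthogonality reduces to one dimension.\<close>

lemma integral_wave:
  fixes p :: "int^'d"
  shows "(LINT x:torus_cell|lebesgue. wave p x) = (if p = 0 then of_real ((2*pi) ^ CARD('d)) else 0)"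
proof -
  define f where "f = (\<lambda>(b::real^'d) y. indicator {0..2*pi} y *\<^sub>R exp (\<i> * of_real (of_int (p $ axis_index b) * y)) :: complex)"
  have f: "has_bochner_integral lborel (f b) (if p $ axis_index b = 0 then of_real (2*pi) else 0)" for b
    unfolding f_def by (rule integral_wave_1d)
  have Basis: "(Basis :: (real^'d) set) = range (\<lambda>i. axis i 1)" by (auto simp: Basis_vec_def)
  have inj: "inj (\<lambda>i::'d. axis i (1::real))" by (auto simp: inj_on_def axis_eq_axis)
  have split: "indicator torus_cell x *\<^sub>R wave p x = (\<Prod>b\<in>Basis. f b (x \<bullet> b))" for x
  proof -
    have "(\<Prod>b\<in>Basis. f b (x \<bullet> b)) = (\<Prod>i\<in>UNIV. f (axis i 1) (x $ i))"
      unfolding Basis prod.reindex[OF inj] by (simp add: inner_axis)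
    also have "\<dots> = (\<Prod>i\<in>UNIV. indicator {0..2*pi} (x $ i) *\<^sub>R exp (\<i> * of_real (of_int (p $ i) * x $ i)))"
      by (simp add: f_def axis_index_axis)
    also have "\<dots> = (\<Prod>i\<in>UNIV. of_real (indicator {0..2*pi} (x $ i))) * (\<Prod>i\<in>UNIV. exp (\<i> * of_real (of_int (p $ i) * x $ i)))"
      by (simp add: scaleR_conv_of_real prod.distrib)
    also have "(\<Prod>i\<in>UNIV. exp (\<i> * of_real (of_int (p $ i) * x $ i))) = wave p x"
      by (simp add: wave_def freq_dot_def sum_distrib_left exp_sum)
    also have "(\<Prod>i\<in>UNIV. complex_of_real (indicator {0..2*pi} (x $ i))) = of_real (indicator torus_cell x)"
    proof (cases "x \<in> torus_cell")
      case True
      then show ?thesis by (simp add: torus_cell_def mem_box_cart indicator_def)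
    next
      case False
      then obtain i where "x $ i \<notin> {0..2*pi}" by (auto simp: torus_cell_def mem_box_cart)
      then have "(\<Prod>i\<in>UNIV. complex_of_real (indicator {0..2*pi} (x $ i))) = 0"
        by (intro prod_zero bexI[of _ i]) (simp_all add: indicator_def del: atLeastAtMost_iff)
      then show ?thesis using False by simp
    qed
    finally show ?thesis by (simp add: scaleR_conv_of_real)
  qed
  have "(LINT x:torus_cell|lebesgue. wave p x) = (LINT x|lborel. indicator torus_cell x *\<^sub>R wave p x)"
  proof -
    have [measurable]: "wave p \<in> borel_measurable borel"
      by (intro borel_measurable_continuous_onI continuous_on_wave)
    show ?thesis unfolding set_lebesgue_integral_def torus_cell_def
      by (rule integral_completion) measurable
  qed
  also have "\<dots> = (\<Prod>b\<in>Basis. LINT y|lborel. f b y)"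
    unfolding split by (rule integral_lborel_prod) (use f has_bochner_integral_iff in blast)
  also have "\<dots> = (\<Prod>b\<in>Basis. if p $ axis_index (b::real^'d) = 0 then of_real (2*pi) else 0)"
    by (intro prod.cong refl has_bochner_integral_integral_eq f)
  also have "\<dots> = (\<Prod>i\<in>UNIV. if p $ i = 0 then of_real (2*pi) else 0)"
    unfolding Basis prod.reindex[OF inj] by (simp add: axis_index_axis)
  also have "\<dots> = (if p = 0 then of_real ((2*pi) ^ CARD('d)) else 0)"
  proof (cases "p = 0")
    case False
    then obtain i where "p $ i \<noteq> 0" by (auto simp: vec_eq_iff)
    then have "(\<Prod>i\<in>UNIV. if p $ i = 0 then complex_of_real (2*pi) else 0) = 0"
      by (intro prod_zero) auto
    then show ?thesis using False by simp
  qed simp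
  finally show ?thesis .
qed

lemma fcoeff_wave: "fcoeff (wave m) k = (if k = m then 1 else 0)"
proof -
  have "fcoeff (wave m) k = (LINT x:torus_cell|lebesgue. wave (m - k) x) / of_real ((2 * pi) ^ CARD('a))"
    unfolding fcoeff_def by (simp flip: wave_add)
  then show ?thesis by (simp add: integral_wave)
qed

lemma fcoeff_wave_sum:
  assumes "finite S"
  shows "fcoeff (\<lambda>x. \<Sum>m\<in>S. c m * wave m x) k = (if k \<in> S then c k else 0)"
proof -
  have "fcoeff (\<lambda>x. \<Sum>m\<in>S. c m * wave m x) k = (\<Sum>m\<in>S. c m * (if k = m then 1 else 0))"
    by (subst fcoeff_sum[OF assms]) (auto intro!: continuous_intros simp: fcoeff_cmult fcoeff_wave)
  then show ?thesis using assms by (simp add: if_distrib cong: if_cong)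
qed

section \<open>Trigonometric polynomials\<close>

definition freq_box :: "nat \<Rightarrow> (int^'d) set" where
  "freq_box N = {k. \<forall>j. \<bar>k $ j\<bar> \<le> int N}"

lemma finite_freq_box [simp]: "finite (freq_box N :: (int^'d) set)"
proof -
  have "freq_box N \<subseteq> vec_lambda ` (PiE (UNIV::'d set) (\<lambda>_. {- int N..int N}))"
  proof
    fix k :: "int^'d" assume "k \<in> freq_box N"
    then have "vec_nth k \<in> PiE UNIV (\<lambda>_. {- int N..int N})"
      by (auto simp: freq_box_def abs_le_iff PiE_iff minus_le_iff)
    then show "k \<in> vec_lambda ` (PiE (UNIV::'d set) (\<lambda>_. {- int N..int N}))"
      by (metis image_eqI vec_nth_inverse)
  qed
  then show ?thesis by (rule finite_subset) (intro finite_imageI finite_PiE; simp)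
qed

lemma freq_box_mono: "N \<le> M \<Longrightarrow> freq_box N \<subseteq> freq_box M"
  unfolding freq_box_def by (auto intro: order_trans)

lemma freq_box_uminus: "- k \<in> freq_box N \<longleftrightarrow> k \<in> freq_box N"
  by (simp add: freq_box_def)

lemma freq_box_0 [simp]: "0 \<in> freq_box N"
  by (simp add: freq_box_def)

lemma freq_box_add: "k \<in> freq_box N \<Longrightarrow> m \<in> freq_box M \<Longrightarrow> k + m \<in> freq_box (N + M)"
  unfolding freq_box_def by (auto intro!: order_trans[OF abs_triangle_ineq] add_mono)

definition trig_poly :: "nat \<Rightarrow> (real^'d \<Rightarrow> complex) \<Rightarrow> bool" where
  "trig_poly N g \<longleftrightarrow> (\<exists>c. \<forall>x. g x = (\<Sum>k\<in>freq_box N. c k * wave k x))"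

text \<open>By orthogonality the coefficients in the defining sum are the Fourier coefficients. The second fact allows
  sums over boxes of different size to be compared.\<close>

lemma trig_poly_expand: "trig_poly N g \<Longrightarrow> g x = (\<Sum>k\<in>freq_box N. fcoeff g k * wave k x)"
  and trig_poly_fcoeff_outside: "trig_poly N g \<Longrightarrow> k \<notin> freq_box N \<Longrightarrow> fcoeff g k = 0"
proof -
  assume "trig_poly N g"
  then obtain c where c: "g = (\<lambda>x. \<Sum>k\<in>freq_box N. c k * wave k x)"
    unfolding trig_poly_def by auto
  have *: "fcoeff g k = (if k \<in> freq_box N then c k else 0)" for k
    unfolding c by (rule fcoeff_wave_sum) simp
  have "g x = (\<Sum>k\<in>freq_box N. c k * wave k x)" by (simp add: c)
  also have "\<dots> = (\<Sum>k\<in>freq_box N. fcoeff g k * wave k x)"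
    by (intro sum.cong refl) (simp add: *)
  finally show "g x = (\<Sum>k\<in>freq_box N. fcoeff g k * wave k x)" .
  show "k \<notin> freq_box N \<Longrightarrow> fcoeff g k = 0" by (simp add: *)
qed

lemma trig_poly_of_sum:
  assumes "S \<subseteq> freq_box N" "\<And>x. g x = (\<Sum>k\<in>S. c k * wave k x)"
  shows "trig_poly N g"
  unfolding trig_poly_def
proof (intro exI allI)
  fix x
  show "g x = (\<Sum>k\<in>freq_box N. (if k \<in> S then c k else 0) * wave k x)"
    unfolding assms(2)
    by (rule sum.mono_neutral_cong_left) (use assms(1) in auto)
qed

lemma trig_poly_mono: "trig_poly N g \<Longrightarrow> N \<le> M \<Longrightarrow> trig_poly M g"
  by (rule trig_poly_of_sum[OF freq_box_mono trig_poly_expand])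

lemma trig_poly_const: "trig_poly N (\<lambda>x. c)"
  by (rule trig_poly_of_sum[of "{0}" _ _ "\<lambda>_. c"]) auto

lemma trig_poly_cmult: "trig_poly N g \<Longrightarrow> trig_poly N (\<lambda>x. c * g x)"
  by (rule trig_poly_of_sum[of "freq_box N" _ _ "\<lambda>k. c * fcoeff g k"])
    (simp_all add: trig_poly_expand[of N g] sum_distrib_left mult.assoc)

lemma trig_poly_add: "trig_poly N f \<Longrightarrow> trig_poly N g \<Longrightarrow> trig_poly N (\<lambda>x. f x + g x)"
  by (rule trig_poly_of_sum[of "freq_box N" _ _ "\<lambda>k. fcoeff f k + fcoeff g k"])
    (auto simp: trig_poly_expand[of N f] trig_poly_expand[of N g] distrib_right sum.distrib)

lemma trig_poly_sum:
  assumes "finite S" "\<And>m. m \<in> S \<Longrightarrow> trig_poly N (f m)"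
  shows "trig_poly N (\<lambda>x. \<Sum>m\<in>S. f m x)"
  using assms by (induction S rule: finite_induct) (auto intro: trig_poly_const trig_poly_add)

lemma trig_poly_cnj:
  assumes "trig_poly N f"
  shows "trig_poly N (\<lambda>x. cnj (f x))"
proof (rule trig_poly_of_sum[of "freq_box N" _ _ "\<lambda>k. cnj (fcoeff f (-k))"])
  fix x
  have "cnj (f x) = (\<Sum>k\<in>freq_box N. cnj (fcoeff f k) * wave (-k) x)"
    by (subst trig_poly_expand[OF assms]) (simp add: wave_uminus)
  also have "\<dots> = (\<Sum>k\<in>freq_box N. cnj (fcoeff f (-k)) * wave k x)"
    by (rule sum.reindex_bij_witness[of _ uminus uminus]) (auto simp: freq_box_uminus)
  finally show "cnj (f x) = (\<Sum>k\<in>freq_box N. cnj (fcoeff f (-k)) * wave k x)" .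
qed simp

lemma trig_poly_Re: "trig_poly N f \<Longrightarrow> trig_poly N (\<lambda>x. of_real (Re (f x)))"
proof -
  assume f: "trig_poly N f"
  have "trig_poly N (\<lambda>x. (1/2) * (f x + cnj (f x)))"
    by (intro trig_poly_cmult trig_poly_add trig_poly_cnj f)
  then show ?thesis by (simp add: complex_add_cnj)
qed

lemma trig_poly_has_derivative:
  assumes "trig_poly N g"
  shows "(g has_derivative (\<lambda>h. \<Sum>k\<in>freq_box N. \<i> * of_real (freq_dot k h) * fcoeff g k * wave k x)) (at x)"
proof -
  have "((\<lambda>x. \<Sum>k\<in>freq_box N. fcoeff g k * wave k x) has_derivative
     (\<lambda>h. \<Sum>k\<in>freq_box N. fcoeff g k * (\<i> * of_real (freq_dot k h) * wave k x))) (at x)"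
    by (intro has_derivative_sum has_derivative_mult_right wave_has_derivative)
  moreover have "(\<lambda>x. \<Sum>k\<in>freq_box N. fcoeff g k * wave k x) = g"
    using trig_poly_expand[OF assms] by auto
  ultimately show ?thesis by (simp add: mult_ac)
qed

lemma trig_poly_continuous: "trig_poly N g \<Longrightarrow> continuous_on S g"
  using has_derivative_continuous[OF trig_poly_has_derivative] continuous_at_imp_continuous_on by blast

lemma trig_poly_periodic: "trig_poly N g \<Longrightarrow> g (x + axis j (2*pi)) = g x"
  using trig_poly_expand[of N g x] trig_poly_expand[of N g "x + axis j (2*pi)"]
  by (simp add: wave_periodic)

text \<open>Multiplication by a wave shifts the coefficients, so a product with a trigonometric polynomial is a finite
  convolution.\<close>

lemma fcoeff_mult:
  assumes f: "continuous_on UNIV f" and g: "trig_poly M g"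
  shows "fcoeff (\<lambda>x. f x * g x) k = (\<Sum>m\<in>freq_box M. fcoeff f (k - m) * fcoeff g m)"
proof -
  have "(\<lambda>x. f x * g x) = (\<lambda>x. \<Sum>m\<in>freq_box M. fcoeff g m * (f x * wave m x))"
  proof
    fix x show "f x * g x = (\<Sum>m\<in>freq_box M. fcoeff g m * (f x * wave m x))"
      by (subst trig_poly_expand[OF g]) (simp add: sum_distrib_left mult_ac)
  qed
  then have "fcoeff (\<lambda>x. f x * g x) k = (\<Sum>m\<in>freq_box M. fcoeff (\<lambda>x. fcoeff g m * (f x * wave m x)) k)"
    using f by (simp add: fcoeff_sum continuous_intros)
  then show ?thesis by (simp add: fcoeff_cmult fcoeff_times_wave mult.commute)
qed

lemma trig_poly_mult:
  assumes f: "trig_poly N f" and g: "trig_poly M g"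
  shows "trig_poly (N + M) (\<lambda>x. f x * g x)"
proof -
  have "trig_poly (N + M) (\<lambda>x. \<Sum>k\<in>freq_box N. \<Sum>m\<in>freq_box M. (fcoeff f k * fcoeff g m) * wave (k + m) x)"
  proof (intro trig_poly_sum finite_freq_box trig_poly_cmult)
    fix k m :: "int^'a" assume "k \<in> freq_box N" "m \<in> freq_box M"
    then show "trig_poly (N + M) (wave (k + m))"
      by (intro trig_poly_of_sum[of "{k+m}" _ _ "\<lambda>_. 1"]) (auto intro: freq_box_add)
  qed
  moreover have "(\<Sum>k\<in>freq_box N. \<Sum>m\<in>freq_box M. (fcoeff f k * fcoeff g m) * wave (k + m) x) = f x * g x" for x
    by (subst trig_poly_expand[OF f], subst trig_poly_expand[OF g])
      (simp add: sum_product wave_add mult_ac)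
  ultimately show ?thesis by simp
qed

section \<open>Sampling on a uniform grid\<close>

definition grid :: "nat \<Rightarrow> ('d \<Rightarrow> nat) set" where
  "grid N = PiE UNIV (\<lambda>_. {..2*N})"

definition grid_point :: "nat \<Rightarrow> ('d \<Rightarrow> nat) \<Rightarrow> real^'d" where
  "grid_point N \<gamma> = (\<chi> j. 2 * pi * real (\<gamma> j) / real (2*N+1))"

lemma finite_grid [simp]: "finite (grid N :: ('d::finite \<Rightarrow> nat) set)"
  unfolding grid_def by (intro finite_PiE) auto

lemma grid_orthogonality_1d:
  fixes c :: int
  assumes c: "\<bar>c\<bar> \<le> 2 * int N"
  shows "(\<Sum>r\<le>2*N. exp (\<i> * of_real (of_int c * (2 * pi * real r / real (2*N+1))))) =
    (if c = 0 then of_nat (2*N+1) else (0::complex))"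
proof (cases "c = 0")
  case False
  define z where "z = exp (\<i> * of_real (of_int c * (2 * pi / real (2*N+1))))"
  have z1: "z \<noteq> 1"
  proof
    assume "z = 1"
    then obtain n :: int where n: "of_int c * (2 * pi / real (2*N+1)) = of_int (2 * n) * pi"
      unfolding z_def exp_eq_1 by auto
    then have "(2 * pi) * real_of_int c = (2 * pi) * (of_int n * real (2*N+1))" by (simp add: field_simps)
    then have "real_of_int c = of_int n * real (2*N+1)" by (subst (asm) mult_cancel_left) simp
    then have "real_of_int c = real_of_int (n * (2 * int N + 1))" by simp
    then have "c = n * (2 * int N + 1)" by (simp only: of_int_eq_iff)
    moreover then have "n \<noteq> 0" using False by auto
    ultimately have "\<bar>c\<bar> \<ge> 2 * int N + 1"
      by (simp add: abs_mult)
    then show False using c by simp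
  qed
  have "exp (\<i> * of_real (of_int c * (2 * pi * real r / real (2*N+1)))) = z ^ r" for r
  proof -
    have "of_int c * (2 * pi * real r / real (2*N+1)) = real r * (of_int c * (2 * pi / real (2*N+1)))"
      by simp
    then have "\<i> * complex_of_real (of_int c * (2 * pi * real r / real (2*N+1))) =
        of_nat r * (\<i> * of_real (of_int c * (2 * pi / real (2*N+1))))"
      by (metis mult.left_commute of_real_mult of_real_of_nat_eq)
    then show ?thesis unfolding z_def by (simp only: exp_of_nat_mult)
  qed
  then have "(\<Sum>r\<le>2*N. exp (\<i> * of_real (of_int c * (2 * pi * real r / real (2*N+1))))) = (\<Sum>r<2*N+1. z ^ r)"
    by (simp add: lessThan_Suc_atMost)
  also have "\<dots> = (z ^ (2*N+1) - 1) / (z - 1)" by (rule geometric_sum[OF z1])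
  also have "z ^ (2*N+1) = exp (of_nat (2*N+1) * (\<i> * of_real (of_int c * (2 * pi / real (2*N+1)))))"
    unfolding z_def by (rule exp_of_nat_mult[symmetric])
  also have "of_nat (2*N+1) * (\<i> * complex_of_real (of_int c * (2 * pi / real (2*N+1)))) = \<i> * of_real (of_int c * 2 * pi)"
  proof -
    have "real (2*N+1) * (of_int c * (2 * pi / real (2*N+1))) = of_int c * 2 * pi" by simp
    then show ?thesis
      by (metis mult.left_commute of_real_mult of_real_of_nat_eq)
  qed
  also have "exp (\<i> * complex_of_real (of_int c * 2 * pi)) = 1"
    by (simp add: exp_eq_1)
  finally show ?thesis using False by simp
qed simp

text \<open>With \<open>2N+1\<close> points per direction the discrete sums of the waves behave like their integrals as long as no
  frequency exceeds \<open>2N\<close> in absolute value, which differences of two frequencies in the box do not.\<close>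

lemma grid_orthogonality:
  fixes p :: "int^'d"
  assumes p: "\<And>j. \<bar>p $ j\<bar> \<le> 2 * int N"
  shows "(\<Sum>\<gamma>\<in>grid N. wave p (grid_point N \<gamma>)) = (if p = 0 then of_nat ((2*N+1) ^ CARD('d)) else 0)"
proof -
  have "(\<Sum>\<gamma>\<in>grid N. wave p (grid_point N \<gamma>)) =
      (\<Sum>\<gamma>\<in>grid N. \<Prod>j\<in>UNIV. exp (\<i> * of_real (of_int (p $ j) * (2 * pi * real (\<gamma> j) / real (2*N+1)))))"
    by (simp add: wave_def freq_dot_def grid_point_def sum_distrib_left exp_sum)
  also have "\<dots> = (\<Prod>j\<in>UNIV. \<Sum>r\<le>2*N. exp (\<i> * of_real (of_int (p $ j) * (2 * pi * real r / real (2*N+1)))))"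
    unfolding grid_def by (rule prod_sum_PiE[symmetric]) auto
  also have "\<dots> = (\<Prod>j\<in>UNIV. if p $ j = 0 then of_nat (2*N+1) else 0)"
    by (intro prod.cong refl grid_orthogonality_1d p)
  also have "\<dots> = (if p = 0 then of_nat ((2*N+1) ^ CARD('d)) else 0)"
  proof (cases "p = 0")
    case False
    then obtain i where "p $ i \<noteq> 0" by (auto simp: vec_eq_iff)
    then have "(\<Prod>i\<in>UNIV. if p $ i = 0 then of_nat (2*N+1) else (0::complex)) = 0"
      by (intro prod_zero) auto
    then show ?thesis using False by simp
  qed simp
  finally show ?thesis .
qed

text \<open>The coefficients of a trigonometric polynomial are finite linear combinations of its point values. This is what
  converts pointwise information about a solution into information about its coefficients.\<close>

lemma fcoeff_sample:
  fixes g :: "real^'d \<Rightarrow> complex"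
  assumes g: "trig_poly N g" and k: "k \<in> freq_box N"
  shows "fcoeff g k = (\<Sum>\<gamma>\<in>grid N. g (grid_point N \<gamma>) * wave (- k) (grid_point N \<gamma>)) / of_nat ((2*N+1) ^ CARD('d))"
proof -
  have "(\<Sum>\<gamma>\<in>grid N. g (grid_point N \<gamma>) * wave (- k) (grid_point N \<gamma>)) =
      (\<Sum>\<gamma>\<in>grid N. \<Sum>m\<in>freq_box N. fcoeff g m * wave (m - k) (grid_point N \<gamma>))"
    by (subst trig_poly_expand[OF g]) (simp add: sum_distrib_right mult.assoc flip: wave_add)
  also have "\<dots> = (\<Sum>m\<in>freq_box N. fcoeff g m * (\<Sum>\<gamma>\<in>grid N. wave (m - k) (grid_point N \<gamma>)))"
    by (subst sum.swap) (simp add: sum_distrib_left)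
  also have "\<dots> = (\<Sum>m\<in>freq_box N. fcoeff g m * (if m = k then of_nat ((2*N+1) ^ CARD('d)) else 0))"
  proof (intro sum.cong refl arg_cong2[where f="(*)"])
    fix m :: "int^'d" assume m: "m \<in> freq_box N"
    \<comment> \<open>No aliasing: \<open>m - k\<close> is congruent to \<open>0\<close> modulo \<open>2N+1\<close> only if it is \<open>0\<close>.\<close>
    have "\<bar>(m - k) $ j\<bar> \<le> 2 * int N" for j
    proof -
      have "\<bar>m $ j\<bar> \<le> int N" "\<bar>k $ j\<bar> \<le> int N" using m k by (auto simp: freq_box_def)
      then show ?thesis using abs_triangle_ineq4[of "m $ j" "k $ j"] by simp
    qed
    from grid_orthogonality[of "m - k", OF this]
    show "(\<Sum>\<gamma>\<in>grid N. wave (m - k) (grid_point N \<gamma>)) = (if m = k then of_nat ((2*N+1) ^ CARD('d)) else 0)"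
      by simp
  qed
  also have "\<dots> = fcoeff g k * of_nat ((2*N+1) ^ CARD('d))"
    using k by (simp add: if_distrib cong: if_cong)
  finally show ?thesis by (simp del: of_nat_power of_nat_add of_nat_mult)
qed

section \<open>Fourier weights\<close>

definition fnorm :: "int^'d \<Rightarrow> real" where
  "fnorm k = norm (\<chi> j. real_of_int (k $ j))"

lemma fnorm_nonneg [simp]: "fnorm k \<ge> 0" by (simp add: fnorm_def)

lemma fnorm_0 [simp]: "fnorm 0 = 0"
proof -
  have "(\<chi> j. real_of_int ((0::int^'d) $ j)) = 0" by (simp add: vec_eq_iff)
  then show ?thesis by (simp add: fnorm_def)
qed

lemma fnorm_add: "fnorm (k + m) \<le> fnorm k + fnorm m"
proof -
  have "(\<chi> j. real_of_int ((k + m) $ j)) = (\<chi> j. real_of_int (k $ j)) + (\<chi> j. real_of_int (m $ j))"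
    by (simp add: vec_eq_iff)
  then show ?thesis by (simp add: fnorm_def norm_triangle_ineq)
qed

lemma component_le_fnorm: "\<bar>real_of_int (k $ j)\<bar> \<le> fnorm k"
  using component_le_norm_cart[of "\<chi> j. real_of_int (k $ j)" j] by (simp add: fnorm_def)

text \<open>This form gives access to the triangle inequality.\<close>

lemma japanese_bracket_eq: "japanese_bracket k = norm (1::real, \<chi> j. real_of_int (k $ j))"
  by (simp add: japanese_bracket_def norm_Pair norm_vec_def L2_set_def sum_nonneg)

lemma japanese_bracket_ge_1 [simp]: "japanese_bracket k \<ge> 1"
  by (simp add: japanese_bracket_def sum_nonneg)

lemma japanese_bracket_pos [simp]: "japanese_bracket k > 0"
  using japanese_bracket_ge_1[of k] by linarith

lemma japanese_bracket_nonneg [simp]: "japanese_bracket k \<ge> 0"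
  using japanese_bracket_ge_1[of k] by linarith

lemma japanese_bracket_sq: "(japanese_bracket k)\<^sup>2 = 1 + (fnorm k)\<^sup>2"
  by (simp add: japanese_bracket_def fnorm_def norm_vec_def L2_set_def sum_nonneg)

lemma fnorm_le_japanese_bracket: "fnorm k \<le> japanese_bracket k"
  by (rule power2_le_imp_le) (simp_all add: japanese_bracket_sq)

lemma japanese_bracket_mono: "fnorm k \<le> fnorm m \<Longrightarrow> japanese_bracket k \<le> japanese_bracket m"
  by (rule power2_le_imp_le) (simp_all add: japanese_bracket_sq power_mono)

lemma japanese_bracket_diff: "\<bar>japanese_bracket k - japanese_bracket m\<bar> \<le> fnorm (k - m)"
proof -
  have "(1::real, \<chi> j. real_of_int (k $ j)) - (1, \<chi> j. real_of_int (m $ j)) = (0, \<chi> j. real_of_int ((k - m) $ j))"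
    by (simp add: vec_eq_iff)
  then show ?thesis
    using norm_triangle_ineq3[of "(1::real, \<chi> j. real_of_int (k $ j))" "(1, \<chi> j. real_of_int (m $ j))"]
    by (simp add: japanese_bracket_eq fnorm_def norm_Pair)
qed

lemma japanese_bracket_triangle: "japanese_bracket k \<le> japanese_bracket m + japanese_bracket (k - m)"
  using japanese_bracket_diff[of k m] fnorm_le_japanese_bracket[of "k - m"] by linarith

lemma powr_diff_bound:
  fixes x y \<sigma> :: real
  assumes "x > 0" "y > 0" "\<sigma> \<ge> 1"
  shows "\<bar>x powr \<sigma> - y powr \<sigma>\<bar> \<le> \<sigma> * \<bar>x - y\<bar> * max x y powr (\<sigma> - 1)"
proof -
  have *: "b powr \<sigma> - a powr \<sigma> \<le> \<sigma> * (b - a) * b powr (\<sigma> - 1)" if "0 < a" "a < b" for a b :: real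
  proof -
    have "\<exists>z>a. z < b \<and> b powr \<sigma> - a powr \<sigma> = (b - a) * (\<sigma> * z powr (\<sigma> - 1))"
      by (rule MVT2[OF that(2)]) (use that in \<open>auto intro!: derivative_eq_intros\<close>)
    then obtain z where z: "a < z" "z < b" "b powr \<sigma> - a powr \<sigma> = (b - a) * (\<sigma> * z powr (\<sigma> - 1))"
      by blast
    have "z powr (\<sigma> - 1) \<le> b powr (\<sigma> - 1)" using z that assms(3) by (intro powr_mono2) auto
    then have "(b - a) * (\<sigma> * z powr (\<sigma> - 1)) \<le> (b - a) * (\<sigma> * b powr (\<sigma> - 1))"
      using that assms(3) by (intro mult_left_mono) auto
    then show ?thesis using z(3) by (simp add: mult_ac)
  qed
  have m: "a powr \<sigma> \<le> b powr \<sigma>" if "0 < a" "a < b" for a b :: real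
    using that assms(3) by (intro powr_mono2) auto
  consider "x < y" | "x = y" | "y < x" by linarith
  then show ?thesis
  proof cases
    case 1 then show ?thesis using *[of x y] m[of x y] assms by (simp add: max_def)
  next
    case 3 then show ?thesis using *[of y x] m[of y x] assms by (simp add: max_def)
  qed simp
qed

lemma max_powr_le_add:
  fixes a b p :: real
  assumes "a \<ge> 0" "b \<ge> 0"
  shows "max a b powr p \<le> a powr p + b powr p"
  by (simp add: max_def)

text \<open>The commutator of a multiplier of order \<open>\<sigma>\<close> with multiplication by a function: one factor
  \<open>|k - m|\<close> is gained, and the remaining \<open>\<sigma> - 1\<close> derivatives fall on either of the two factors.\<close>

lemma weight_commutator:
  assumes "\<sigma> \<ge> 1"
  shows "\<bar>japanese_bracket k powr \<sigma> - japanese_bracket m powr \<sigma>\<bar> \<le>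
    \<sigma> * 2 powr (\<sigma> - 1) * fnorm (k - m) *
      (japanese_bracket m powr (\<sigma> - 1) + japanese_bracket (k - m) powr (\<sigma> - 1))"
proof -
  let ?M = "max (japanese_bracket m) (japanese_bracket (k - m))"
  have "max (japanese_bracket k) (japanese_bracket m) \<le> 2 * ?M"
    using japanese_bracket_triangle[of k m] japanese_bracket_ge_1[of m] by linarith
  then have "max (japanese_bracket k) (japanese_bracket m) powr (\<sigma> - 1) \<le> (2 * ?M) powr (\<sigma> - 1)"
    using assms by (intro powr_mono2) (auto simp: le_max_iff_disj)
  also have "\<dots> = 2 powr (\<sigma> - 1) * ?M powr (\<sigma> - 1)"
    by (subst powr_mult) (auto simp: max_def)
  also have "\<dots> \<le> 2 powr (\<sigma> - 1) * (japanese_bracket m powr (\<sigma> - 1) + japanese_bracket (k - m) powr (\<sigma> - 1))"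
    by (intro mult_left_mono max_powr_le_add) auto
  finally have M: "max (japanese_bracket k) (japanese_bracket m) powr (\<sigma> - 1) \<le>
      2 powr (\<sigma> - 1) * (japanese_bracket m powr (\<sigma> - 1) + japanese_bracket (k - m) powr (\<sigma> - 1))" .
  have "\<bar>japanese_bracket k powr \<sigma> - japanese_bracket m powr \<sigma>\<bar> \<le>
      \<sigma> * \<bar>japanese_bracket k - japanese_bracket m\<bar> * max (japanese_bracket k) (japanese_bracket m) powr (\<sigma> - 1)"
    by (rule powr_diff_bound) (use assms in auto)
  also have "\<dots> \<le> \<sigma> * fnorm (k - m) *
      (2 powr (\<sigma> - 1) * (japanese_bracket m powr (\<sigma> - 1) + japanese_bracket (k - m) powr (\<sigma> - 1)))"
    using assms by (intro mult_mono M japanese_bracket_diff) auto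
  finally show ?thesis by (simp add: mult_ac)
qed

text \<open>Of the same order as \<open>\<langle>k\<rangle>\<^sup>\<sigma>\<close> for \<open>k \<noteq> 0\<close>, but zero at frequency zero: constants such as
  \<open>A j 0\<close> have size zero in this weight, so that polynomials of a field are small when the field is.\<close>

definition tame_weight :: "real \<Rightarrow> int^'d \<Rightarrow> real" where
  "tame_weight \<sigma> k = fnorm k * japanese_bracket k powr (\<sigma> - 1)"

lemma tame_weight_nonneg [simp]: "tame_weight \<sigma> k \<ge> 0"
  by (simp add: tame_weight_def)

lemma tame_weight_0 [simp]: "tame_weight \<sigma> 0 = 0"
  by (simp add: tame_weight_def)

lemma tame_weight_le: "tame_weight \<sigma> k \<le> japanese_bracket k powr \<sigma>"
proof -
  have "tame_weight \<sigma> k \<le> japanese_bracket k * japanese_bracket k powr (\<sigma> - 1)"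
    unfolding tame_weight_def by (intro mult_right_mono fnorm_le_japanese_bracket) auto
  also have "\<dots> = japanese_bracket k powr \<sigma>"
    using powr_add[of "japanese_bracket k" 1 "\<sigma> - 1"] by simp
  finally show ?thesis .
qed

text \<open>The larger of the two frequencies carries the weight of the sum; hence in a product all derivatives may be
  assumed to fall on one factor.\<close>

lemma tame_weight_add:
  assumes "\<sigma> \<ge> 1"
  shows "tame_weight \<sigma> (k + m) \<le> 2 powr \<sigma> * (tame_weight \<sigma> k + tame_weight \<sigma> m)"
proof -
  have *: "tame_weight \<sigma> (k + m) \<le> 2 powr \<sigma> * tame_weight \<sigma> k" if "fnorm m \<le> fnorm k" for k m :: "int^'d"
  proof -
    have "japanese_bracket (k + m) \<le> 2 * japanese_bracket k"
      using japanese_bracket_triangle[of "k + m" k] japanese_bracket_mono[OF that] by simp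
    then have "japanese_bracket (k + m) powr (\<sigma> - 1) \<le> (2 * japanese_bracket k) powr (\<sigma> - 1)"
      using assms by (intro powr_mono2) auto
    moreover have "fnorm (k + m) \<le> 2 * fnorm k" using fnorm_add[of k m] that by simp
    ultimately have "tame_weight \<sigma> (k + m) \<le> (2 * fnorm k) * (2 * japanese_bracket k) powr (\<sigma> - 1)"
      unfolding tame_weight_def by (intro mult_mono) auto
    also have "\<dots> = (2 * 2 powr (\<sigma> - 1)) * tame_weight \<sigma> k"
      by (simp add: powr_mult tame_weight_def)
    also have "2 * 2 powr (\<sigma> - 1) = 2 powr \<sigma>"
      using powr_add[of 2 1 "\<sigma> - 1"] by simp
    finally show ?thesis .
  qed
  show ?thesis
  proof (cases "fnorm m \<le> fnorm k")
    case True
    then show ?thesis using *[of m k] by (simp add: distrib_left add_increasing2)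
  next
    case False
    then show ?thesis using *[of k m] by (simp add: distrib_left add_increasing add.commute)
  qed
qed

section \<open>Convolution inequalities\<close>

text \<open>Norm bounds are stated through all finite partial sums. This combines summability with the value of the norm, and
  finitely supported families need no record of their support.\<close>

definition l1_bound :: "('a \<Rightarrow> real) \<Rightarrow> real \<Rightarrow> bool" where
  "l1_bound f B \<longleftrightarrow> (\<forall>F. finite F \<longrightarrow> (\<Sum>k\<in>F. f k) \<le> B)"

definition l2_bound :: "('a \<Rightarrow> real) \<Rightarrow> real \<Rightarrow> bool" where
  "l2_bound f B \<longleftrightarrow> (\<forall>F. finite F \<longrightarrow> L2_set f F \<le> B)"

lemma l1_boundD: "l1_bound f B \<Longrightarrow> finite F \<Longrightarrow> (\<Sum>k\<in>F. f k) \<le> B"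
  and l2_boundD: "l2_bound f B \<Longrightarrow> finite F \<Longrightarrow> L2_set f F \<le> B"
  by (simp_all add: l1_bound_def l2_bound_def)

lemma l1_bound_nonneg: "l1_bound f B \<Longrightarrow> B \<ge> 0"
  using l1_boundD[of f B "{}"] by simp

lemma l2_bound_nonneg: "l2_bound f B \<Longrightarrow> B \<ge> 0"
  using l2_boundD[of f B "{}"] by simp

lemma l1_bound_mono:
  assumes "l1_bound g B" "\<And>k. f k \<le> g k" "B \<le> C"
  shows "l1_bound f C"
  unfolding l1_bound_def
proof safe
  fix F :: "'a set" assume "finite F"
  have "(\<Sum>k\<in>F. f k) \<le> (\<Sum>k\<in>F. g k)" by (intro sum_mono assms)
  also have "\<dots> \<le> B" by (rule l1_boundD) fact+
  finally show "(\<Sum>k\<in>F. f k) \<le> C" using assms(3) by simp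
qed

lemma l2_bound_mono:
  assumes "l2_bound g B" "\<And>k. 0 \<le> f k" "\<And>k. f k \<le> g k" "B \<le> C"
  shows "l2_bound f C"
  unfolding l2_bound_def
proof safe
  fix F :: "'a set" assume "finite F"
  have "L2_set f F \<le> L2_set g F" by (intro L2_set_mono assms)
  also have "\<dots> \<le> B" by (rule l2_boundD) fact+
  finally show "L2_set f F \<le> C" using assms(4) by simp
qed

lemma l1_bound_add:
  assumes "l1_bound f A" "l1_bound g B"
  shows "l1_bound (\<lambda>k. f k + g k) (A + B)"
  using assms by (auto simp: l1_bound_def sum.distrib intro: add_mono)

lemma l2_bound_add:
  assumes "l2_bound f A" "l2_bound g B"
  shows "l2_bound (\<lambda>k. f k + g k) (A + B)"
  unfolding l2_bound_def
proof safe
  fix F :: "'a set" assume F: "finite F"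
  show "L2_set (\<lambda>k. f k + g k) F \<le> A + B"
    using L2_set_triangle_ineq[of f g F] l2_boundD[OF assms(1) F] l2_boundD[OF assms(2) F] by simp
qed

lemma l1_bound_cmult: "l1_bound f A \<Longrightarrow> c \<ge> 0 \<Longrightarrow> l1_bound (\<lambda>k. c * f k) (c * A)"
  by (auto simp: l1_bound_def mult_left_mono simp flip: sum_distrib_left)

lemma l2_bound_cmult: "l2_bound f A \<Longrightarrow> c \<ge> 0 \<Longrightarrow> l2_bound (\<lambda>k. c * f k) (c * A)"
  by (auto simp: l2_bound_def mult_left_mono simp flip: L2_set_right_distrib)

lemma l1_bound_sum:
  assumes "finite S" "\<And>i. i \<in> S \<Longrightarrow> l1_bound (f i) (B i)"
  shows "l1_bound (\<lambda>k. \<Sum>i\<in>S. f i k) (\<Sum>i\<in>S. B i)"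
  using assms
proof (induction S rule: finite_induct)
  case empty
  show ?case by (simp add: l1_bound_def)
next
  case (insert x F)
  then show ?case by (simp add: l1_bound_add)
qed

lemma l2_bound_sum:
  assumes "finite S" "\<And>i. i \<in> S \<Longrightarrow> l2_bound (f i) (B i)"
  shows "l2_bound (\<lambda>k. \<Sum>i\<in>S. f i k) (\<Sum>i\<in>S. B i)"
  using assms
proof (induction S rule: finite_induct)
  case empty
  show ?case by (simp add: l2_bound_def L2_set_def)
next
  case (insert x F)
  then show ?case by (simp add: l2_bound_add)
qed

lemma L2_set_reindex: "inj_on h F \<Longrightarrow> L2_set f (h ` F) = L2_set (\<lambda>k. f (h k)) F"
  by (simp add: L2_set_def sum.reindex o_def)

lemma l1_bound_shift: "l1_bound f B \<Longrightarrow> l1_bound (\<lambda>k. f (k - m)) B" for m :: "'a::ab_group_add"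
  unfolding l1_bound_def
proof safe
  fix F :: "'a set" assume "\<forall>F. finite F \<longrightarrow> sum f F \<le> B" "finite F"
  then have "sum f ((\<lambda>k. k - m) ` F) \<le> B" by blast
  then show "(\<Sum>k\<in>F. f (k - m)) \<le> B" by (simp add: sum.reindex inj_on_def o_def)
qed

lemma l2_bound_shift: "l2_bound f B \<Longrightarrow> l2_bound (\<lambda>k. f (k - m)) B" for m :: "'a::ab_group_add"
  unfolding l2_bound_def
proof safe
  fix F :: "'a set" assume "\<forall>F. finite F \<longrightarrow> L2_set f F \<le> B" "finite F"
  then have "L2_set f ((\<lambda>k. k - m) ` F) \<le> B" by blast
  then show "L2_set (\<lambda>k. f (k - m)) F \<le> B" by (simp add: L2_set_reindex inj_on_def)
qed

lemma young_l1_l1: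
  fixes f g :: "'a::ab_group_add \<Rightarrow> real"
  assumes f: "l1_bound f A" and g: "l1_bound g B" "\<And>k. g k \<ge> 0" and K: "finite K"
  shows "l1_bound (\<lambda>k. \<Sum>m\<in>K. f (k - m) * g m) (A * B)"
proof -
  have "l1_bound (\<lambda>k. \<Sum>m\<in>K. g m * f (k - m)) (\<Sum>m\<in>K. g m * A)"
    by (intro l1_bound_sum l1_bound_cmult l1_bound_shift K f g)
  then show ?thesis
  proof (rule l1_bound_mono)
    show "(\<Sum>m\<in>K. g m * A) \<le> A * B"
      using mult_left_mono[OF l1_boundD[OF g(1) K] l1_bound_nonneg[OF f]]
      by (simp add: sum_distrib_left mult.commute)
  qed (simp add: mult.commute)
qed

text \<open>A superposition of translates of \<open>f\<close> with the weights \<open>g m\<close>, so the triangle inequality in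
  \<open>\<ell>\<^sup>2\<close> suffices.\<close>

lemma young_l2_l1:
  fixes f g :: "'a::ab_group_add \<Rightarrow> real"
  assumes f: "l2_bound f A" "\<And>k. f k \<ge> 0" and g: "l1_bound g B" "\<And>k. g k \<ge> 0" and K: "finite K"
  shows "l2_bound (\<lambda>k. \<Sum>m\<in>K. f (k - m) * g m) (A * B)"
proof -
  have "l2_bound (\<lambda>k. \<Sum>m\<in>K. g m * f (k - m)) (\<Sum>m\<in>K. g m * A)"
    by (intro l2_bound_sum l2_bound_cmult l2_bound_shift K f g)
  then show ?thesis
  proof (rule l2_bound_mono)
    show "(\<Sum>m\<in>K. g m * A) \<le> A * B"
      using mult_left_mono[OF l1_boundD[OF g(1) K] l2_bound_nonneg[OF f(1)]]
      by (simp add: sum_distrib_left mult.commute)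
    show "0 \<le> (\<Sum>m\<in>K. f (k - m) * g m)" for k by (intro sum_nonneg mult_nonneg_nonneg f g)
  qed (simp add: mult.commute)
qed

text \<open>Substituting \<open>l = k - m\<close> exchanges the roles of the factors. The range of \<open>l\<close> then depends on \<open>k\<close>; since all
  terms are nonnegative it may be enlarged to a common finite set \<open>H\<close>.\<close>

lemma young_l1_l2:
  fixes f g :: "'a::ab_group_add \<Rightarrow> real"
  assumes f: "l1_bound f A" "\<And>k. f k \<ge> 0" and g: "l2_bound g B" "\<And>k. g k \<ge> 0" and K: "finite K"
  shows "l2_bound (\<lambda>k. \<Sum>m\<in>K. f (k - m) * g m) (A * B)"
  unfolding l2_bound_def
proof safe
  fix F :: "'a set" assume F: "finite F"
  define H where "H = (\<lambda>(k, m). k - m) ` (F \<times> K)"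
  have H: "finite H" unfolding H_def using F K by auto
  have "(\<Sum>m\<in>K. f (k - m) * g m) \<le> (\<Sum>l\<in>H. g (k - l) * f l)" if "k \<in> F" for k
  proof -
    have "(\<Sum>m\<in>K. f (k - m) * g m) = (\<Sum>l\<in>(\<lambda>m. k - m) ` K. g (k - l) * f l)"
      by (subst sum.reindex) (auto simp: inj_on_def mult.commute)
    also have "\<dots> \<le> (\<Sum>l\<in>H. g (k - l) * f l)"
      by (rule sum_mono2[OF H]) (use that in \<open>auto simp: H_def f g\<close>)
    finally show ?thesis .
  qed
  then have "L2_set (\<lambda>k. \<Sum>m\<in>K. f (k - m) * g m) F \<le> L2_set (\<lambda>k. \<Sum>l\<in>H. g (k - l) * f l) F"
    by (intro L2_set_mono sum_nonneg mult_nonneg_nonneg f g)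
  also have "\<dots> \<le> B * A"
    by (rule l2_boundD[OF young_l2_l1 F]) (use f g H in auto)
  finally show "L2_set (\<lambda>k. \<Sum>m\<in>K. f (k - m) * g m) F \<le> A * B" by (simp add: mult.commute)
qed

lemma l2_pairing:
  assumes h: "l2_bound h A" "\<And>k. h k \<ge> 0" and f: "l2_bound f B" "\<And>k. f k \<ge> 0" and F: "finite F"
  shows "(\<Sum>k\<in>F. h k * f k) \<le> A * B"
proof -
  have "(\<Sum>k\<in>F. h k * f k) = (\<Sum>k\<in>F. \<bar>h k\<bar> * \<bar>f k\<bar>)" using h f by simp
  also have "\<dots> \<le> L2_set h F * L2_set f F" by (rule L2_set_mult_ineq)
  also have "\<dots> \<le> A * B"
    using l2_boundD[OF h(1) F] l2_boundD[OF f(1) F] l2_bound_nonneg[OF h(1)]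
    by (intro mult_mono) auto
  finally show ?thesis .
qed

section \<open>Sobolev embedding into the Wiener algebra\<close>

lemma finite_subset_freq_box:
  assumes "finite (F :: (int^'d) set)"
  obtains M where "F \<subseteq> freq_box M"
proof -
  define M where "M = (\<Sum>k\<in>F. \<Sum>j\<in>UNIV. nat \<bar>k $ j\<bar>)"
  have "k \<in> freq_box M" if "k \<in> F" for k
    unfolding freq_box_def
  proof safe
    fix j
    have "nat \<bar>k $ j\<bar> \<le> (\<Sum>j\<in>UNIV. nat \<bar>k $ j\<bar>)" by (intro member_le_sum) auto
    also have "\<dots> \<le> M" unfolding M_def using that assms
      by (intro member_le_sum[of k F "\<lambda>k. \<Sum>j\<in>UNIV. nat \<bar>k $ j\<bar>"]) auto
    finally show "\<bar>k $ j\<bar> \<le> int M" by simp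
  qed
  then show ?thesis using that by blast
qed

lemma lattice_sum_1d:
  fixes q :: real
  assumes "2 * q > 1"
  obtains Z where "\<And>M. (\<Sum>i\<in>{- int M..int M}. (1 + (real_of_int i)\<^sup>2) powr (- q)) \<le> Z"
proof -
  define h where "h = (\<lambda>x::real. (1 + x\<^sup>2) powr (- q))"
  have "summable (\<lambda>n. real n powr (- (2 * q)))" using assms by (simp add: summable_real_powr_iff)
  then have sm: "summable (\<lambda>n. h (real n))"
  proof (rule summable_comparison_test'[where N=1])
    fix n :: nat assume n: "n \<ge> 1"
    have "h (real n) \<le> ((real n)\<^sup>2) powr (- q)"
      unfolding h_def using n assms by (intro powr_mono2') auto
    also have "\<dots> = real n powr (- (2 * q))"
      using n by (simp add: powr_powr flip: powr_numeral)
    finally show "norm (h (real n)) \<le> real n powr (- (2 * q))" by (simp add: h_def)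
  qed
  have "(\<Sum>i\<in>{- int M..int M}. h (real_of_int i)) \<le> 2 * (\<Sum>n. h (real n))" for M
  proof -
    have sub: "{- int M..int M} \<subseteq> int ` {..M} \<union> (\<lambda>n. - int n) ` {..M}"
    proof
      fix i assume i: "i \<in> {- int M..int M}"
      show "i \<in> int ` {..M} \<union> (\<lambda>n. - int n) ` {..M}"
      proof (cases "i \<ge> 0")
        case True then show ?thesis using i by (intro UnI1 image_eqI[of _ _ "nat i"]) auto
      next
        case False then show ?thesis using i by (intro UnI2 image_eqI[of _ _ "nat (- i)"]) auto
      qed
    qed
    have "(\<Sum>i\<in>{- int M..int M}. h (real_of_int i)) \<le> (\<Sum>i\<in>int ` {..M} \<union> (\<lambda>n. - int n) ` {..M}. h (real_of_int i))"
      by (rule sum_mono2[OF _ sub]) (auto simp: h_def)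
    also have "\<dots> \<le> (\<Sum>i\<in>int ` {..M}. h (real_of_int i)) + (\<Sum>i\<in>(\<lambda>n. - int n) ` {..M}. h (real_of_int i))"
      by (subst sum_Un) (auto intro!: sum_nonneg simp: h_def)
    also have "\<dots> = (\<Sum>n\<le>M. h (real n)) + (\<Sum>n\<le>M. h (real n))"
      by (simp add: sum.reindex inj_on_def) (simp add: h_def)
    also have "\<dots> \<le> (\<Sum>n. h (real n)) + (\<Sum>n. h (real n))"
      by (intro add_mono sum_le_suminf[OF sm]) (auto simp: h_def)
    finally show ?thesis by simp
  qed
  then show ?thesis using that unfolding h_def by blast
qed

text \<open>Since \<open>\<langle>k\<rangle>\<^sup>2 \<ge> 1 + k\<^sub>j\<^sup>2\<close> for each of the \<open>d\<close> coordinates, the summand is at most a product of functions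
  \<open>(1 + k\<^sub>j\<^sup>2)\<^bsup>-r/d\<^esup>\<close> of one coordinate each, and every one-dimensional sum converges because \<open>2r/d > 1\<close>.\<close>

lemma lattice_sum:
  fixes r :: real
  assumes r: "2 * r > CARD('d)"
  obtains Z where "l1_bound (\<lambda>k::int^'d. japanese_bracket k powr (- (2 * r))) Z"
proof -
  define q where "q = r / CARD('d)"
  define h where "h = (\<lambda>i::int. (1 + (real_of_int i)\<^sup>2) powr (- q))"
  have q: "2 * q > 1" unfolding q_def using r by (simp add: field_simps)
  obtain Z where Z: "\<And>M. (\<Sum>i\<in>{- int M..int M}. h i) \<le> Z"
    using lattice_sum_1d[OF q] unfolding h_def by blast
  have le: "japanese_bracket k powr (- (2 * r)) \<le> (\<Prod>j\<in>UNIV. h (k $ j))" for k :: "int^'d"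
  proof -
    have "japanese_bracket k powr (- (2 * r)) = ((japanese_bracket k)\<^sup>2) powr (- r)"
      by (simp add: powr_powr flip: powr_numeral)
    also have "\<dots> = (((japanese_bracket k)\<^sup>2) powr (- q)) powr real CARD('d)"
      by (simp only: powr_powr) (simp add: q_def)
    also have "\<dots> = (((japanese_bracket k)\<^sup>2) powr (- q)) ^ CARD('d)"
      by (rule powr_realpow) (use japanese_bracket_pos[of k] in \<open>simp del: japanese_bracket_pos\<close>)
    also have "\<dots> = (\<Prod>j\<in>(UNIV::'d set). ((japanese_bracket k)\<^sup>2) powr (- q))"
      by (rule prod_constant[symmetric])
    also have "\<dots> \<le> (\<Prod>j\<in>UNIV. h (k $ j))"
    proof (rule prod_mono, safe)
      fix j
      have "(real_of_int (k $ j))\<^sup>2 \<le> (fnorm k)\<^sup>2"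
        using component_le_fnorm[of k j] by (intro abs_le_square_iff[THEN iffD1]) simp
      then show "((japanese_bracket k)\<^sup>2) powr (- q) \<le> h (k $ j)"
        unfolding h_def japanese_bracket_sq using q by (intro powr_mono2') (auto intro: add_pos_nonneg)
    qed simp
    finally show ?thesis .
  qed
  have "(\<Sum>k\<in>F. japanese_bracket k powr (- (2 * r))) \<le> Z ^ CARD('d)"
    if F: "finite F" for F :: "(int^'d) set"
  proof -
    obtain M where M: "F \<subseteq> freq_box M" using finite_subset_freq_box[OF F] .
    have "(\<Sum>k\<in>F. japanese_bracket k powr (- (2 * r))) \<le> (\<Sum>k\<in>F. \<Prod>j\<in>UNIV. h (k $ j))"
      by (intro sum_mono le)
    also have "\<dots> \<le> (\<Sum>k\<in>(freq_box M :: (int^'d) set). \<Prod>j\<in>UNIV. h (k $ j))"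
      by (rule sum_mono2[OF finite_freq_box M]) (simp add: h_def prod_nonneg)
    also have "\<dots> = (\<Sum>\<gamma>\<in>PiE (UNIV :: 'd set) (\<lambda>_. {- int M..int M}). \<Prod>j\<in>UNIV. h (\<gamma> j))"
      by (rule sum.reindex_bij_witness[of _ vec_lambda vec_nth])
        (auto simp: freq_box_def abs_le_iff PiE_iff minus_le_iff)
    also have "\<dots> = (\<Prod>j\<in>(UNIV::'d set). \<Sum>i\<in>{- int M..int M}. h i)"
      by (rule prod_sum_PiE[symmetric]) auto
    also have "\<dots> \<le> (\<Prod>j\<in>(UNIV::'d set). Z)"
      by (intro prod_mono conjI Z sum_nonneg) (simp add: h_def)
    finally show ?thesis by simp
  qed
  then show ?thesis using that unfolding l1_bound_def by blast
qed

text \<open>Cauchy--Schwarz against the weight \<open>\<langle>k\<rangle>\<^bsup>-(s-1)\<^esup>\<close>, which is square summable precisely when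
  \<open>s > d/2 + 1\<close>.\<close>

lemma sobolev_wiener_embedding:
  fixes s :: real
  assumes s: "s > CARD('d) / 2 + 1"
  obtains W where "W > 0" "\<And>(a::int^'d \<Rightarrow> complex) B. l2_bound (\<lambda>k. japanese_bracket k powr s * norm (a k)) B \<Longrightarrow>
     l1_bound (\<lambda>k. japanese_bracket k * norm (a k)) (W * B)"
proof -
  have "2 * (s - 1) > CARD('d)" using s by simp
  then obtain Z where Z: "l1_bound (\<lambda>k::int^'d. japanese_bracket k powr (- (2 * (s - 1)))) Z"
    by (rule lattice_sum)
  have Z0: "Z \<ge> 0" using l1_bound_nonneg[OF Z] .
  have Z2: "l2_bound (\<lambda>k::int^'d. japanese_bracket k powr (- (s - 1))) (sqrt Z + 1)"
    unfolding l2_bound_def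
  proof safe
    fix F :: "(int^'d) set" assume F: "finite F"
    have "L2_set (\<lambda>k. japanese_bracket k powr (- (s - 1))) F = sqrt (\<Sum>k\<in>F. japanese_bracket k powr (- (2 * (s - 1))))"
      unfolding L2_set_def by (simp add: powr_powr mult.commute flip: powr_numeral)
    also have "\<dots> \<le> sqrt Z" using l1_boundD[OF Z F] by simp
    finally show "L2_set (\<lambda>k. japanese_bracket k powr (- (s - 1))) F \<le> sqrt Z + 1" by simp
  qed
  show ?thesis
  proof (rule that)
    show "sqrt Z + 1 > 0" using Z0 by (simp add: add_nonneg_pos)
    fix a :: "int^'d \<Rightarrow> complex" and B
    assume a: "l2_bound (\<lambda>k. japanese_bracket k powr s * norm (a k)) B"
    show "l1_bound (\<lambda>k. japanese_bracket k * norm (a k)) ((sqrt Z + 1) * B)"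
      unfolding l1_bound_def
    proof safe
      fix F :: "(int^'d) set" assume F: "finite F"
      have "japanese_bracket k * norm (a k) = japanese_bracket k powr (- (s - 1)) * (japanese_bracket k powr s * norm (a k))" for k
      proof -
        have "japanese_bracket k powr (- (s - 1)) * japanese_bracket k powr s = japanese_bracket k"
          by (simp flip: powr_add)
        then show ?thesis by (simp flip: mult.assoc)
      qed
      then have "(\<Sum>k\<in>F. japanese_bracket k * norm (a k)) =
          (\<Sum>k\<in>F. japanese_bracket k powr (- (s - 1)) * (japanese_bracket k powr s * norm (a k)))"
        by (intro sum.cong refl)
      also have "\<dots> \<le> (sqrt Z + 1) * B"
        by (rule l2_pairing[OF Z2 _ a _ F]) auto
      finally show "(\<Sum>k\<in>F. japanese_bracket k * norm (a k)) \<le> (sqrt Z + 1) * B" .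
    qed
  qed
qed

section \<open>Tame bounds for polynomial nonlinearities\<close>

text \<open>To be read with \<open>\<alpha>\<close> and \<open>\<beta>\<close> the first-order Wiener norm and the Sobolev norm of some underlying field, and
  \<open>g\<close> a function of it: the two norms of \<open>g\<close> without the frequency zero depend linearly on those of the field, with
  the same constant that bounds the full Wiener norm of \<open>g\<close>.\<close>

definition tame_bound :: "real \<Rightarrow> real \<Rightarrow> real \<Rightarrow> real \<Rightarrow> (real^'d \<Rightarrow> complex) \<Rightarrow> bool" where
  "tame_bound \<sigma> \<alpha> \<beta> K g \<longleftrightarrow> (\<exists>M. trig_poly M g) \<and>
     l1_bound (\<lambda>k. norm (fcoeff g k)) K \<and>
     l1_bound (\<lambda>k. fnorm k * norm (fcoeff g k)) (K * \<alpha>) \<and>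
     l2_bound (\<lambda>k. tame_weight \<sigma> k * norm (fcoeff g k)) (K * \<beta>)"

lemma tame_bound_nonneg: "tame_bound \<sigma> \<alpha> \<beta> K g \<Longrightarrow> K \<ge> 0"
  unfolding tame_bound_def using l1_bound_nonneg by blast

lemma tame_bound_mono:
  assumes "tame_bound \<sigma> \<alpha> \<beta> K g" "K \<le> L" "\<alpha> \<ge> 0" "\<beta> \<ge> 0"
  shows "tame_bound \<sigma> \<alpha> \<beta> L g"
  using assms unfolding tame_bound_def
  by (auto intro: l1_bound_mono[OF _ order_refl] l2_bound_mono[OF _ _ order_refl] mult_right_mono)

lemma tame_bound_const:
  assumes "\<alpha> \<ge> 0" "\<beta> \<ge> 0"
  shows "tame_bound \<sigma> \<alpha> \<beta> (norm c) (\<lambda>x. c)"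
proof -
  have c: "fcoeff (\<lambda>x::real^'a. c) k = (if k = 0 then c else 0)" for k
    using fcoeff_wave_sum[of "{0::int^'a}" "\<lambda>_. c" k] by simp
  have "(\<Sum>k\<in>F. norm (if k = 0 then c else 0)) \<le> norm c" if "finite F" for F :: "(int^'a) set"
    using that by (simp add: if_distrib[of norm] cong: if_cong)
  moreover have "fnorm k * norm (if k = 0 then c else 0) = 0"
    "tame_weight \<sigma> k * norm (if k = 0 then c else 0) = 0" for k :: "int^'a" by simp_all
  ultimately show ?thesis
    unfolding tame_bound_def c l1_bound_def l2_bound_def L2_set_def
    using assms trig_poly_const[of 0 c] by (simp only: sum.neutral_const power_zero_numeral) auto
qed

lemma tame_bound_add:
  assumes f: "tame_bound \<sigma> \<alpha> \<beta> K f" and g: "tame_bound \<sigma> \<alpha> \<beta> L g"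
  shows "tame_bound \<sigma> \<alpha> \<beta> (K + L) (\<lambda>x. f x + g x)"
proof -
  obtain M1 M2 where M: "trig_poly M1 f" "trig_poly M2 g" using f g by (auto simp: tame_bound_def)
  have eq: "fcoeff (\<lambda>x. f x + g x) k = fcoeff f k + fcoeff g k" for k
    by (intro fcoeff_add trig_poly_continuous[OF M(1)] trig_poly_continuous[OF M(2)])
  have "trig_poly (max M1 M2) (\<lambda>x. f x + g x)"
    by (intro trig_poly_add trig_poly_mono[OF M(1)] trig_poly_mono[OF M(2)]) auto
  moreover have "l1_bound (\<lambda>k. norm (fcoeff (\<lambda>x. f x + g x) k)) (K + L)"
    by (rule l1_bound_mono[OF l1_bound_add[of "\<lambda>k. norm (fcoeff f k)" K "\<lambda>k. norm (fcoeff g k)" L]])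
      (use f g in \<open>auto simp: tame_bound_def eq norm_triangle_ineq\<close>)
  moreover have "l1_bound (\<lambda>k. fnorm k * norm (fcoeff (\<lambda>x. f x + g x) k)) ((K + L) * \<alpha>)"
    by (rule l1_bound_mono[OF l1_bound_add[of "\<lambda>k. fnorm k * norm (fcoeff f k)" "K * \<alpha>" "\<lambda>k. fnorm k * norm (fcoeff g k)" "L * \<alpha>"]])
      (use f g in \<open>auto simp: tame_bound_def eq norm_triangle_ineq distrib_right mult_left_mono simp flip: distrib_left\<close>)
  moreover have "l2_bound (\<lambda>k. tame_weight \<sigma> k * norm (fcoeff (\<lambda>x. f x + g x) k)) ((K + L) * \<beta>)"
    by (rule l2_bound_mono[OF l2_bound_add[of "\<lambda>k. tame_weight \<sigma> k * norm (fcoeff f k)" "K * \<beta>" "\<lambda>k. tame_weight \<sigma> k * norm (fcoeff g k)" "L * \<beta>"]])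
      (use f g in \<open>auto simp: tame_bound_def eq norm_triangle_ineq distrib_right mult_left_mono simp flip: distrib_left\<close>)
  ultimately show ?thesis unfolding tame_bound_def by blast
qed

text \<open>The product rule with frequencies: the weight of \<open>k = (k - m) + m\<close> splits into the weights of the two factors, and
  the factor without weight is measured in the Wiener norm. The constant \<open>2 * 2 powr \<sigma>\<close> serves all three bounds at
  once.\<close>

lemma tame_bound_mult:
  assumes \<sigma>: "\<sigma> \<ge> 1" and \<alpha>: "\<alpha> \<ge> 0" and \<beta>: "\<beta> \<ge> 0"
    and f: "tame_bound \<sigma> \<alpha> \<beta> K f" and g: "tame_bound \<sigma> \<alpha> \<beta> L g"
  shows "tame_bound \<sigma> \<alpha> \<beta> (2 * 2 powr \<sigma> * (K * L)) (\<lambda>x. f x * g x)"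
proof -
  obtain M1 M2 where M: "trig_poly M1 f" "trig_poly M2 g" using f g by (auto simp: tame_bound_def)
  let ?F = "\<lambda>k. norm (fcoeff f k)" and ?G = "\<lambda>k. norm (fcoeff g k)"
  let ?w = "tame_weight \<sigma> :: int^'a \<Rightarrow> real" and ?K = "freq_box M2 :: (int^'a) set"
  have K: "K \<ge> 0" "L \<ge> 0" by (rule tame_bound_nonneg[OF f], rule tame_bound_nonneg[OF g])
  have F: "l1_bound ?F K" "l1_bound (\<lambda>k. fnorm k * ?F k) (K * \<alpha>)" "l2_bound (\<lambda>k. ?w k * ?F k) (K * \<beta>)"
    and G: "l1_bound ?G L" "l1_bound (\<lambda>k. fnorm k * ?G k) (L * \<alpha>)" "l2_bound (\<lambda>k. ?w k * ?G k) (L * \<beta>)"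
    using f g unfolding tame_bound_def by auto
  have one: "1 \<le> 2 * 2 powr \<sigma>" "2 \<le> 2 * 2 powr \<sigma>"
    using ge_one_powr_ge_zero[of 2 \<sigma>] \<sigma> by auto
  have le: "norm (fcoeff (\<lambda>x. f x * g x) k) \<le> (\<Sum>m\<in>?K. ?F (k - m) * ?G m)" for k
    unfolding fcoeff_mult[OF trig_poly_continuous[OF M(1)] M(2)]
    by (intro order_trans[OF norm_sum]) (simp add: norm_mult)
  have weighted: "w k * norm (fcoeff (\<lambda>x. f x * g x) k) \<le>
      c * ((\<Sum>m\<in>?K. (w (k - m) * ?F (k - m)) * ?G m) + (\<Sum>m\<in>?K. ?F (k - m) * (w m * ?G m)))"
    if w: "\<And>k m. w (k + m) \<le> c * (w k + w m)" "\<And>k. w k \<ge> 0" for w :: "int^'a \<Rightarrow> real" and c k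
  proof -
    have "w k * norm (fcoeff (\<lambda>x. f x * g x) k) \<le> w k * (\<Sum>m\<in>?K. ?F (k - m) * ?G m)"
      by (intro mult_left_mono le w)
    also have "\<dots> = (\<Sum>m\<in>?K. w ((k - m) + m) * (?F (k - m) * ?G m))"
      by (simp add: sum_distrib_left)
    also have "\<dots> \<le> (\<Sum>m\<in>?K. (c * (w (k - m) + w m)) * (?F (k - m) * ?G m))"
      by (intro sum_mono mult_right_mono w) simp
    also have "\<dots> = c * ((\<Sum>m\<in>?K. (w (k - m) * ?F (k - m)) * ?G m) + (\<Sum>m\<in>?K. ?F (k - m) * (w m * ?G m)))"
      by (simp add: sum_distrib_left sum.distrib[symmetric] algebra_simps)
    finally show ?thesis .
  qed
  have "l1_bound (\<lambda>k. norm (fcoeff (\<lambda>x. f x * g x) k)) (2 * 2 powr \<sigma> * (K * L))"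
    by (rule l1_bound_mono[OF young_l1_l1[OF F(1) G(1) norm_ge_zero finite_freq_box] le])
      (use mult_right_mono[OF one(1), of "K * L"] K in simp)
  moreover have "l1_bound (\<lambda>k. fnorm k * norm (fcoeff (\<lambda>x. f x * g x) k)) (2 * 2 powr \<sigma> * (K * L) * \<alpha>)"
  proof (rule l1_bound_mono)
    show "l1_bound (\<lambda>k. 1 * ((\<Sum>m\<in>?K. (fnorm (k - m) * ?F (k - m)) * ?G m) + (\<Sum>m\<in>?K. ?F (k - m) * (fnorm m * ?G m))))
        (1 * ((K * \<alpha>) * L + K * (L * \<alpha>)))"
      by (intro l1_bound_cmult l1_bound_add young_l1_l1[of "\<lambda>k. fnorm k * ?F k"] young_l1_l1[of ?F] F G) auto
    show "fnorm k * norm (fcoeff (\<lambda>x. f x * g x) k) \<le>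
        1 * ((\<Sum>m\<in>?K. (fnorm (k - m) * ?F (k - m)) * ?G m) + (\<Sum>m\<in>?K. ?F (k - m) * (fnorm m * ?G m)))" for k
      by (rule weighted) (auto simp: fnorm_add)
    show "1 * ((K * \<alpha>) * L + K * (L * \<alpha>)) \<le> 2 * 2 powr \<sigma> * (K * L) * \<alpha>"
      using mult_right_mono[OF one(2), of "K * L * \<alpha>"] K \<alpha> by (simp add: mult_ac)
  qed
  moreover have "l2_bound (\<lambda>k. ?w k * norm (fcoeff (\<lambda>x. f x * g x) k)) (2 * 2 powr \<sigma> * (K * L) * \<beta>)"
  proof (rule l2_bound_mono)
    show "l2_bound (\<lambda>k. 2 powr \<sigma> * ((\<Sum>m\<in>?K. (?w (k - m) * ?F (k - m)) * ?G m) + (\<Sum>m\<in>?K. ?F (k - m) * (?w m * ?G m))))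
        (2 powr \<sigma> * ((K * \<beta>) * L + K * (L * \<beta>)))"
      by (intro l2_bound_cmult l2_bound_add young_l2_l1[of "\<lambda>k. ?w k * ?F k"] young_l1_l2[of ?F] F G) auto
    show "?w k * norm (fcoeff (\<lambda>x. f x * g x) k) \<le>
        2 powr \<sigma> * ((\<Sum>m\<in>?K. (?w (k - m) * ?F (k - m)) * ?G m) + (\<Sum>m\<in>?K. ?F (k - m) * (?w m * ?G m)))" for k
      by (rule weighted) (auto simp: tame_weight_add[OF \<sigma>])
    show "2 powr \<sigma> * ((K * \<beta>) * L + K * (L * \<beta>)) \<le> 2 * 2 powr \<sigma> * (K * L) * \<beta>"
      by (simp add: algebra_simps)
  qed simp
  ultimately show ?thesis unfolding tame_bound_def using trig_poly_mult[OF M] by blast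
qed

lemma tame_bound_cmult:
  assumes f: "tame_bound \<sigma> \<alpha> \<beta> K f"
  shows "tame_bound \<sigma> \<alpha> \<beta> (norm c * K) (\<lambda>x. c * f x)"
proof -
  obtain M where "trig_poly M f" using f by (auto simp: tame_bound_def)
  then have "trig_poly M (\<lambda>x. c * f x)" by (rule trig_poly_cmult)
  then show ?thesis
    using f l1_bound_cmult[of _ _ "norm c"] l2_bound_cmult[of _ _ "norm c"]
    unfolding tame_bound_def fcoeff_cmult norm_mult
    by (auto simp: mult.assoc mult.left_commute[of _ "norm c"])
qed

lemma tame_bound_sum:
  assumes "finite S" "\<And>i. i \<in> S \<Longrightarrow> tame_bound \<sigma> \<alpha> \<beta> (K i) (f i)" "\<alpha> \<ge> 0" "\<beta> \<ge> 0"
  shows "tame_bound \<sigma> \<alpha> \<beta> (\<Sum>i\<in>S. K i) (\<lambda>x. \<Sum>i\<in>S. f i x)"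
  using assms(1,2)
proof (induction S rule: finite_induct)
  case empty
  then show ?case using tame_bound_const[OF assms(3,4), of \<sigma> 0] by simp
next
  case (insert a S)
  then show ?case using tame_bound_add[of \<sigma> \<alpha> \<beta> "K a" "f a"] by simp
qed

definition trig_vec :: "nat \<Rightarrow> (real^'d \<Rightarrow> real^'n) \<Rightarrow> bool" where
  "trig_vec N U \<longleftrightarrow> (\<forall>i. trig_poly N (\<lambda>x. of_real (U x $ i)))"

lemma trig_vecD: "trig_vec N U \<Longrightarrow> trig_poly N (\<lambda>x. of_real (U x $ i))"
  by (simp add: trig_vec_def)

lemma linear_functional_expand:
  fixes f :: "real^'n \<Rightarrow> real"
  assumes "bounded_linear f"
  shows "f y = (\<Sum>i\<in>UNIV. f (axis i 1) * y $ i)"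
proof -
  have "f y = f (\<Sum>i\<in>UNIV. (y $ i) *\<^sub>R axis i 1)"
    using basis_expansion[of y] by (simp add: scalar_mult_eq_scaleR)
  also have "\<dots> = (\<Sum>i\<in>UNIV. f (axis i 1) * y $ i)"
    using assms by (simp add: linear_sum linear_scale bounded_linear.linear mult.commute)
  finally show ?thesis .
qed

text \<open>Structural induction on the polynomial. The constant depends on the polynomial, on \<open>\<sigma>\<close> and on the Wiener norm
  \<open>R\<close> of the field, but neither on its degree as a trigonometric polynomial nor on \<open>\<alpha>\<close> and \<open>\<beta>\<close>.\<close>

lemma tame_bound_polynomial:
  fixes p :: "real^'n \<Rightarrow> real"
  assumes p: "real_polynomial_function p" and \<sigma>: "\<sigma> \<ge> 1"
  shows "\<exists>K. \<forall>(U::real^'d \<Rightarrow> real^'n) \<alpha> \<beta>. \<alpha> \<ge> 0 \<longrightarrow> \<beta> \<ge> 0 \<longrightarrow>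
     (\<forall>i. tame_bound \<sigma> \<alpha> \<beta> R (\<lambda>x. of_real (U x $ i))) \<longrightarrow>
     tame_bound \<sigma> \<alpha> \<beta> K (\<lambda>x. of_real (p (U x)))"
  using p
proof (induction p rule: real_polynomial_function.induct)
  case (linear f)
  note f = linear_functional_expand[OF linear]
  show ?case
  proof (intro exI allI impI)
    fix U :: "real^'d \<Rightarrow> real^'n" and \<alpha> \<beta> :: real
    assume *: "\<alpha> \<ge> 0" "\<beta> \<ge> 0" "\<forall>i. tame_bound \<sigma> \<alpha> \<beta> R (\<lambda>x. of_real (U x $ i))"
    have "tame_bound \<sigma> \<alpha> \<beta> (\<Sum>i\<in>UNIV. norm (complex_of_real (f (axis i 1))) * R)
        (\<lambda>x. \<Sum>i\<in>UNIV. of_real (f (axis i 1)) * of_real (U x $ i))"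
      by (intro tame_bound_sum tame_bound_cmult) (use * in auto)
    moreover have "(\<Sum>i\<in>UNIV. of_real (f (axis i 1)) * of_real (U x $ i)) = complex_of_real (f (U x))" for x
      by (subst (2) f) simp
    ultimately show "tame_bound \<sigma> \<alpha> \<beta> (\<Sum>i\<in>UNIV. norm (complex_of_real (f (axis i 1))) * R) (\<lambda>x. of_real (f (U x)))"
      by simp
  qed
next
  case (const c)
  show ?case using tame_bound_const by blast
next
  case (add f g)
  then obtain K L where
    "\<And>(U::real^'d \<Rightarrow> real^'n) \<alpha> \<beta>. \<alpha> \<ge> 0 \<Longrightarrow> \<beta> \<ge> 0 \<Longrightarrow> \<forall>i. tame_bound \<sigma> \<alpha> \<beta> R (\<lambda>x. of_real (U x $ i)) \<Longrightarrow>
     tame_bound \<sigma> \<alpha> \<beta> K (\<lambda>x. of_real (f (U x)))"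
    "\<And>(U::real^'d \<Rightarrow> real^'n) \<alpha> \<beta>. \<alpha> \<ge> 0 \<Longrightarrow> \<beta> \<ge> 0 \<Longrightarrow> \<forall>i. tame_bound \<sigma> \<alpha> \<beta> R (\<lambda>x. of_real (U x $ i)) \<Longrightarrow>
     tame_bound \<sigma> \<alpha> \<beta> L (\<lambda>x. of_real (g (U x)))" by metis
  then show ?case by (intro exI[of _ "K + L"]) (auto intro: tame_bound_add)
next
  case (mult f g)
  then obtain K L where
    "\<And>(U::real^'d \<Rightarrow> real^'n) \<alpha> \<beta>. \<alpha> \<ge> 0 \<Longrightarrow> \<beta> \<ge> 0 \<Longrightarrow> \<forall>i. tame_bound \<sigma> \<alpha> \<beta> R (\<lambda>x. of_real (U x $ i)) \<Longrightarrow>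
     tame_bound \<sigma> \<alpha> \<beta> K (\<lambda>x. of_real (f (U x)))"
    "\<And>(U::real^'d \<Rightarrow> real^'n) \<alpha> \<beta>. \<alpha> \<ge> 0 \<Longrightarrow> \<beta> \<ge> 0 \<Longrightarrow> \<forall>i. tame_bound \<sigma> \<alpha> \<beta> R (\<lambda>x. of_real (U x $ i)) \<Longrightarrow>
     tame_bound \<sigma> \<alpha> \<beta> L (\<lambda>x. of_real (g (U x)))" by metis
  then show ?case
    by (intro exI[of _ "2 * 2 powr \<sigma> * (K * L)"]) (auto intro: tame_bound_mult[OF \<sigma>])
qed

section \<open>The commutator estimate\<close>

text \<open>Renaming \<open>P\<close> and \<open>Q\<close> into each other shows that the sum of \<open>cnj (g Q P)\<close> is the conjugate of the original
  one, so only the Hermitian part of the form contributes to its real part.\<close>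

lemma hermitian_part:
  fixes g :: "'i \<Rightarrow> 'i \<Rightarrow> complex"
  shows "Re (\<Sum>P\<in>I. \<Sum>Q\<in>I. g P Q) = Re (\<Sum>P\<in>I. \<Sum>Q\<in>I. g P Q + cnj (g Q P)) / 2"
proof -
  have "Re (\<Sum>P\<in>I. \<Sum>Q\<in>I. cnj (g Q P)) = Re (\<Sum>P\<in>I. \<Sum>Q\<in>I. g P Q)"
    by (subst sum.swap) simp
  then show ?thesis by (simp add: sum.distrib)
qed

lemma trilinear_bound:
  fixes x y :: "int^'d \<Rightarrow> real"
  assumes x: "l2_bound x \<beta>" "\<And>k. x k \<ge> 0"
    and conv: "l2_bound (\<lambda>k. \<Sum>m\<in>K. f (k - m) * y m) \<gamma>" "\<And>k m. f k * y m \<ge> 0"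
    and K: "finite K"
  shows "(\<Sum>k\<in>K. \<Sum>m\<in>K. x k * (f (k - m) * y m)) \<le> \<beta> * \<gamma>"
  unfolding sum_distrib_left[symmetric]
  by (rule l2_pairing[OF x conv(1) sum_nonneg K]) (rule conv(2))

text \<open>Here \<open>c a k\<close> are the coefficients of the field and \<open>B j a b\<close> those of the matrix entries. With
  \<open>v = \<langle>k\<rangle>\<^sup>\<sigma> c\<close> the form splits into one with both weights on \<open>v\<close>, whose Hermitian part is \<open>D/2\<close> with
  \<open>m\<^sub>j - k\<^sub>j\<close> in place of \<open>m\<^sub>j\<close>, and the commutator \<open>E\<close>. The hypotheses \<open>real_coeff\<close> and
  \<open>symmetric\<close> say that \<open>B\<close> comes from real symmetric matrices; they are what makes the swap of
  \<open>(a, k)\<close> and \<open>(b, m)\<close> a conjugation.\<close>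

lemma commutator_estimate:
  fixes c :: "'n::finite \<Rightarrow> int^'d \<Rightarrow> complex" and B :: "'d \<Rightarrow> 'n \<Rightarrow> 'n \<Rightarrow> int^'d \<Rightarrow> complex"
  assumes \<sigma>: "\<sigma> \<ge> 1" and K: "finite K"
    and real_coeff: "\<And>j a b p. B j a b (- p) = cnj (B j a b p)"
    and symmetric: "\<And>j a b p. B j a b p = B j b a p"
    and c2: "\<And>a. l2_bound (\<lambda>k. japanese_bracket k powr \<sigma> * norm (c a k)) \<beta>"
    and c1: "\<And>a. l1_bound (\<lambda>k. fnorm k * norm (c a k)) \<alpha>"
    and B1: "\<And>j a b. l1_bound (\<lambda>k. fnorm k * norm (B j a b k)) (\<kappa> * \<alpha>)"
    and B2: "\<And>j a b. l2_bound (\<lambda>k. tame_weight \<sigma> k * norm (B j a b k)) (\<kappa> * \<beta>)"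
  shows "\<bar>Re (\<Sum>a\<in>UNIV. \<Sum>k\<in>K. of_real (japanese_bracket k powr (2 * \<sigma>)) * cnj (c a k) *
            (\<Sum>j\<in>UNIV. \<Sum>b\<in>UNIV. \<Sum>m\<in>K. B j a b (k - m) * (\<i> * of_int (m $ j) * c b m)))\<bar>
     \<le> real (CARD('d) * CARD('n)\<^sup>2) * (1/2 + 2 * (\<sigma> * 2 powr (\<sigma> - 1))) * (\<kappa> * \<alpha> * \<beta>\<^sup>2)"
proof -
  let ?w = "\<lambda>k::int^'d. japanese_bracket k powr \<sigma>"
  define C where "C = \<sigma> * 2 powr (\<sigma> - 1)"
  have C0: "C \<ge> 0" using \<sigma> by (simp add: C_def)
  define v where "v = (\<lambda>a k. of_real (?w k) * c a k)"
  have nv: "norm (v a k) = ?w k * norm (c a k)" for a k by (simp add: v_def norm_mult)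
  have v2: "l2_bound (\<lambda>k. norm (v a k)) \<beta>" for a using c2 by (simp add: nv)
  have w2: "japanese_bracket k powr (2 * \<sigma>) = ?w k * ?w k" for k :: "int^'d"
    by (simp add: powr_add[symmetric])
  define D where "D = (\<lambda>j a b. \<Sum>k\<in>K. \<Sum>m\<in>K. cnj (v a k) * B j a b (k - m) * (\<i> * of_int (m $ j - k $ j) * v b m))"
  define E where "E = (\<lambda>j a b. \<Sum>k\<in>K. \<Sum>m\<in>K. cnj (v a k) * B j a b (k - m) * (\<i> * of_int (m $ j) * (of_real (?w k - ?w m) * c b m)))"
  have D: "norm (D j a b) \<le> \<kappa> * \<alpha> * \<beta>\<^sup>2" for j a b
  proof -
    have "norm (D j a b) \<le> (\<Sum>k\<in>K. \<Sum>m\<in>K. norm (v a k) * ((fnorm (k - m) * norm (B j a b (k - m))) * norm (v b m)))"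
      unfolding D_def
    proof (intro order_trans[OF norm_sum] sum_mono)
      fix k m
      have "\<bar>real_of_int (m $ j - k $ j)\<bar> \<le> fnorm (k - m)"
        using component_le_fnorm[of "k - m" j] by (simp add: abs_minus_commute)
      then have "norm (v a k) * norm (B j a b (k - m)) * norm (v b m) * \<bar>real_of_int (m $ j - k $ j)\<bar> \<le>
          norm (v a k) * norm (B j a b (k - m)) * norm (v b m) * fnorm (k - m)"
        by (intro mult_left_mono) auto
      then show "norm (cnj (v a k) * B j a b (k - m) * (\<i> * of_int (m $ j - k $ j) * v b m)) \<le>
          norm (v a k) * ((fnorm (k - m) * norm (B j a b (k - m))) * norm (v b m))"
        by (simp only: norm_mult norm_ii norm_of_int complex_mod_cnj mult_1 mult_ac)
    qed
    also have "\<dots> \<le> \<beta> * ((\<kappa> * \<alpha>) * \<beta>)"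
      by (intro trilinear_bound[where x="\<lambda>k. norm (v a k)" and f="\<lambda>k. fnorm k * norm (B j a b k)"
            and y="\<lambda>k. norm (v b k)"] v2 K
          young_l1_l2[of "\<lambda>k. fnorm k * norm (B j a b k)"] B1) auto
    finally show ?thesis by (simp add: power2_eq_square mult_ac)
  qed
  have E: "norm (E j a b) \<le> 2 * C * (\<kappa> * \<alpha> * \<beta>\<^sup>2)" for j a b
  proof -
    have "norm (E j a b) \<le> (\<Sum>k\<in>K. \<Sum>m\<in>K. C * (norm (v a k) * ((fnorm (k - m) * norm (B j a b (k - m))) * norm (v b m))
        + norm (v a k) * ((tame_weight \<sigma> (k - m) * norm (B j a b (k - m))) * (fnorm m * norm (c b m)))))"
      unfolding E_def
    proof (intro order_trans[OF norm_sum] sum_mono)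
      fix k m :: "int^'d"
      let ?X = "norm (v a k) * norm (B j a b (k - m)) * norm (c b m)"
      have "\<bar>real_of_int (m $ j)\<bar> * \<bar>?w k - ?w m\<bar> \<le> fnorm m * (C * fnorm (k - m) *
          (japanese_bracket m powr (\<sigma> - 1) + japanese_bracket (k - m) powr (\<sigma> - 1)))"
        unfolding C_def by (intro mult_mono component_le_fnorm weight_commutator \<sigma>) auto
      also have "\<dots> = C * (fnorm (k - m) * tame_weight \<sigma> m + tame_weight \<sigma> (k - m) * fnorm m)"
        by (simp add: tame_weight_def algebra_simps)
      also have "\<dots> \<le> C * (fnorm (k - m) * ?w m + tame_weight \<sigma> (k - m) * fnorm m)"
        using C0 by (intro mult_left_mono add_mono tame_weight_le) auto
      finally have "?X * (\<bar>real_of_int (m $ j)\<bar> * \<bar>?w k - ?w m\<bar>) \<le>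
          ?X * (C * (fnorm (k - m) * ?w m + tame_weight \<sigma> (k - m) * fnorm m))"
        by (rule mult_left_mono) simp
      also have "?X * (\<bar>real_of_int (m $ j)\<bar> * \<bar>?w k - ?w m\<bar>) =
          norm (cnj (v a k) * B j a b (k - m) * (\<i> * of_int (m $ j) * (of_real (?w k - ?w m) * c b m)))"
        by (simp only: norm_mult norm_ii norm_of_int norm_of_real complex_mod_cnj mult_1 mult_ac)
      also have "?X * (C * (fnorm (k - m) * ?w m + tame_weight \<sigma> (k - m) * fnorm m)) =
          C * (norm (v a k) * ((fnorm (k - m) * norm (B j a b (k - m))) * norm (v b m))
        + norm (v a k) * ((tame_weight \<sigma> (k - m) * norm (B j a b (k - m))) * (fnorm m * norm (c b m))))"
        unfolding nv[of b] by (simp only: distrib_left mult_ac)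
      finally show "norm (cnj (v a k) * B j a b (k - m) * (\<i> * of_int (m $ j) * (of_real (?w k - ?w m) * c b m))) \<le>
          C * (norm (v a k) * ((fnorm (k - m) * norm (B j a b (k - m))) * norm (v b m))
        + norm (v a k) * ((tame_weight \<sigma> (k - m) * norm (B j a b (k - m))) * (fnorm m * norm (c b m))))" .
    qed
    also have "\<dots> = C * ((\<Sum>k\<in>K. \<Sum>m\<in>K. norm (v a k) * ((fnorm (k - m) * norm (B j a b (k - m))) * norm (v b m)))
        + (\<Sum>k\<in>K. \<Sum>m\<in>K. norm (v a k) * ((tame_weight \<sigma> (k - m) * norm (B j a b (k - m))) * (fnorm m * norm (c b m)))))"
      by (simp only: sum.distrib sum_distrib_left distrib_left)
    also have "\<dots> \<le> C * (\<beta> * ((\<kappa> * \<alpha>) * \<beta>) + \<beta> * ((\<kappa> * \<beta>) * \<alpha>))"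
      by (intro mult_left_mono add_mono C0
          trilinear_bound[where x="\<lambda>k. norm (v a k)" and f="\<lambda>k. fnorm k * norm (B j a b k)"
            and y="\<lambda>k. norm (v b k)"]
          trilinear_bound[where x="\<lambda>k. norm (v a k)" and f="\<lambda>k. tame_weight \<sigma> k * norm (B j a b k)"
            and y="\<lambda>k. fnorm k * norm (c b k)"] v2 K
          young_l1_l2[of "\<lambda>k. fnorm k * norm (B j a b k)"]
          young_l2_l1[of "\<lambda>k. tame_weight \<sigma> k * norm (B j a b k)"] B1 B2 c1) auto
    also have "\<dots> = 2 * C * (\<kappa> * \<alpha> * \<beta>\<^sup>2)" by (simp add: power2_eq_square algebra_simps)
    finally show ?thesis .
  qed
  have symm: "Re (\<Sum>a\<in>UNIV. \<Sum>k\<in>K. \<Sum>b\<in>UNIV. \<Sum>m\<in>K. cnj (v a k) * B j a b (k - m) * (\<i> * of_int (m $ j) * v b m)) =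
      Re (\<Sum>a\<in>UNIV. \<Sum>b\<in>UNIV. D j a b) / 2" for j
  proof -
    define g where "g = (\<lambda>(a, k) (b, m). cnj (v a k) * B j a b (k - m) * (\<i> * of_int (m $ j) * v b m))"
    have flat: "(\<Sum>a\<in>UNIV. \<Sum>k\<in>K. \<Sum>b\<in>UNIV. \<Sum>m\<in>K. cnj (v a k) * B j a b (k - m) * (\<i> * of_int (m $ j) * v b m)) =
        (\<Sum>P\<in>UNIV \<times> K. \<Sum>Q\<in>UNIV \<times> K. g P Q)"
      unfolding sum.cartesian_product' by (simp add: g_def)
    have "g P Q + cnj (g Q P) = (case P of (a, k) \<Rightarrow> case Q of (b, m) \<Rightarrow>
        cnj (v a k) * B j a b (k - m) * (\<i> * of_int (m $ j - k $ j) * v b m))" for P Q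
    proof -
      obtain a k b m where PQ: "P = (a, k)" "Q = (b, m)" by fastforce
      have "cnj (B j b a (m - k)) = B j a b (k - m)"
        using real_coeff[of j b a "m - k"] symmetric[of j b a "k - m"] by simp
      then show ?thesis by (simp add: PQ g_def algebra_simps)
    qed
    then have "(\<Sum>P\<in>UNIV \<times> K. \<Sum>Q\<in>UNIV \<times> K. g P Q + cnj (g Q P)) =
        (\<Sum>a\<in>UNIV. \<Sum>k\<in>K. \<Sum>b\<in>UNIV. \<Sum>m\<in>K. cnj (v a k) * B j a b (k - m) * (\<i> * of_int (m $ j - k $ j) * v b m))"
      by (simp only: sum.cartesian_product' case_prod_conv)
    also have "\<dots> = (\<Sum>a\<in>UNIV. \<Sum>b\<in>UNIV. D j a b)"
      unfolding D_def by (intro sum.cong refl sum.swap)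
    finally show ?thesis
      unfolding flat hermitian_part[of g] by simp
  qed
  have "(\<Sum>a\<in>UNIV. \<Sum>k\<in>K. of_real (japanese_bracket k powr (2 * \<sigma>)) * cnj (c a k) *
            (\<Sum>j\<in>UNIV. \<Sum>b\<in>UNIV. \<Sum>m\<in>K. B j a b (k - m) * (\<i> * of_int (m $ j) * c b m))) =
      (\<Sum>a\<in>UNIV. \<Sum>k\<in>K. \<Sum>j\<in>UNIV. \<Sum>b\<in>UNIV. \<Sum>m\<in>K.
         cnj (v a k) * B j a b (k - m) * (\<i> * of_int (m $ j) * v b m)
       + cnj (v a k) * B j a b (k - m) * (\<i> * of_int (m $ j) * (of_real (?w k - ?w m) * c b m)))"
    unfolding sum_distrib_left w2 by (intro sum.cong refl) (simp add: v_def algebra_simps)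
  also have "\<dots> = (\<Sum>j\<in>UNIV. \<Sum>a\<in>UNIV. \<Sum>k\<in>K. \<Sum>b\<in>UNIV. \<Sum>m\<in>K. cnj (v a k) * B j a b (k - m) * (\<i> * of_int (m $ j) * v b m))
     + (\<Sum>j\<in>UNIV. \<Sum>a\<in>UNIV. \<Sum>b\<in>UNIV. E j a b)"
  proof -
    have "(\<Sum>a\<in>UNIV. \<Sum>k\<in>K. \<Sum>j\<in>UNIV. \<Sum>b\<in>UNIV. \<Sum>m\<in>K. h a k j b m) =
        (\<Sum>j\<in>UNIV. \<Sum>a\<in>UNIV. \<Sum>k\<in>K. \<Sum>b\<in>UNIV. \<Sum>m\<in>K. h a k j b m)"
      for h :: "'n \<Rightarrow> int^'d \<Rightarrow> 'd \<Rightarrow> 'n \<Rightarrow> int^'d \<Rightarrow> complex"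
      by (subst (2) sum.swap) (intro sum.cong refl sum.swap)
    moreover have "(\<Sum>k\<in>K. \<Sum>b\<in>UNIV. \<Sum>m\<in>K. cnj (v a k) * B j a b (k - m) * (\<i> * of_int (m $ j) * (of_real (?w k - ?w m) * c b m))) =
       (\<Sum>b\<in>UNIV. E j a b)" for j a
      unfolding E_def by (rule sum.swap)
    ultimately show ?thesis by (simp only: sum.distrib)
  qed
  finally have eq: "Re (\<Sum>a\<in>UNIV. \<Sum>k\<in>K. of_real (japanese_bracket k powr (2 * \<sigma>)) * cnj (c a k) *
            (\<Sum>j\<in>UNIV. \<Sum>b\<in>UNIV. \<Sum>m\<in>K. B j a b (k - m) * (\<i> * of_int (m $ j) * c b m))) =
      (\<Sum>j\<in>UNIV. Re (\<Sum>a\<in>UNIV. \<Sum>b\<in>UNIV. D j a b) / 2) + Re (\<Sum>j\<in>UNIV. \<Sum>a\<in>UNIV. \<Sum>b\<in>UNIV. E j a b)"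
    by (simp only: plus_complex.sel) (subst Re_sum, simp only: symm)
  also have "\<bar>\<dots>\<bar> \<le> (\<Sum>j\<in>(UNIV::'d set). (\<Sum>a\<in>(UNIV::'n set). \<Sum>b\<in>(UNIV::'n set). \<kappa> * \<alpha> * \<beta>\<^sup>2) / 2)
      + (\<Sum>j\<in>(UNIV::'d set). \<Sum>a\<in>(UNIV::'n set). \<Sum>b\<in>(UNIV::'n set). 2 * C * (\<kappa> * \<alpha> * \<beta>\<^sup>2))"
  proof (intro order_trans[OF abs_triangle_ineq] add_mono order_trans[OF sum_abs] sum_mono)
    fix j
    have "\<bar>Re (\<Sum>a\<in>UNIV. \<Sum>b\<in>UNIV. D j a b)\<bar> \<le> (\<Sum>a\<in>(UNIV::'n set). \<Sum>b\<in>(UNIV::'n set). \<kappa> * \<alpha> * \<beta>\<^sup>2)"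
      by (intro order_trans[OF abs_Re_le_cmod] order_trans[OF norm_sum] sum_mono D)
    then show "\<bar>Re (\<Sum>a\<in>UNIV. \<Sum>b\<in>UNIV. D j a b) / 2\<bar> \<le> (\<Sum>a\<in>(UNIV::'n set). \<Sum>b\<in>(UNIV::'n set). \<kappa> * \<alpha> * \<beta>\<^sup>2) / 2"
      by simp
  next
    show "\<bar>Re (\<Sum>j\<in>UNIV. \<Sum>a\<in>UNIV. \<Sum>b\<in>UNIV. E j a b)\<bar> \<le>
        (\<Sum>j\<in>(UNIV::'d set). \<Sum>a\<in>(UNIV::'n set). \<Sum>b\<in>(UNIV::'n set). 2 * C * (\<kappa> * \<alpha> * \<beta>\<^sup>2))"
      by (intro order_trans[OF abs_Re_le_cmod] order_trans[OF norm_sum] sum_mono E)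
  qed
  also have "\<dots> = real (CARD('d) * CARD('n)\<^sup>2) * (1/2 + 2 * C) * (\<kappa> * \<alpha> * \<beta>\<^sup>2)"
    by (simp add: power2_eq_square algebra_simps)
  finally show ?thesis by (simp only: C_def)
qed

section \<open>Real trigonometric vector fields\<close>

lemma trig_vec_has_derivative:
  fixes U :: "real^'d \<Rightarrow> real^'n"
  assumes U: "trig_vec N U"
  obtains D where "(U has_derivative D) (at x)"
    "\<And>h i. complex_of_real (D h $ i) = (\<Sum>k\<in>freq_box N. \<i> * of_real (freq_dot k h) * fourier_coeff U k $ i * wave k x)"
proof -
  define D where "D = (\<lambda>h. \<chi> i. Re (\<Sum>k\<in>freq_box N. \<i> * of_real (freq_dot k h) * fourier_coeff U k $ i * wave k x))"
  have g: "((\<lambda>x. complex_of_real (U x $ i)) has_derivative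
     (\<lambda>h. \<Sum>k\<in>freq_box N. \<i> * of_real (freq_dot k h) * fourier_coeff U k $ i * wave k x)) (at x)" for i
    unfolding fourier_coeff_nth by (rule trig_poly_has_derivative[OF trig_vecD[OF U]])
  have comp: "((\<lambda>x. U x $ i) has_derivative (\<lambda>h. D h $ i)) (at x)" for i
    using bounded_linear.has_derivative[OF bounded_linear_Re g[of i]] by (simp add: D_def)
  have 1: "(U has_derivative D) (at x)"
    by (subst has_derivative_componentwise_within) (auto simp: Basis_vec_def inner_axis comp)
  have 2: "complex_of_real (D h $ i) = (\<Sum>k\<in>freq_box N. \<i> * of_real (freq_dot k h) * fourier_coeff U k $ i * wave k x)" for h i
    using has_derivative_unique[OF bounded_linear.has_derivative[OF bounded_linear_of_real comp[of i]] g[of i]]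
    by (rule fun_cong)
  show ?thesis using that[OF 1 2] .
qed

lemma trig_vec_differentiable: "trig_vec N U \<Longrightarrow> U differentiable (at x)"
  by (meson differentiable_def trig_vec_has_derivative)

lemma trig_vec_continuous: "trig_vec N U \<Longrightarrow> continuous_on S U"
  by (intro continuous_at_imp_continuous_on ballI differentiable_imp_continuous_within
      trig_vec_differentiable)

lemma partial_deriv_expand:
  assumes U: "trig_vec N U"
  shows "complex_of_real (partial_deriv j U x $ i) =
    (\<Sum>k\<in>freq_box N. (\<i> * of_int (k $ j) * fourier_coeff U k $ i) * wave k x)"
proof -
  obtain D where D: "(U has_derivative D) (at x)"
    "\<And>h i. complex_of_real (D h $ i) = (\<Sum>k\<in>freq_box N. \<i> * of_real (freq_dot k h) * fourier_coeff U k $ i * wave k x)"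
    using trig_vec_has_derivative[OF U] by blast
  have "partial_deriv j U x = D (axis j 1)"
    unfolding partial_deriv_def using frechet_derivative_at[OF D(1)] by simp
  then show ?thesis by (simp add: D(2) freq_dot_axis)
qed

lemma trig_poly_partial_deriv:
  assumes U: "trig_vec N U"
  shows "trig_poly N (\<lambda>x. of_real (partial_deriv j U x $ i))"
    and "k \<in> freq_box N \<Longrightarrow> fcoeff (\<lambda>x. of_real (partial_deriv j U x $ i)) k = \<i> * of_int (k $ j) * fourier_coeff U k $ i"
  unfolding partial_deriv_expand[OF U]
  by (auto simp: trig_poly_def fcoeff_wave_sum)

lemma quasilinear_term_nth:
  "quasilinear_term A U x $ a = (\<Sum>j\<in>UNIV. \<Sum>b\<in>UNIV. A j (U x) $ a $ b * partial_deriv j U x $ b)"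
  by (simp add: quasilinear_term_def sum_component matrix_vector_mult_def)

lemma fourier_coeff_quasilinear:
  assumes U: "trig_vec N U"
    and A: "\<And>j a b. \<exists>M. trig_poly M (\<lambda>x. of_real (A j (U x) $ a $ b))"
  shows "fourier_coeff (quasilinear_term A U) k $ a = (\<Sum>j\<in>UNIV. \<Sum>b\<in>UNIV. \<Sum>m\<in>freq_box N.
      fcoeff (\<lambda>x. of_real (A j (U x) $ a $ b)) (k - m) * (\<i> * of_int (m $ j) * fourier_coeff U m $ b))"
proof -
  have cA: "continuous_on UNIV (\<lambda>x. complex_of_real (A j (U x) $ a $ b))" for j a b
    using A trig_poly_continuous by blast
  have cU: "continuous_on UNIV (\<lambda>x. complex_of_real (partial_deriv j U x $ b))" for j b
    by (rule trig_poly_continuous[OF trig_poly_partial_deriv(1)[OF U]])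
  have "fourier_coeff (quasilinear_term A U) k $ a = fcoeff (\<lambda>x. \<Sum>j\<in>UNIV. \<Sum>b\<in>UNIV.
      of_real (A j (U x) $ a $ b) * of_real (partial_deriv j U x $ b)) k"
    by (simp add: fourier_coeff_nth quasilinear_term_nth)
  also have "\<dots> = (\<Sum>j\<in>UNIV. fcoeff (\<lambda>x. \<Sum>b\<in>UNIV. of_real (A j (U x) $ a $ b) * of_real (partial_deriv j U x $ b)) k)"
    by (rule fcoeff_sum) (auto intro!: continuous_on_sum continuous_on_mult cA cU)
  also have "\<dots> = (\<Sum>j\<in>UNIV. \<Sum>b\<in>UNIV. fcoeff (\<lambda>x. of_real (A j (U x) $ a $ b) * of_real (partial_deriv j U x $ b)) k)"
    by (intro sum.cong refl fcoeff_sum) (auto intro!: continuous_on_mult cA cU)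
  also have "\<dots> = (\<Sum>j\<in>UNIV. \<Sum>b\<in>UNIV. \<Sum>m\<in>freq_box N.
      fcoeff (\<lambda>x. of_real (A j (U x) $ a $ b)) (k - m) * (\<i> * of_int (m $ j) * fourier_coeff U m $ b))"
    by (intro sum.cong refl)
      (simp add: fcoeff_mult[OF cA trig_poly_partial_deriv(1)[OF U]] trig_poly_partial_deriv(2)[OF U])
  finally show ?thesis .
qed

lemma trig_vec_fourier_outside: "trig_vec N U \<Longrightarrow> k \<notin> freq_box N \<Longrightarrow> fourier_coeff U k = 0"
  by (simp add: vec_eq_iff fourier_coeff_nth trig_poly_fcoeff_outside[OF trig_vecD])

lemma sobolev_norm_trig_vec:
  assumes U: "trig_vec N U"
  shows "sobolev_norm s U = sqrt (\<Sum>k\<in>freq_box N. japanese_bracket k powr (2 * s) * (norm (fourier_coeff U k))\<^sup>2)"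
proof -
  have "(\<Sum>\<^sub>\<infinity>k. japanese_bracket k powr (2 * s) * (norm (fourier_coeff U k))\<^sup>2) =
      (\<Sum>\<^sub>\<infinity>k\<in>freq_box N. japanese_bracket k powr (2 * s) * (norm (fourier_coeff U k))\<^sup>2)"
    by (rule infsum_cong_neutral) (auto simp: trig_vec_fourier_outside[OF U])
  then show ?thesis by (simp add: sobolev_norm_def)
qed

lemma l2_bound_sobolev_norm:
  assumes U: "trig_vec N U"
  shows "l2_bound (\<lambda>k. japanese_bracket k powr s * norm (fourier_coeff U k $ a)) (sobolev_norm s U)"
  unfolding l2_bound_def
proof safe
  fix F :: "(int^'a) set" assume F: "finite F"
  let ?f = "\<lambda>k. japanese_bracket k powr (2 * s) * (norm (fourier_coeff U k))\<^sup>2"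
  have "(\<Sum>k\<in>F. (japanese_bracket k powr s * norm (fourier_coeff U k $ a))\<^sup>2) \<le> (\<Sum>k\<in>F. ?f k)"
  proof (rule sum_mono)
    fix k :: "int^'a"
    have "(japanese_bracket k powr s)\<^sup>2 = japanese_bracket k powr (2 * s)"
      by (simp add: power2_eq_square powr_add[symmetric])
    moreover have "(norm (fourier_coeff U k $ a))\<^sup>2 \<le> (norm (fourier_coeff U k))\<^sup>2"
      by (intro power_mono Finite_Cartesian_Product.norm_nth_le norm_ge_zero)
    ultimately show "(japanese_bracket k powr s * norm (fourier_coeff U k $ a))\<^sup>2 \<le> ?f k"
      by (simp add: power_mult_distrib mult_left_mono)
  qed
  also have "\<dots> \<le> (\<Sum>k\<in>F \<union> freq_box N. ?f k)"
    using F by (intro sum_mono2) auto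
  also have "\<dots> = (\<Sum>k\<in>freq_box N. ?f k)"
    using F by (intro sum.mono_neutral_right) (auto simp: trig_vec_fourier_outside[OF U])
  finally show "L2_set (\<lambda>k. japanese_bracket k powr s * norm (fourier_coeff U k $ a)) F \<le> sobolev_norm s U"
    unfolding L2_set_def sobolev_norm_trig_vec[OF U] by (rule real_sqrt_le_mono)
qed

section \<open>The energy estimate\<close>

text \<open>Up to the factor \<open>-2\<close>, the time derivative of \<open>|U|\<^sub>\<sigma>\<^sup>2\<close> along the filtered equation.\<close>

definition energy_production ::
    "('d \<Rightarrow> real^'n \<Rightarrow> real^'n^'n) \<Rightarrow> nat \<Rightarrow> real \<Rightarrow> (real^'d \<Rightarrow> real^'n) \<Rightarrow> real" where
  "energy_production A N \<sigma> U = (\<Sum>k\<in>freq_box N. japanese_bracket k powr (2 * \<sigma>) * (fourier_coeff U k \<bullet> fourier_coeff (quasilinear_term A U) k))"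

text \<open>The upper bound \<open>R\<close> on the \<open>H\<^sup>s\<close> norm enters through the Wiener norm of \<open>U\<close>, on which the constants of the
  polynomials \<open>A j\<close> depend.\<close>

theorem filtered_energy_estimate:
  fixes A :: "'d::finite \<Rightarrow> real^'n::finite \<Rightarrow> real^'n^'n" and s \<sigma> :: real
  assumes symmetric: "\<And>j u. transpose (A j u) = A j u"
    and polynomial: "\<And>j a b. real_polynomial_function (\<lambda>u. A j u $ a $ b)"
    and s: "s > real CARD('d) / 2 + 1" and \<sigma>: "\<sigma> \<ge> 1"
  obtains C where "C > 0" "\<And>N (U :: real^'d \<Rightarrow> real^'n). trig_vec N U \<Longrightarrow> sobolev_norm s U \<le> R \<Longrightarrow>
    \<bar>energy_production A N \<sigma> U\<bar>
      \<le> C * sobolev_norm s U * (sobolev_norm \<sigma> U)\<^sup>2"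
proof -
  obtain W where W: "W > 0" "\<And>(a::int^'d \<Rightarrow> complex) B. l2_bound (\<lambda>k. japanese_bracket k powr s * norm (a k)) B \<Longrightarrow>
     l1_bound (\<lambda>k. japanese_bracket k * norm (a k)) (W * B)"
    using sobolev_wiener_embedding[OF s] by blast
  \<comment> \<open>At least \<open>1\<close>, so that the components of \<open>U\<close> satisfy the bounds \<open>R' * \<alpha>\<close> and \<open>R' * \<beta>\<close> below.\<close>
  define R' where "R' = max 1 (W * R)"
  have "\<exists>\<kappa>. \<forall>(U::real^'d \<Rightarrow> real^'n) \<alpha> \<beta>. \<alpha> \<ge> 0 \<longrightarrow> \<beta> \<ge> 0 \<longrightarrow>
     (\<forall>i. tame_bound \<sigma> \<alpha> \<beta> R' (\<lambda>x. of_real (U x $ i))) \<longrightarrow>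
     tame_bound \<sigma> \<alpha> \<beta> \<kappa> (\<lambda>x. of_real (A j (U x) $ a $ b))" for j a b
    by (rule tame_bound_polynomial[OF polynomial \<sigma>])
  then obtain \<kappa> where \<kappa>: "\<And>j a b (U::real^'d \<Rightarrow> real^'n) \<alpha> \<beta>. \<alpha> \<ge> 0 \<Longrightarrow> \<beta> \<ge> 0 \<Longrightarrow>
     \<forall>i. tame_bound \<sigma> \<alpha> \<beta> R' (\<lambda>x. of_real (U x $ i)) \<Longrightarrow>
     tame_bound \<sigma> \<alpha> \<beta> (\<kappa> j a b) (\<lambda>x. of_real (A j (U x) $ a $ b))" by metis
  \<comment> \<open>One constant for all matrix entries.\<close>
  define \<kappa>1 where "\<kappa>1 = (\<Sum>j\<in>UNIV. \<Sum>a\<in>UNIV. \<Sum>b\<in>UNIV. \<bar>\<kappa> j a b\<bar>)"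
  have \<kappa>1: "\<kappa> j a b \<le> \<kappa>1" for j a b
  proof -
    have "\<kappa> j a b \<le> \<bar>\<kappa> j a b\<bar>" by simp
    also have "\<dots> \<le> (\<Sum>b\<in>UNIV. \<bar>\<kappa> j a b\<bar>)"
      by (rule member_le_sum[of b _ "\<lambda>b. \<bar>\<kappa> j a b\<bar>"]) auto
    also have "\<dots> \<le> (\<Sum>a\<in>UNIV. \<Sum>b\<in>UNIV. \<bar>\<kappa> j a b\<bar>)"
      by (rule member_le_sum[of a _ "\<lambda>a. \<Sum>b\<in>UNIV. \<bar>\<kappa> j a b\<bar>"]) (auto intro: sum_nonneg)
    also have "\<dots> \<le> \<kappa>1" unfolding \<kappa>1_def
      by (rule member_le_sum[of j _ "\<lambda>j. \<Sum>a\<in>UNIV. \<Sum>b\<in>UNIV. \<bar>\<kappa> j a b\<bar>"]) (auto intro: sum_nonneg)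
    finally show ?thesis .
  qed
  have \<kappa>1_0: "\<kappa>1 \<ge> 0" unfolding \<kappa>1_def by (intro sum_nonneg) auto
  define L where "L = real (CARD('d) * CARD('n)\<^sup>2) * (1/2 + 2 * (\<sigma> * 2 powr (\<sigma> - 1)))"
  have L0: "L \<ge> 0" using \<sigma> by (auto simp: L_def)
  have main: "\<bar>energy_production A N \<sigma> U\<bar>
      \<le> (L * \<kappa>1 * W + 1) * sobolev_norm s U * (sobolev_norm \<sigma> U)\<^sup>2"
    if U: "trig_vec N U" and UR: "sobolev_norm s U \<le> R" for N and U :: "real^'d \<Rightarrow> real^'n"
  proof -
    define \<alpha> \<beta> where "\<alpha> = W * sobolev_norm s U" and "\<beta> = sobolev_norm \<sigma> U"
    have \<alpha>: "\<alpha> \<ge> 0" and \<beta>: "\<beta> \<ge> 0"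
      unfolding \<alpha>_def \<beta>_def using W(1) l2_bound_nonneg[OF l2_bound_sobolev_norm[OF U]] by auto
    let ?c = "\<lambda>a k. fourier_coeff U k $ a"
    have wiener: "l1_bound (\<lambda>k. japanese_bracket k * norm (?c a k)) \<alpha>" for a
      unfolding \<alpha>_def by (rule W(2)[OF l2_bound_sobolev_norm[OF U]])
    have c2: "l2_bound (\<lambda>k. japanese_bracket k powr \<sigma> * norm (?c a k)) \<beta>" for a
      unfolding \<beta>_def by (rule l2_bound_sobolev_norm[OF U])
    have c1: "l1_bound (\<lambda>k. fnorm k * norm (?c a k)) \<alpha>" for a
      by (rule l1_bound_mono[OF wiener]) (auto intro: mult_right_mono fnorm_le_japanese_bracket)
    have c0: "l1_bound (\<lambda>k. norm (?c a k)) R'" for a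
    proof (rule l1_bound_mono[OF wiener])
      show "norm (?c a k) \<le> japanese_bracket k * norm (?c a k)" for k
        using mult_right_mono[OF japanese_bracket_ge_1[of k] norm_ge_zero[of "?c a k"]] by simp
      have "\<alpha> \<le> W * R" unfolding \<alpha>_def using UR W(1) by simp
      then show "\<alpha> \<le> R'" unfolding R'_def by simp
    qed
    have "tame_bound \<sigma> \<alpha> \<beta> R' (\<lambda>x. of_real (U x $ i))" for i
      unfolding tame_bound_def fourier_coeff_nth[symmetric]
    proof (intro conjI c0)
      have R': "\<alpha> \<le> R' * \<alpha>" "\<beta> \<le> R' * \<beta>"
        using mult_right_mono[of 1 R'] \<alpha> \<beta> by (auto simp: R'_def)
      show "\<exists>M. trig_poly M (\<lambda>x. complex_of_real (U x $ i))" using trig_vecD[OF U] by blast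
      show "l1_bound (\<lambda>k. fnorm k * norm (?c i k)) (R' * \<alpha>)"
        by (rule l1_bound_mono[OF c1[of i] _ R'(1)]) simp
      show "l2_bound (\<lambda>k. tame_weight \<sigma> k * norm (?c i k)) (R' * \<beta>)"
        by (rule l2_bound_mono[OF c2[of i] _ _ R'(2)]) (auto intro: mult_right_mono tame_weight_le)
    qed
    then have tA: "tame_bound \<sigma> \<alpha> \<beta> \<kappa>1 (\<lambda>x. of_real (A j (U x) $ a $ b))" for j a b
      by (intro tame_bound_mono[OF \<kappa> \<kappa>1] \<alpha> \<beta> allI)
    define B where "B = (\<lambda>j a b. fcoeff (\<lambda>x. complex_of_real (A j (U x) $ a $ b)))"
    have Bcnj: "B j a b (- p) = cnj (B j a b p)" for j a b p
      unfolding B_def using fcoeff_cnj[of "\<lambda>x. complex_of_real (A j (U x) $ a $ b)" "- p"] by simp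
    have Bsym: "B j a b p = B j b a p" for j a b p
    proof -
      have "A j u $ a $ b = A j u $ b $ a" for u
        using arg_cong[OF symmetric[of j u], of "\<lambda>X. X $ b $ a"] by (simp add: transpose_def)
      then show ?thesis by (simp add: B_def)
    qed
    have "energy_production A N \<sigma> U =
      Re (\<Sum>a\<in>UNIV. \<Sum>k\<in>freq_box N. of_real (japanese_bracket k powr (2 * \<sigma>)) * cnj (?c a k) *
            (\<Sum>j\<in>UNIV. \<Sum>b\<in>UNIV. \<Sum>m\<in>freq_box N. B j a b (k - m) * (\<i> * of_int (m $ j) * ?c b m)))"
    proof -
      have q: "fourier_coeff (quasilinear_term A U) k $ a = (\<Sum>j\<in>UNIV. \<Sum>b\<in>UNIV. \<Sum>m\<in>freq_box N. B j a b (k - m) * (\<i> * of_int (m $ j) * ?c b m))" for k a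
        unfolding B_def by (rule fourier_coeff_quasilinear[OF U]) (use tA in \<open>auto simp: tame_bound_def\<close>)
      have i: "x \<bullet> y = Re (\<Sum>a\<in>UNIV. cnj (x $ a) * y $ a)" for x y :: "complex^'n"
        by (simp add: inner_vec_def inner_complex_def)
      have "(\<Sum>k\<in>freq_box N. japanese_bracket k powr (2 * \<sigma>) * (fourier_coeff U k \<bullet> fourier_coeff (quasilinear_term A U) k)) =
        Re (\<Sum>k\<in>freq_box N. \<Sum>a\<in>UNIV. of_real (japanese_bracket k powr (2 * \<sigma>)) * (cnj (?c a k) * fourier_coeff (quasilinear_term A U) k $ a))"
        unfolding i by (simp add: sum_distrib_left del: complex_cnj_cnj)
      then show ?thesis unfolding q energy_production_def by (subst (asm) sum.swap) (simp only: mult.assoc)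
    qed
    also have "\<bar>\<dots>\<bar> \<le> L * (\<kappa>1 * \<alpha> * \<beta>\<^sup>2)"
      unfolding L_def
    proof (rule commutator_estimate[where c="?c" and B=B, OF \<sigma> finite_freq_box])
      show "l1_bound (\<lambda>k. fnorm k * norm (B j a b k)) (\<kappa>1 * \<alpha>)"
        "l2_bound (\<lambda>k. tame_weight \<sigma> k * norm (B j a b k)) (\<kappa>1 * \<beta>)" for j a b
        using tA[of j a b] by (simp_all add: tame_bound_def B_def)
    qed (fact Bcnj Bsym c2 c1)+
    also have "\<dots> \<le> (L * \<kappa>1 * W + 1) * sobolev_norm s U * (sobolev_norm \<sigma> U)\<^sup>2"
      using l2_bound_nonneg[OF l2_bound_sobolev_norm[OF U, of s]] by (simp add: \<alpha>_def \<beta>_def algebra_simps)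
    finally show ?thesis .
  qed
  have "L * \<kappa>1 * W + 1 > 0" using L0 \<kappa>1_0 W(1) by (intro add_nonneg_pos mult_nonneg_nonneg) auto
  then show ?thesis using that main by blast
qed

section \<open>The low-pass filter\<close>

lemma fourier_coeff_cnj: "cnj (fourier_coeff U k $ i) = fourier_coeff U (- k) $ i"
  using fcoeff_cnj[of "\<lambda>x. complex_of_real (U x $ i)" "- k"] by (simp add: fourier_coeff_nth)

text \<open>The coefficients of a real function at \<open>k\<close> and \<open>-k\<close> are conjugate, so the filtered sum is real and taking its real
  part changes nothing.\<close>

lemma low_pass_expand:
  "complex_of_real (low_pass N F x $ i) = (\<Sum>k\<in>freq_box N. fourier_coeff F k $ i * wave k x)"
proof -
  let ?S = "\<Sum>k\<in>freq_box N. fourier_coeff F k $ i * wave k x"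
  have "cnj ?S = (\<Sum>k\<in>freq_box N. fourier_coeff F (- k) $ i * wave (- k) x)"
    by (simp add: fourier_coeff_cnj wave_uminus)
  also have "\<dots> = ?S"
    by (rule sum.reindex_bij_witness[of _ uminus uminus]) (auto simp: freq_box_uminus)
  finally have "complex_of_real (Re ?S) = ?S"
    using complex_add_cnj[of ?S] by (simp add: complex_eq_iff)
  then show ?thesis by (simp add: low_pass_def freq_box_def wave_def)
qed

lemma trig_vec_low_pass: "trig_vec N (low_pass N F)"
  unfolding trig_vec_def low_pass_expand by (auto simp: trig_poly_def)

lemma low_pass_trig_vec:
  assumes "trig_vec N U"
  shows "low_pass N U = U"
proof
  fix x
  have "complex_of_real (low_pass N U x $ i) = of_real (U x $ i)" for i
    unfolding low_pass_expand fourier_coeff_nth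
    by (rule trig_poly_expand[OF trig_vecD[OF assms], symmetric])
  then show "low_pass N U x = U x" by (simp add: vec_eq_iff)
qed

lemma fourier_coeff_low_pass: "fourier_coeff (low_pass N F) k = (if k \<in> freq_box N then fourier_coeff F k else 0)"
proof -
  have "fourier_coeff (low_pass N F) k $ i = (if k \<in> freq_box N then fourier_coeff F k $ i else 0)" for i
    unfolding fourier_coeff_nth[of "low_pass N F"] low_pass_expand by (rule fcoeff_wave_sum) simp
  then show ?thesis by (simp add: vec_eq_iff)
qed

lemma trig_vec_bounded:
  assumes "trig_vec N U"
  shows "norm (U x) \<le> (\<Sum>i\<in>UNIV. \<Sum>k\<in>freq_box N. norm (fourier_coeff U k $ i))"
proof -
  have "norm (U x) \<le> (\<Sum>i\<in>UNIV. \<bar>U x $ i\<bar>)" by (rule norm_le_l1_cart)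
  also have "\<dots> \<le> (\<Sum>i\<in>UNIV. \<Sum>k\<in>freq_box N. norm (fourier_coeff U k $ i))"
  proof (rule sum_mono)
    fix i
    have "\<bar>U x $ i\<bar> = norm (\<Sum>k\<in>freq_box N. fourier_coeff U k $ i * wave k x)"
      unfolding fourier_coeff_nth trig_poly_expand[OF trig_vecD[OF assms], symmetric] by simp
    also have "\<dots> \<le> (\<Sum>k\<in>freq_box N. norm (fourier_coeff U k $ i))"
      by (intro order_trans[OF norm_sum]) (simp add: norm_mult)
    finally show "\<bar>U x $ i\<bar> \<le> (\<Sum>k\<in>freq_box N. norm (fourier_coeff U k $ i))" .
  qed
  finally show ?thesis .
qed

lemma trig_vec_bcontfun: "trig_vec N U \<Longrightarrow> U \<in> bcontfun"
  by (rule bcontfun_normI[OF trig_vec_continuous trig_vec_bounded])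

lemma trig_vec_sobolev:
  assumes U: "trig_vec N U"
  shows "U \<in> sobolev s"
proof -
  have "torus_periodic U" unfolding torus_periodic_def
  proof safe
    fix x j
    have "complex_of_real (U (x + axis j (2 * pi)) $ i) = of_real (U x $ i)" for i
      by (rule trig_poly_periodic[OF trig_vecD[OF U]])
    then show "U (x + axis j (2 * pi)) = U x" by (simp add: vec_eq_iff)
  qed
  moreover have "U \<in> borel_measurable lebesgue"
    by (rule measurable_completion) (simp add: borel_measurable_continuous_onI trig_vec_continuous[OF U])
  moreover have "set_integrable lebesgue torus_cell (\<lambda>x. (norm (U x))\<^sup>2)"
    by (intro set_integrable_cell continuous_intros trig_vec_continuous[OF U])
  moreover have "(\<lambda>k. japanese_bracket k powr (2 * s) * (norm (fourier_coeff U k))\<^sup>2) summable_on UNIV"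
  proof -
    have "(\<lambda>k. japanese_bracket k powr (2 * s) * (norm (fourier_coeff U k))\<^sup>2) summable_on freq_box N" by simp
    then show ?thesis
      by (rule summable_on_cong_neutral[THEN iffD1, rotated -1]) (auto simp: trig_vec_fourier_outside[OF U])
  qed
  ultimately show ?thesis by (simp add: sobolev_def torus_L2_def)
qed

lemma sobolev_norm_low_pass:
  assumes "U \<in> sobolev s"
  shows "sobolev_norm s (low_pass N U) \<le> sobolev_norm s U"
proof -
  let ?f = "\<lambda>k. japanese_bracket k powr (2 * s) * (norm (fourier_coeff U k))\<^sup>2"
  have "sobolev_norm s (low_pass N U) = sqrt (\<Sum>k\<in>freq_box N. ?f k)"
    unfolding sobolev_norm_trig_vec[OF trig_vec_low_pass] by (simp add: fourier_coeff_low_pass)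
  also have "\<dots> \<le> sqrt (infsum ?f UNIV)"
    using assms by (intro real_sqrt_le_mono finite_sum_le_infsum) (auto simp: sobolev_def)
  finally show ?thesis by (simp add: sobolev_norm_def)
qed

section \<open>Linear functionals of bounded continuous functions\<close>

lemma fcoeff_bound:
  fixes g :: "real^'d \<Rightarrow> complex"
  assumes g: "continuous_on UNIV g" and B: "\<And>x. norm (g x) \<le> B"
  shows "norm (fcoeff g k) \<le> B"
proof -
  have "B \<ge> 0" using B[of 0] norm_ge_zero order_trans by blast
  have eq: "(LINT x:torus_cell|lebesgue. wave (- k) x * g x) = integral torus_cell (\<lambda>x. wave (- k) x * g x)"
    and int: "(\<lambda>x. wave (- k) x * g x) integrable_on torus_cell"
    using set_lebesgue_integral_eq_integral[OF set_integrable_fcoeff[OF g]] by auto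
  have content: "measure lborel (torus_cell :: (real^'d) set) = (2 * pi) ^ CARD('d)"
    unfolding torus_cell_def by (subst content_cbox_cart) (auto simp: interval_ne_empty_cart)
  have "norm (integral torus_cell (\<lambda>x. wave (- k) x * g x)) \<le> B * measure lborel (torus_cell :: (real^'d) set)"
    using int unfolding torus_cell_def
    by (intro integrable_bound \<open>B \<ge> 0\<close>) (auto simp: norm_mult B)
  moreover have "norm (complex_of_real ((2 * pi) ^ CARD('d))) = (2 * pi) ^ CARD('d)"
    by (simp only: norm_of_real) simp
  ultimately show ?thesis
    unfolding fcoeff_def eq content norm_divide by (simp add: pos_divide_le_eq)
qed

lemma continuous_on_bcontfun_nth:
  "continuous_on S (\<lambda>x. complex_of_real (apply_bcontfun u x $ i))"
  by (intro continuous_intros continuous_on_apply_bcontfun)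

lemma norm_vec_le_sum: "norm (x :: 'b::real_normed_vector ^ 'n) \<le> (\<Sum>i\<in>UNIV. norm (x $ i))"
  unfolding norm_vec_def by (rule L2_set_le_sum) simp

lemma bounded_linear_fourier_coeff:
  "bounded_linear (\<lambda>u::(real^'d) \<Rightarrow>\<^sub>C (real^'n). fourier_coeff (apply_bcontfun u) k)"
proof (rule bounded_linear_intro)
  fix u v :: "(real^'d) \<Rightarrow>\<^sub>C (real^'n)" and r :: real
  show "fourier_coeff (apply_bcontfun (u + v)) k = fourier_coeff (apply_bcontfun u) k + fourier_coeff (apply_bcontfun v) k"
    by (simp add: vec_eq_iff fourier_coeff_nth fcoeff_add[OF continuous_on_bcontfun_nth continuous_on_bcontfun_nth])
  show "fourier_coeff (apply_bcontfun (r *\<^sub>R u)) k = r *\<^sub>R fourier_coeff (apply_bcontfun u) k"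
    by (simp add: vec_eq_iff fourier_coeff_nth fcoeff_cmult) (simp add: scaleR_conv_of_real)
  have "norm (fourier_coeff (apply_bcontfun u) k $ i) \<le> norm u" for i
    unfolding fourier_coeff_nth
  proof (rule fcoeff_bound[OF continuous_on_bcontfun_nth])
    fix x
    have "\<bar>apply_bcontfun u x $ i\<bar> \<le> norm (apply_bcontfun u x)" by (rule component_le_norm_cart)
    then show "norm (complex_of_real (apply_bcontfun u x $ i)) \<le> norm u"
      using norm_bounded[of u x] by simp
  qed
  then have "(\<Sum>i\<in>UNIV. norm (fourier_coeff (apply_bcontfun u) k $ i)) \<le> (\<Sum>i\<in>(UNIV::'n set). norm u)"
    by (rule sum_mono)
  then show "norm (fourier_coeff (apply_bcontfun u) k) \<le> norm u * real CARD('n)"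
    using norm_vec_le_sum[of "fourier_coeff (apply_bcontfun u) k"] by (simp add: mult.commute)
qed

lemma bounded_linear_eval: "bounded_linear (\<lambda>u::'a::topological_space \<Rightarrow>\<^sub>C 'b::real_normed_vector. apply_bcontfun u x)"
  by (rule bounded_linear_intro[where K=1]) (auto simp: norm_bounded)

lemma bounded_linear_low_pass:
  "bounded_linear (\<lambda>u::(real^'d) \<Rightarrow>\<^sub>C (real^'n). low_pass N (apply_bcontfun u) x)"
proof -
  have "bounded_linear (\<lambda>u::(real^'d) \<Rightarrow>\<^sub>C (real^'n).
      Re (\<Sum>k\<in>freq_box N. fourier_coeff (apply_bcontfun u) k $ i * wave k x))" for i
    by (intro bounded_linear_compose[OF bounded_linear_Re] bounded_linear_sum
        bounded_linear_compose[OF bounded_linear_mult_left]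
        bounded_linear_compose[OF bounded_linear_vec_nth] bounded_linear_fourier_coeff)
  then have comp: "bounded_linear (\<lambda>u::(real^'d) \<Rightarrow>\<^sub>C (real^'n). low_pass N (apply_bcontfun u) x $ i)" for i
    unfolding low_pass_expand[symmetric] by simp
  have "bounded_linear (\<lambda>u::(real^'d) \<Rightarrow>\<^sub>C (real^'n). \<Sum>i\<in>UNIV. (low_pass N (apply_bcontfun u) x $ i) *\<^sub>R axis i (1::real))"
    by (intro bounded_linear_sum bounded_linear_compose[OF bounded_linear_scaleR_left] comp)
  moreover have "(\<Sum>i\<in>UNIV. (y $ i) *\<^sub>R axis i 1) = y" for y :: "real^'n"
    using basis_expansion[of y] by (simp add: scalar_mult_eq_scaleR)
  ultimately show ?thesis by simp
qed

section \<open>The filtered vector field\<close>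

text \<open>Boundedness and Lipschitz continuity on balls, uniformly in a parameter \<open>x\<close>. Here \<open>u\<close> is a field and \<open>x\<close> a point of
  space; keeping the point as a parameter makes the notion stable under pointwise products, which composition with
  polynomials requires.\<close>

definition unif_lipschitz :: "('e::real_normed_vector \<Rightarrow> 'x \<Rightarrow> 'b::real_normed_vector) \<Rightarrow> bool" where
  "unif_lipschitz \<Phi> \<longleftrightarrow> (\<forall>R. \<exists>L\<ge>0. \<forall>u v x. norm u \<le> R \<longrightarrow> norm v \<le> R \<longrightarrow>
     norm (\<Phi> u x) \<le> L \<and> norm (\<Phi> u x - \<Phi> v x) \<le> L * norm (u - v))"

lemma unif_lipschitzE:
  assumes "unif_lipschitz \<Phi>"
  obtains L where "L \<ge> 0" "\<And>u x. norm u \<le> R \<Longrightarrow> norm (\<Phi> u x) \<le> L"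
    "\<And>u v x. norm u \<le> R \<Longrightarrow> norm v \<le> R \<Longrightarrow> norm (\<Phi> u x - \<Phi> v x) \<le> L * norm (u - v)"
  using assms unfolding unif_lipschitz_def by meson

lemma unif_lipschitz_const:
  assumes "\<And>x. norm (c x) \<le> B"
  shows "unif_lipschitz (\<lambda>u x. c x)"
  unfolding unif_lipschitz_def
  by (intro allI exI[of _ "\<bar>B\<bar>"] conjI impI order_trans[OF assms abs_ge_self]) simp_all

lemma unif_lipschitz_add:
  fixes \<Phi> \<Psi> :: "'e::real_normed_vector \<Rightarrow> 'x \<Rightarrow> 'b::real_normed_vector"
  assumes "unif_lipschitz \<Phi>" "unif_lipschitz \<Psi>"
  shows "unif_lipschitz (\<lambda>u x. \<Phi> u x + \<Psi> u x)"
  unfolding unif_lipschitz_def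
proof
  fix R
  obtain L where L: "L \<ge> 0" "\<And>u x. norm u \<le> R \<Longrightarrow> norm (\<Phi> u x) \<le> L"
    "\<And>u v x. norm u \<le> R \<Longrightarrow> norm v \<le> R \<Longrightarrow> norm (\<Phi> u x - \<Phi> v x) \<le> L * norm (u - v)"
    using unif_lipschitzE[OF assms(1)] by blast
  obtain M where M: "M \<ge> 0" "\<And>u x. norm u \<le> R \<Longrightarrow> norm (\<Psi> u x) \<le> M"
    "\<And>u v x. norm u \<le> R \<Longrightarrow> norm v \<le> R \<Longrightarrow> norm (\<Psi> u x - \<Psi> v x) \<le> M * norm (u - v)"
    using unif_lipschitzE[OF assms(2)] by blast
  show "\<exists>L\<ge>0. \<forall>u v x. norm u \<le> R \<longrightarrow> norm v \<le> R \<longrightarrow> norm (\<Phi> u x + \<Psi> u x) \<le> L \<and>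
      norm (\<Phi> u x + \<Psi> u x - (\<Phi> v x + \<Psi> v x)) \<le> L * norm (u - v)"
  proof (intro exI[of _ "L + M"] conjI allI impI)
    fix u v :: 'e and x :: 'x assume uv: "norm u \<le> R" "norm v \<le> R"
    show "norm (\<Phi> u x + \<Psi> u x) \<le> L + M"
      by (rule norm_triangle_le[OF add_mono[OF L(2)[OF uv(1)] M(2)[OF uv(1)]]])
    show "norm (\<Phi> u x + \<Psi> u x - (\<Phi> v x + \<Psi> v x)) \<le> (L + M) * norm (u - v)"
      unfolding add_diff_add distrib_right
      by (rule norm_triangle_le[OF add_mono[OF L(3)[OF uv] M(3)[OF uv]]])
  qed (use L M in simp)
qed

lemma unif_lipschitz_mult:
  fixes \<Phi> \<Psi> :: "'e::real_normed_vector \<Rightarrow> 'x \<Rightarrow> 'b::real_normed_algebra"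
  assumes "unif_lipschitz \<Phi>" "unif_lipschitz \<Psi>"
  shows "unif_lipschitz (\<lambda>u x. \<Phi> u x * \<Psi> u x)"
  unfolding unif_lipschitz_def
proof
  fix R
  obtain L where L: "L \<ge> 0" "\<And>u x. norm u \<le> R \<Longrightarrow> norm (\<Phi> u x) \<le> L"
    "\<And>u v x. norm u \<le> R \<Longrightarrow> norm v \<le> R \<Longrightarrow> norm (\<Phi> u x - \<Phi> v x) \<le> L * norm (u - v)"
    using unif_lipschitzE[OF assms(1)] by blast
  obtain M where M: "M \<ge> 0" "\<And>u x. norm u \<le> R \<Longrightarrow> norm (\<Psi> u x) \<le> M"
    "\<And>u v x. norm u \<le> R \<Longrightarrow> norm v \<le> R \<Longrightarrow> norm (\<Psi> u x - \<Psi> v x) \<le> M * norm (u - v)"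
    using unif_lipschitzE[OF assms(2)] by blast
  show "\<exists>L\<ge>0. \<forall>u v x. norm u \<le> R \<longrightarrow> norm v \<le> R \<longrightarrow> norm (\<Phi> u x * \<Psi> u x) \<le> L \<and>
      norm (\<Phi> u x * \<Psi> u x - (\<Phi> v x * \<Psi> v x)) \<le> L * norm (u - v)"
  proof (intro exI[of _ "2 * (L * M)"] conjI allI impI)
    fix u v :: 'e and x :: 'x assume uv: "norm u \<le> R" "norm v \<le> R"
    have "norm (\<Phi> u x * \<Psi> u x) \<le> L * M"
      by (rule order_trans[OF norm_mult_ineq mult_mono[OF L(2)[OF uv(1)] M(2)[OF uv(1)] L(1) norm_ge_zero]])
    then show "norm (\<Phi> u x * \<Psi> u x) \<le> 2 * (L * M)" using mult_nonneg_nonneg[OF L(1) M(1)] by linarith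
    have "\<Phi> u x * \<Psi> u x - \<Phi> v x * \<Psi> v x = \<Phi> u x * (\<Psi> u x - \<Psi> v x) + (\<Phi> u x - \<Phi> v x) * \<Psi> v x"
      by (simp add: algebra_simps)
    also have "norm \<dots> \<le> L * (M * norm (u - v)) + (L * norm (u - v)) * M"
      by (intro norm_triangle_le add_mono order_trans[OF norm_mult_ineq] mult_mono L M uv)
        (auto simp: L(1))
    finally show "norm (\<Phi> u x * \<Psi> u x - \<Phi> v x * \<Psi> v x) \<le> 2 * (L * M) * norm (u - v)"
      by (simp add: algebra_simps)
  qed (use L M in simp)
qed

lemma unif_lipschitz_sum:
  assumes "finite S" "\<And>i. i \<in> S \<Longrightarrow> unif_lipschitz (\<Phi> i)"
  shows "unif_lipschitz (\<lambda>u x. \<Sum>i\<in>S. \<Phi> i u x)"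
  using assms
proof (induction S rule: finite_induct)
  case empty
  show ?case using unif_lipschitz_const[of "\<lambda>_. 0" 0] by simp
next
  case (insert a S)
  then show ?case by (simp add: unif_lipschitz_add)
qed

lemma unif_lipschitz_bounded_linear:
  fixes T :: "'e::real_normed_vector \<Rightarrow> 'b::real_normed_vector"
  assumes "bounded_linear T"
  shows "unif_lipschitz (\<lambda>u x. T u)"
  unfolding unif_lipschitz_def
proof
  fix R
  obtain K where K: "K \<ge> 0" "\<And>u. norm (T u) \<le> norm u * K"
    using bounded_linear.nonneg_bounded[OF assms] by blast
  show "\<exists>L\<ge>0. \<forall>u v x. norm u \<le> R \<longrightarrow> norm v \<le> R \<longrightarrow> norm (T u) \<le> L \<and> norm (T u - T v) \<le> L * norm (u - v)"
  proof (intro exI[of _ "(\<bar>R\<bar> + 1) * K"] conjI allI impI)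
    fix u v :: 'e assume u: "norm u \<le> R"
    have "norm u * K \<le> (\<bar>R\<bar> + 1) * K" using K u by (intro mult_right_mono) auto
    then show "norm (T u) \<le> (\<bar>R\<bar> + 1) * K" using K(2)[of u] by linarith
    have "norm (T u - T v) \<le> K * norm (u - v)"
      using K(2)[of "u - v"] linear_diff[OF bounded_linear.linear[OF assms]] by (simp add: mult.commute)
    also have "\<dots> \<le> ((\<bar>R\<bar> + 1) * K) * norm (u - v)"
      using K by (intro mult_right_mono) (auto simp: distrib_right)
    finally show "norm (T u - T v) \<le> ((\<bar>R\<bar> + 1) * K) * norm (u - v)" .
  qed (use K in simp)
qed

lemma unif_lipschitz_of_real:
  assumes "unif_lipschitz (\<lambda>u x. complex_of_real (\<phi> u x))"
  shows "unif_lipschitz \<phi>"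
  using assms unfolding unif_lipschitz_def of_real_diff[symmetric] norm_of_real by simp

lemma unif_lipschitz_polynomial:
  fixes p :: "real^'n \<Rightarrow> real"
  assumes p: "real_polynomial_function p" and w: "\<And>i. unif_lipschitz (\<lambda>u x. w u x $ i)"
  shows "unif_lipschitz (\<lambda>u x. p (w u x))"
  using p
proof (induction p rule: real_polynomial_function.induct)
  case (linear f)
  have "(\<lambda>u x. f (w u x)) = (\<lambda>u x. \<Sum>i\<in>UNIV. f (axis i 1) * w u x $ i)"
    by (intro ext linear_functional_expand linear)
  moreover have "unif_lipschitz (\<lambda>u x. \<Sum>i\<in>UNIV. f (axis i 1) * w u x $ i)"
    by (intro unif_lipschitz_sum unif_lipschitz_mult w unif_lipschitz_const[where B="\<bar>f (axis _ 1)\<bar>"]) auto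
  ultimately show ?case by (simp only:)
next
  case (const c)
  show ?case by (rule unif_lipschitz_const[of _ "\<bar>c\<bar>"]) simp
qed (auto intro: unif_lipschitz_add unif_lipschitz_mult)

text \<open>The inner filter changes nothing along solutions of the filtered equation. It makes the derivatives in
  the quasilinear term bounded operators, so that the vector field is defined on the whole Banach space.\<close>

definition filtered_field ::
    "('d \<Rightarrow> real^'n \<Rightarrow> real^'n^'n) \<Rightarrow> nat \<Rightarrow> ((real^'d) \<Rightarrow>\<^sub>C (real^'n)) \<Rightarrow> ((real^'d) \<Rightarrow>\<^sub>C (real^'n))" where
  "filtered_field A N u = - Bcontfun (low_pass N (quasilinear_term A (low_pass N (apply_bcontfun u))))"

lemma apply_filtered_field:
  "apply_bcontfun (filtered_field A N u) x = - low_pass N (quasilinear_term A (low_pass N (apply_bcontfun u))) x"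
  by (simp add: filtered_field_def Bcontfun_inverse trig_vec_bcontfun[OF trig_vec_low_pass])

lemma trig_vec_uminus:
  assumes "trig_vec N U"
  shows "trig_vec N (\<lambda>x. - U x)"
  unfolding trig_vec_def
proof
  fix i
  have "trig_poly N (\<lambda>x. (-1) * complex_of_real (U x $ i))"
    by (intro trig_poly_cmult trig_vecD assms)
  then show "trig_poly N (\<lambda>x. complex_of_real ((- U x) $ i))" by simp
qed

lemma trig_vec_filtered_field: "trig_vec N (apply_bcontfun (filtered_field A N u))"
proof -
  have "apply_bcontfun (filtered_field A N u) =
      (\<lambda>x. - low_pass N (quasilinear_term A (low_pass N (apply_bcontfun u))) x)"
    by (rule ext) (rule apply_filtered_field)
  then show ?thesis by (simp only: trig_vec_uminus[OF trig_vec_low_pass])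
qed

lemma real_polynomial_trig_vec:
  fixes p :: "real^'n \<Rightarrow> real"
  assumes p: "real_polynomial_function p" and U: "trig_vec N U"
  shows "continuous_on S (\<lambda>x. p (U x))"
proof -
  have "continuous_on UNIV p"
    using continuous_on_polymonial_function p real_polynomial_function_eq by blast
  then show ?thesis by (rule continuous_on_compose2[OF _ trig_vec_continuous[OF U]]) simp
qed

text \<open>The filtered field and its derivatives are bounded linear in \<open>u\<close>; the quasilinear term is a polynomial in them; the
  coefficients and the outer filter are again bounded linear.\<close>

lemma filtered_field_lipschitz:
  fixes A :: "'d::finite \<Rightarrow> real^'n::finite \<Rightarrow> real^'n^'n"
  assumes polynomial: "\<And>j a b. real_polynomial_function (\<lambda>u. A j u $ a $ b)"
  shows "lipschitz_on_balls (filtered_field A N)"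
proof -
  define w where "w = (\<lambda>u::(real^'d) \<Rightarrow>\<^sub>C (real^'n). low_pass N (apply_bcontfun u))"
  have tw: "trig_vec N (w u)" for u unfolding w_def by (rule trig_vec_low_pass)
  have multiplier: "unif_lipschitz (\<lambda>(u::(real^'d) \<Rightarrow>\<^sub>C (real^'n)) x. \<Sum>k\<in>freq_box N. (c k * fourier_coeff (apply_bcontfun u) k $ i) * wave k x)"
    for c :: "int^'d \<Rightarrow> complex" and i
    by (intro unif_lipschitz_sum unif_lipschitz_mult finite_freq_box
        unif_lipschitz_bounded_linear bounded_linear_compose[OF bounded_linear_mult_right]
        bounded_linear_compose[OF bounded_linear_vec_nth] bounded_linear_fourier_coeff
        unif_lipschitz_const[where B=1]) simp
  have lw: "unif_lipschitz (\<lambda>u x. w u x $ i)" for i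
    by (rule unif_lipschitz_of_real) (use multiplier[of "\<lambda>_. 1" i] in \<open>simp add: w_def low_pass_expand\<close>)
  have ld: "unif_lipschitz (\<lambda>u x. partial_deriv j (w u) x $ i)" for i j
  proof (rule unif_lipschitz_of_real)
    have "complex_of_real (partial_deriv j (w u) x $ i) =
        (\<Sum>k\<in>freq_box N. ((\<i> * of_int (k $ j)) * fourier_coeff (apply_bcontfun u) k $ i) * wave k x)" for u x
      unfolding partial_deriv_expand[OF tw] by (intro sum.cong) (auto simp: w_def fourier_coeff_low_pass)
    then show "unif_lipschitz (\<lambda>u x. complex_of_real (partial_deriv j (w u) x $ i))"
      using multiplier[of "\<lambda>k. \<i> * of_int (k $ j)" i] by simp
  qed
  define F where "F = (\<lambda>u. quasilinear_term A (w u))"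
  have lF: "unif_lipschitz (\<lambda>u x. F u x $ i)" for i
    unfolding F_def quasilinear_term_nth
    by (intro unif_lipschitz_sum unif_lipschitz_mult unif_lipschitz_polynomial[OF polynomial] lw ld) simp_all
  have cF: "continuous_on UNIV (\<lambda>x. complex_of_real (F u x $ i))" for u i
  proof -
    have "continuous_on UNIV (\<lambda>x. complex_of_real (A j (w u x) $ i $ b) * of_real (partial_deriv j (w u) x $ b))" for j b
      by (intro continuous_intros real_polynomial_trig_vec[OF polynomial tw]
          trig_poly_continuous[OF trig_poly_partial_deriv(1)[OF tw]])
    then show ?thesis unfolding F_def quasilinear_term_nth of_real_sum of_real_mult
      by (intro continuous_on_sum)
  qed
  have lc: "unif_lipschitz (\<lambda>u (x::real^'d). fourier_coeff (F u) k $ i)" for k i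
    unfolding unif_lipschitz_def
  proof
    fix R
    obtain L where L: "L \<ge> 0" "\<And>u x. norm u \<le> R \<Longrightarrow> norm (F u x $ i) \<le> L"
      "\<And>u v x. norm u \<le> R \<Longrightarrow> norm v \<le> R \<Longrightarrow> norm (F u x $ i - F v x $ i) \<le> L * norm (u - v)"
      using unif_lipschitzE[OF lF] by blast
    show "\<exists>L\<ge>0. \<forall>u v x. norm u \<le> R \<longrightarrow> norm v \<le> R \<longrightarrow> norm (fourier_coeff (F u) k $ i) \<le> L \<and>
       norm (fourier_coeff (F u) k $ i - fourier_coeff (F v) k $ i) \<le> L * norm (u - v)"
    proof (intro exI[of _ L] conjI allI impI)
      fix u v :: "(real^'d) \<Rightarrow>\<^sub>C (real^'n)" assume uv: "norm u \<le> R" "norm v \<le> R"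
      show "norm (fourier_coeff (F u) k $ i) \<le> L"
        unfolding fourier_coeff_nth using L(2)[OF uv(1)] by (intro fcoeff_bound cF) simp
      have "fcoeff (\<lambda>x. complex_of_real (F u x $ i) + (-1) * complex_of_real (F v x $ i)) k =
          fcoeff (\<lambda>x. complex_of_real (F u x $ i)) k + fcoeff (\<lambda>x. (-1) * complex_of_real (F v x $ i)) k"
        by (intro fcoeff_add continuous_on_mult continuous_on_const cF)
      then have eq: "fourier_coeff (F u) k $ i - fourier_coeff (F v) k $ i =
          fcoeff (\<lambda>x. complex_of_real (F u x $ i) + (-1) * complex_of_real (F v x $ i)) k"
        unfolding fourier_coeff_nth fcoeff_cmult by simp
      show "norm (fourier_coeff (F u) k $ i - fourier_coeff (F v) k $ i) \<le> L * norm (u - v)"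
        unfolding eq
      proof (rule fcoeff_bound)
        show "continuous_on UNIV (\<lambda>x. complex_of_real (F u x $ i) + (-1) * complex_of_real (F v x $ i))"
          by (intro continuous_on_add continuous_on_mult continuous_on_const cF)
        fix x
        have "complex_of_real (F u x $ i) + (-1) * complex_of_real (F v x $ i) = of_real (F u x $ i - F v x $ i)" by simp
        then show "norm (complex_of_real (F u x $ i) + (-1) * complex_of_real (F v x $ i)) \<le> L * norm (u - v)"
          using L(3)[OF uv, of x] by (simp only: norm_of_real real_norm_def)
      qed
    qed (fact L(1))
  qed
  have lP: "unif_lipschitz (\<lambda>u x. low_pass N (F u) x $ i)" for i
    by (rule unif_lipschitz_of_real, unfold low_pass_expand)
      (intro unif_lipschitz_sum unif_lipschitz_mult finite_freq_box lc unif_lipschitz_const[where B=1], simp)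
  show ?thesis
    unfolding lipschitz_on_balls_def
  proof
    fix R
    have "\<exists>L. \<forall>i. L i \<ge> 0 \<and> (\<forall>u v x. norm u \<le> R \<longrightarrow> norm v \<le> R \<longrightarrow>
        norm (low_pass N (F u) x $ i - low_pass N (F v) x $ i) \<le> L i * norm (u - v))"
      using unif_lipschitzE[OF lP] by (intro choice) metis
    then obtain L where L: "\<And>i. L i \<ge> 0"
      "\<And>i u v x. norm u \<le> R \<Longrightarrow> norm v \<le> R \<Longrightarrow> norm (low_pass N (F u) x $ i - low_pass N (F v) x $ i) \<le> L i * norm (u - v)"
      by blast
    have "(\<Sum>i\<in>UNIV. L i)-lipschitz_on (cball 0 R) (filtered_field A N)"
    proof (rule lipschitz_onI)
      fix u v :: "(real^'d) \<Rightarrow>\<^sub>C (real^'n)" assume uv: "u \<in> cball 0 R" "v \<in> cball 0 R"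
      show "dist (filtered_field A N u) (filtered_field A N v) \<le> (\<Sum>i\<in>UNIV. L i) * dist u v"
      proof (rule dist_bound)
        fix x
        have "dist (apply_bcontfun (filtered_field A N u) x) (apply_bcontfun (filtered_field A N v) x) =
            norm (low_pass N (F u) x - low_pass N (F v) x)"
          by (simp add: apply_filtered_field F_def w_def dist_norm norm_minus_commute)
        also have "\<dots> \<le> (\<Sum>i\<in>UNIV. norm ((low_pass N (F u) x - low_pass N (F v) x) $ i))"
          by (rule norm_vec_le_sum)
        also have "\<dots> \<le> (\<Sum>i\<in>UNIV. L i * norm (u - v))"
          using uv by (intro sum_mono) (simp add: L(2)[simplified])
        finally show "dist (apply_bcontfun (filtered_field A N u) x) (apply_bcontfun (filtered_field A N v) x) \<le> (\<Sum>i\<in>UNIV. L i) * dist u v"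
          by (simp add: sum_distrib_right dist_norm)
      qed
    qed (use L in \<open>simp add: sum_nonneg\<close>)
    then show "\<exists>L. L-lipschitz_on (cball 0 R) (filtered_field A N)" by blast
  qed
qed

section \<open>Classical solutions as integral curves\<close>

instance bcontfun :: (metric_space, banach) banach ..

lemma has_vector_derivative_eval:
  assumes "(u has_vector_derivative u') (at t)"
  shows "((\<lambda>r. apply_bcontfun (u r) x) has_vector_derivative apply_bcontfun u' x) (at t)"
  by (rule bounded_linear.has_vector_derivative[OF bounded_linear_eval assms])

lemma constant_on_interval:
  fixes h :: "real \<Rightarrow> 'a::real_normed_vector"
  assumes "is_interval J" "0 \<in> J" "t \<in> J" "\<And>r. r \<in> J \<Longrightarrow> (h has_vector_derivative 0) (at r)"
  shows "h t = h 0"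
proof -
  have "convex J" using assms(1) is_interval_convex by blast
  then obtain c where "\<And>r. r \<in> J \<Longrightarrow> h r = c"
    using has_vector_derivative_zero_constant[of J h] assms(4) has_vector_derivative_at_within by blast
  then show ?thesis using assms(2,3) by simp
qed

text \<open>The vector field takes values in the range of the filter, so the part of the solution outside this range does
  not move.\<close>

lemma filtered_flow_trig_vec:
  assumes sol: "ode_solution (filtered_field A N) u0 J u" and u0: "trig_vec N (apply_bcontfun u0)" and t: "t \<in> J"
  shows "trig_vec N (apply_bcontfun (u t))"
proof -
  have J: "is_interval J" "0 \<in> J" "u 0 = u0"
    and u: "\<And>r. r \<in> J \<Longrightarrow> (u has_vector_derivative filtered_field A N (u r)) (at r)"
    using sol unfolding ode_solution_def by auto
  have "apply_bcontfun (u t) x - low_pass N (apply_bcontfun (u t)) x = 0" for x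
  proof -
    let ?h = "\<lambda>r. apply_bcontfun (u r) x - low_pass N (apply_bcontfun (u r)) x"
    have "(?h has_vector_derivative 0) (at r)" if "r \<in> J" for r
    proof -
      let ?G = "apply_bcontfun (filtered_field A N (u r))"
      have "low_pass N ?G x = ?G x" by (simp add: low_pass_trig_vec[OF trig_vec_filtered_field])
      then show ?thesis
        using has_vector_derivative_diff[OF has_vector_derivative_eval[OF u[OF that], of x]
            bounded_linear.has_vector_derivative[OF bounded_linear_low_pass u[OF that], of N x]] by simp
    qed
    then have "?h t = ?h 0" by (rule constant_on_interval[OF J(1,2) t])
    then show ?thesis using low_pass_trig_vec[OF u0] J(3) by simp
  qed
  then have "apply_bcontfun (u t) = low_pass N (apply_bcontfun (u t))" by auto
  then show ?thesis using trig_vec_low_pass by metis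
qed

text \<open>The Dirichlet kernel centred at a grid point: the trigonometric polynomial that is one there and zero at the
  other grid points.\<close>

definition interpolation_kernel :: "nat \<Rightarrow> ('d \<Rightarrow> nat) \<Rightarrow> real^'d \<Rightarrow> real" where
  "interpolation_kernel N \<gamma> x =
     Re (\<Sum>k\<in>freq_box N. wave (- k) (grid_point N \<gamma>) * wave k x) / real ((2*N+1) ^ CARD('d))"

lemma trig_poly_interpolation_kernel: "trig_poly N (\<lambda>x. of_real (interpolation_kernel N \<gamma> x))"
proof -
  have "trig_poly N (\<lambda>x. of_real (1 / real ((2*N+1) ^ CARD('a))) *
      complex_of_real (Re (\<Sum>k\<in>freq_box N. wave (- k) (grid_point N \<gamma>) * wave k x)))"
    by (intro trig_poly_cmult trig_poly_Re) (auto simp: trig_poly_def)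
  then show ?thesis by (simp add: interpolation_kernel_def)
qed

lemma trig_vec_interpolate:
  fixes U :: "real^'d \<Rightarrow> real^'n"
  assumes U: "trig_vec N U"
  shows "U x = (\<Sum>\<gamma>\<in>grid N. interpolation_kernel N \<gamma> x *\<^sub>R U (grid_point N \<gamma>))"
proof -
  have "U x $ i = (\<Sum>\<gamma>\<in>grid N. interpolation_kernel N \<gamma> x * U (grid_point N \<gamma>) $ i)" for i
  proof -
    let ?M = "real ((2*N+1) ^ CARD('d))"
    let ?g = "\<lambda>x. complex_of_real (U x $ i)"
    have "?g x = (\<Sum>k\<in>freq_box N. ((\<Sum>\<gamma>\<in>grid N. ?g (grid_point N \<gamma>) * wave (- k) (grid_point N \<gamma>)) / of_nat ((2*N+1) ^ CARD('d))) * wave k x)"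
      by (subst trig_poly_expand[OF trig_vecD[OF U]], rule sum.cong) (simp_all only: fcoeff_sample[OF trig_vecD[OF U]])
    also have "\<dots> = (\<Sum>k\<in>freq_box N. \<Sum>\<gamma>\<in>grid N. of_real (U (grid_point N \<gamma>) $ i / ?M) * (wave (- k) (grid_point N \<gamma>) * wave k x))"
      by (simp only: sum_divide_distrib sum_distrib_right) (simp add: field_simps)
    also have "\<dots> = (\<Sum>\<gamma>\<in>grid N. of_real (U (grid_point N \<gamma>) $ i / ?M) * (\<Sum>k\<in>freq_box N. wave (- k) (grid_point N \<gamma>) * wave k x))"
      by (subst sum.swap) (simp only: sum_distrib_left)
    finally have "Re (?g x) = (\<Sum>\<gamma>\<in>grid N. U (grid_point N \<gamma>) $ i / ?M * Re (\<Sum>k\<in>freq_box N. wave (- k) (grid_point N \<gamma>) * wave k x))"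
      by (simp only: Re_sum Re_complex_of_real times_complex.sel Im_complex_of_real mult_zero_left diff_zero)
    then show ?thesis by (simp add: interpolation_kernel_def mult.commute)
  qed
  then show ?thesis by (simp add: vec_eq_iff sum_component)
qed

lemma filtered_field_on_trig_vec:
  assumes "trig_vec N (apply_bcontfun u)"
  shows "apply_bcontfun (filtered_field A N u) x = - low_pass N (quasilinear_term A (apply_bcontfun u)) x"
  by (simp add: apply_filtered_field low_pass_trig_vec[OF assms])

text \<open>The difference between the solution and its trigonometric interpolation has zero derivative in time at every point,
  since the right-hand side of the equation is interpolated exactly, and it vanishes at time zero. Only finitely many
  point values enter for each \<open>x\<close>, so the pointwise equation suffices.\<close>

lemma classical_solution_trig_vec:
  assumes V: "classical_solution A s N U0 J V" and t: "t \<in> J"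
  shows "trig_vec N (V t)"
proof -
  have J: "is_interval J" "0 \<in> J" "V 0 = low_pass N U0"
    and V': "\<And>r x. r \<in> J \<Longrightarrow> ((\<lambda>r. V r x) has_vector_derivative - low_pass N (quasilinear_term A (V r)) x) (at r)"
    using V unfolding classical_solution_def by auto
  have eq: "V t x = (\<Sum>\<gamma>\<in>grid N. interpolation_kernel N \<gamma> x *\<^sub>R V t (grid_point N \<gamma>))" for x
  proof -
    let ?h = "\<lambda>r. V r x - (\<Sum>\<gamma>\<in>grid N. interpolation_kernel N \<gamma> x *\<^sub>R V r (grid_point N \<gamma>))"
    have "(?h has_vector_derivative 0) (at r)" if r: "r \<in> J" for r
    proof -
      let ?W = "low_pass N (quasilinear_term A (V r))"
      have "(?h has_vector_derivative (- ?W x - (\<Sum>\<gamma>\<in>grid N. interpolation_kernel N \<gamma> x *\<^sub>R (- ?W (grid_point N \<gamma>))))) (at r)"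
        by (intro has_vector_derivative_diff has_vector_derivative_sum V' r
            bounded_linear.has_vector_derivative[OF bounded_linear_scaleR_right])
      moreover have "- ?W x - (\<Sum>\<gamma>\<in>grid N. interpolation_kernel N \<gamma> x *\<^sub>R (- ?W (grid_point N \<gamma>))) = 0"
        by (subst trig_vec_interpolate[OF trig_vec_low_pass, of _ _ x]) (simp add: sum_negf)
      ultimately show ?thesis by (simp only:)
    qed
    then have "?h t = ?h 0" by (rule constant_on_interval[OF J(1,2) t])
    moreover have "?h 0 = 0" unfolding J(3)
      by (subst trig_vec_interpolate[OF trig_vec_low_pass, of _ _ x]) simp
    ultimately show ?thesis by simp
  qed
  have poly: "trig_poly N (\<lambda>x. \<Sum>\<gamma>\<in>grid N. of_real (V t (grid_point N \<gamma>) $ i) * complex_of_real (interpolation_kernel N \<gamma> x))" for i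
    by (intro trig_poly_sum trig_poly_cmult trig_poly_interpolation_kernel) simp
  have expand: "(\<lambda>x. complex_of_real (V t x $ i)) =
      (\<lambda>x. \<Sum>\<gamma>\<in>grid N. of_real (V t (grid_point N \<gamma>) $ i) * complex_of_real (interpolation_kernel N \<gamma> x))" for i
  proof
    fix x
    have "V t x $ i = (\<Sum>\<gamma>\<in>grid N. V t (grid_point N \<gamma>) $ i * interpolation_kernel N \<gamma> x)"
      using arg_cong[OF eq[of x], of "\<lambda>v. v $ i"] by (simp only: sum_component vector_scaleR_component real_scaleR_def mult.commute)
    then show "complex_of_real (V t x $ i) =
        (\<Sum>\<gamma>\<in>grid N. of_real (V t (grid_point N \<gamma>) $ i) * complex_of_real (interpolation_kernel N \<gamma> x))"
      by (simp only: of_real_sum of_real_mult)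
  qed
  show ?thesis
    unfolding trig_vec_def by (rule allI, rule ssubst[OF expand, of "trig_poly N"]) (rule poly)
qed

text \<open>By interpolation the solution is a fixed finite linear combination of functions with coefficients that are
  differentiable in time, hence a differentiable curve in the Banach space.\<close>

lemma classical_imp_ode_solution:
  fixes V :: "real \<Rightarrow> real^'d \<Rightarrow> real^'n"
  assumes V: "classical_solution A s N U0 J V"
  shows "ode_solution (filtered_field A N) (Bcontfun (low_pass N U0)) J (\<lambda>t. Bcontfun (V t))"
proof -
  have J: "open J" "is_interval J" "0 \<in> J" "V 0 = low_pass N U0"
    and V': "\<And>r x. r \<in> J \<Longrightarrow> ((\<lambda>r. V r x) has_vector_derivative - low_pass N (quasilinear_term A (V r)) x) (at r)"
    using V unfolding classical_solution_def by auto
  note trig = classical_solution_trig_vec[OF V]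
  have kernel: "(\<lambda>x. interpolation_kernel N \<gamma> x *\<^sub>R y) \<in> bcontfun" for \<gamma> and y :: "real^'n"
  proof (rule trig_vec_bcontfun[of N], unfold trig_vec_def, intro allI)
    fix i
    have "trig_poly N (\<lambda>x. of_real (y $ i) * complex_of_real (interpolation_kernel N \<gamma> x))"
      by (intro trig_poly_cmult trig_poly_interpolation_kernel)
    then show "trig_poly N (\<lambda>x. complex_of_real ((interpolation_kernel N \<gamma> x *\<^sub>R y) $ i))"
      by (simp add: mult.commute)
  qed
  define L where "L = (\<lambda>\<gamma> (y::real^'n). Bcontfun (\<lambda>x::real^'d. interpolation_kernel N \<gamma> x *\<^sub>R y))"
  have L_apply: "apply_bcontfun (L \<gamma> y) x = interpolation_kernel N \<gamma> x *\<^sub>R y" for \<gamma> y x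
    unfolding L_def by (simp add: Bcontfun_inverse kernel)
  have "linear (L \<gamma>)" for \<gamma>
    by (rule linearI) (auto intro!: bcontfun_eqI simp: L_apply scaleR_add_right)
  then have L: "bounded_linear (L \<gamma>)" for \<gamma> by (simp add: linear_conv_bounded_linear)
  have apply_sum: "apply_bcontfun (\<Sum>\<gamma>\<in>S. f \<gamma>) x = (\<Sum>\<gamma>\<in>S. apply_bcontfun (f \<gamma>) x)"
    if "finite S" for f :: "_ \<Rightarrow> (real^'d) \<Rightarrow>\<^sub>C (real^'n)" and S x
    using that by (induction S rule: finite_induct) auto
  have interp: "Bcontfun U = (\<Sum>\<gamma>\<in>grid N. L \<gamma> (U (grid_point N \<gamma>)))" if U: "trig_vec N U" for U :: "real^'d \<Rightarrow> real^'n"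
    by (rule bcontfun_eqI)
      (simp add: Bcontfun_inverse[OF trig_vec_bcontfun[OF U]] apply_sum L_apply flip: trig_vec_interpolate[OF U])
  have "((\<lambda>t. Bcontfun (V t)) has_vector_derivative filtered_field A N (Bcontfun (V t))) (at t)" if t: "t \<in> J" for t
  proof -
    let ?W = "\<lambda>x. - low_pass N (quasilinear_term A (V t)) x"
    have W: "trig_vec N ?W" by (rule trig_vec_uminus[OF trig_vec_low_pass])
    have "((\<lambda>t. \<Sum>\<gamma>\<in>grid N. L \<gamma> (V t (grid_point N \<gamma>))) has_vector_derivative
        (\<Sum>\<gamma>\<in>grid N. L \<gamma> (?W (grid_point N \<gamma>)))) (at t)"
      by (intro has_vector_derivative_sum bounded_linear.has_vector_derivative[OF L] V' t)
    then have "((\<lambda>t. Bcontfun (V t)) has_vector_derivative (\<Sum>\<gamma>\<in>grid N. L \<gamma> (?W (grid_point N \<gamma>)))) (at t)"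
      by (rule has_vector_derivative_transform_within_open[OF _ J(1) t]) (simp add: interp[OF trig])
    moreover have "filtered_field A N (Bcontfun (V t)) = Bcontfun ?W"
      by (rule bcontfun_eqI)
        (simp add: filtered_field_on_trig_vec trig[OF t] Bcontfun_inverse[OF trig_vec_bcontfun[OF trig[OF t]]]
          Bcontfun_inverse[OF trig_vec_bcontfun[OF W]])
    ultimately show ?thesis by (simp only: interp[OF W])
  qed
  then show ?thesis using J by (simp add: ode_solution_def)
qed

section \<open>Sobolev regularity in time\<close>

text \<open>Together with the next lemma: on trigonometric polynomials of degree \<open>N\<close> the Sobolev norms and the supremum norm are
  equivalent. The constants depend on \<open>N\<close>, which is harmless for questions of continuity and of continuation.\<close>

lemma sobolev_norm_le_sup_norm:
  obtains C where "C > 0" "\<And>u :: (real^'d) \<Rightarrow>\<^sub>C (real^'n). trig_vec N (apply_bcontfun u) \<Longrightarrow>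
     sobolev_norm s (apply_bcontfun u) \<le> C * norm u"
proof -
  have "\<forall>k. \<exists>K\<ge>0. \<forall>u :: (real^'d) \<Rightarrow>\<^sub>C (real^'n). norm (fourier_coeff (apply_bcontfun u) k) \<le> norm u * K"
    using bounded_linear.nonneg_bounded[OF bounded_linear_fourier_coeff] by blast
  then obtain K where K: "\<And>k. K k \<ge> 0" "\<And>k (u :: (real^'d) \<Rightarrow>\<^sub>C (real^'n)). norm (fourier_coeff (apply_bcontfun u) k) \<le> norm u * K k"
    by metis
  let ?S = "\<Sum>k\<in>freq_box N. japanese_bracket (k::int^'d) powr (2 * s) * (K k)\<^sup>2"
  have S: "?S \<ge> 0" by (intro sum_nonneg) auto
  have "sobolev_norm s (apply_bcontfun u) \<le> (sqrt ?S + 1) * norm u"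
    if u: "trig_vec N (apply_bcontfun u)" for u :: "(real^'d) \<Rightarrow>\<^sub>C (real^'n)"
  proof -
    have "sobolev_norm s (apply_bcontfun u) \<le> sqrt (\<Sum>k\<in>freq_box N. japanese_bracket k powr (2 * s) * (norm u * K k)\<^sup>2)"
      unfolding sobolev_norm_trig_vec[OF u]
      by (intro real_sqrt_le_mono sum_mono mult_left_mono power_mono K) auto
    also have "(\<Sum>k\<in>freq_box N. japanese_bracket k powr (2 * s) * (norm u * K k)\<^sup>2) = (norm u)\<^sup>2 * ?S"
      by (simp add: sum_distrib_left power_mult_distrib mult_ac)
    also have "sqrt \<dots> = norm u * sqrt ?S" by (simp add: real_sqrt_mult)
    also have "\<dots> \<le> (sqrt ?S + 1) * norm u" by (simp add: algebra_simps)
    finally show ?thesis .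
  qed
  moreover have "sqrt ?S + 1 > 0" using S by (simp add: add_nonneg_pos)
  ultimately show ?thesis using that by blast
qed

lemma sup_norm_le_sobolev_norm:
  fixes u :: "(real^'d) \<Rightarrow>\<^sub>C (real^'n)"
  assumes u: "trig_vec N (apply_bcontfun u)" and s: "s \<ge> 0"
  shows "norm u \<le> real (CARD('n) * card (freq_box N :: (int^'d) set)) * sobolev_norm s (apply_bcontfun u)"
proof (rule norm_bound)
  fix x
  let ?S = "sobolev_norm s (apply_bcontfun u)"
  have coeff: "norm (fourier_coeff (apply_bcontfun u) k $ i) \<le> ?S" for k i
  proof -
    have "norm (fourier_coeff (apply_bcontfun u) k $ i) \<le> japanese_bracket k powr s * norm (fourier_coeff (apply_bcontfun u) k $ i)"
      using mult_right_mono[OF ge_one_powr_ge_zero[OF japanese_bracket_ge_1 s], of "norm (fourier_coeff (apply_bcontfun u) k $ i)" k] by simp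
    also have "\<dots> \<le> ?S"
      using l2_boundD[OF l2_bound_sobolev_norm[OF u], of "{k}" s i] by (simp add: L2_set_def)
    finally show ?thesis .
  qed
  have "norm (apply_bcontfun u x) \<le> (\<Sum>i\<in>UNIV. \<Sum>k\<in>freq_box N. norm (fourier_coeff (apply_bcontfun u) k $ i))"
    by (rule trig_vec_bounded[OF u])
  also have "\<dots> \<le> (\<Sum>i\<in>(UNIV::'n set). \<Sum>k\<in>(freq_box N :: (int^'d) set). ?S)"
    by (intro sum_mono coeff)
  finally show "norm (apply_bcontfun u x) \<le> real (CARD('n) * card (freq_box N :: (int^'d) set)) * ?S" by simp
qed

lemma trig_vec_diff:
  assumes "trig_vec N U" "trig_vec N V"
  shows "trig_vec N (\<lambda>x. U x - V x)"
  unfolding trig_vec_def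
proof
  fix i
  have "trig_poly N (\<lambda>x. complex_of_real (U x $ i) + (-1) * complex_of_real (V x $ i))"
    by (intro trig_poly_add trig_poly_cmult trig_vecD assms)
  then show "trig_poly N (\<lambda>x. complex_of_real ((U x - V x) $ i))" by simp
qed

lemma trig_vec_scaleR:
  assumes "trig_vec N U"
  shows "trig_vec N (\<lambda>x. c *\<^sub>R U x)"
  unfolding trig_vec_def
proof
  fix i
  have "trig_poly N (\<lambda>x. of_real c * complex_of_real (U x $ i))"
    by (intro trig_poly_cmult trig_vecD assms)
  then show "trig_poly N (\<lambda>x. complex_of_real ((c *\<^sub>R U x) $ i))" by simp
qed

lemma sobolev_C0_of_continuous:
  fixes u :: "real \<Rightarrow> (real^'d) \<Rightarrow>\<^sub>C (real^'n)"
  assumes u: "\<And>t. t \<in> I \<Longrightarrow> trig_vec N (apply_bcontfun (u t))" and cont: "continuous_on I u"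
  shows "sobolev_C0 s I (\<lambda>t. apply_bcontfun (u t))"
  unfolding sobolev_C0_def
proof (intro conjI ballI)
  fix t assume t: "t \<in> I"
  show "apply_bcontfun (u t) \<in> sobolev s" by (rule trig_vec_sobolev[OF u[OF t]])
  obtain C where C: "\<And>v :: (real^'d) \<Rightarrow>\<^sub>C (real^'n). trig_vec N (apply_bcontfun v) \<Longrightarrow>
     sobolev_norm s (apply_bcontfun v) \<le> C * norm v"
    using sobolev_norm_le_sup_norm by blast
  have diff: "trig_vec N (apply_bcontfun (u r - u t))" if "r \<in> I" for r
    using trig_vec_diff[OF u[OF that] u[OF t]] by simp
  have "((\<lambda>r. C * norm (u r - u t)) \<longlongrightarrow> C * norm (u t - u t)) (at t within I)"
    using cont t by (intro tendsto_intros) (simp add: continuous_on)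
  then have lim: "((\<lambda>r. C * norm (u r - u t)) \<longlongrightarrow> 0) (at t within I)" by simp
  show "((\<lambda>r. sobolev_norm s (\<lambda>x. apply_bcontfun (u r) x - apply_bcontfun (u t) x)) \<longlongrightarrow> 0) (at t within I)"
  proof (rule tendsto_sandwich[OF _ _ tendsto_const lim])
    show "\<forall>\<^sub>F r in at t within I. 0 \<le> sobolev_norm s (\<lambda>x. apply_bcontfun (u r) x - apply_bcontfun (u t) x)"
      by (simp add: sobolev_norm_def infsum_nonneg)
    show "\<forall>\<^sub>F r in at t within I. sobolev_norm s (\<lambda>x. apply_bcontfun (u r) x - apply_bcontfun (u t) x) \<le> C * norm (u r - u t)"
      unfolding eventually_at_filter
      by (intro always_eventually allI impI) (use C[OF diff] in simp)
  qed
qed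

lemma ode_solution_continuous: "ode_solution G u0 I u \<Longrightarrow> continuous_on I u"
  unfolding ode_solution_def
  by (auto intro!: continuous_at_imp_continuous_on has_vector_derivative_continuous)

lemma sobolev_C1_of_flow:
  fixes u :: "real \<Rightarrow> (real^'d) \<Rightarrow>\<^sub>C (real^'n)"
  assumes sol: "ode_solution G u0 I u" and G: "lipschitz_on_balls G"
    and u: "\<And>t. t \<in> I \<Longrightarrow> trig_vec N (apply_bcontfun (u t))"
    and Gu: "\<And>t. t \<in> I \<Longrightarrow> trig_vec N (apply_bcontfun (G (u t)))"
  shows "sobolev_C1 s I (\<lambda>t. apply_bcontfun (u t))"
  unfolding sobolev_C1_def
proof (intro conjI ballI exI[of _ "\<lambda>t. apply_bcontfun (G (u t))"])
  show "apply_bcontfun (u t) \<in> sobolev s" if "t \<in> I" for t by (rule trig_vec_sobolev[OF u[OF that]])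
  have "continuous_on I (\<lambda>t. G (u t))"
    by (rule continuous_on_compose2[OF lipschitz_on_balls_continuous[OF G, of UNIV] ode_solution_continuous[OF sol]]) simp
  then show "sobolev_C0 s I (\<lambda>t. apply_bcontfun (G (u t)))"
    by (intro sobolev_C0_of_continuous[of _ N] Gu)
  fix t assume t: "t \<in> I"
  obtain C where C: "\<And>v :: (real^'d) \<Rightarrow>\<^sub>C (real^'n). trig_vec N (apply_bcontfun v) \<Longrightarrow>
     sobolev_norm s (apply_bcontfun v) \<le> C * norm v"
    using sobolev_norm_le_sup_norm by blast
  let ?q = "\<lambda>r. (1 / (r - t)) *\<^sub>R (u r - u t) - G (u t)"
  have "(u has_vector_derivative G (u t)) (at t within I)"
    using sol t has_vector_derivative_at_within unfolding ode_solution_def by blast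
  then have "((\<lambda>r. (1 / norm (r - t)) *\<^sub>R (u r - (u t + (r - t) *\<^sub>R G (u t)))) \<longlongrightarrow> 0) (at t within I)"
    unfolding has_vector_derivative_def has_derivative_within by blast
  then have lim: "((\<lambda>r. norm ((1 / norm (r - t)) *\<^sub>R (u r - (u t + (r - t) *\<^sub>R G (u t))))) \<longlongrightarrow> 0) (at t within I)"
    by (rule tendsto_norm_zero)
  have q: "norm ((1 / norm (r - t)) *\<^sub>R (u r - (u t + (r - t) *\<^sub>R G (u t)))) = norm (?q r)" if "r \<noteq> t" for r
  proof -
    have "?q r = (1 / (r - t)) *\<^sub>R (u r - (u t + (r - t) *\<^sub>R G (u t)))"
      using that by (simp add: scaleR_diff_right scaleR_add_right)
    then show ?thesis by simp
  qed
  have "((\<lambda>r. norm (?q r)) \<longlongrightarrow> 0) (at t within I)"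
    by (rule Lim_transform_eventually[OF lim]) (use q in \<open>auto simp: eventually_at_filter simp del: real_norm_def\<close>)
  then have limC: "((\<lambda>r. C * norm (?q r)) \<longlongrightarrow> 0) (at t within I)"
    by (rule tendsto_mult_right_zero)
  show "((\<lambda>r. sobolev_norm s (\<lambda>x. (1 / (r - t)) *\<^sub>R (apply_bcontfun (u r) x - apply_bcontfun (u t) x)
      - apply_bcontfun (G (u t)) x)) \<longlongrightarrow> 0) (at t within I)"
  proof (rule tendsto_sandwich[OF _ _ tendsto_const limC])
    show "\<forall>\<^sub>F r in at t within I. 0 \<le> sobolev_norm s (\<lambda>x. (1 / (r - t)) *\<^sub>R (apply_bcontfun (u r) x - apply_bcontfun (u t) x)
      - apply_bcontfun (G (u t)) x)"
      by (simp add: sobolev_norm_def infsum_nonneg)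
    have "trig_vec N (apply_bcontfun (?q r))" if "r \<in> I" for r
      using trig_vec_diff[OF trig_vec_scaleR[OF trig_vec_diff[OF u[OF that] u[OF t]], of "1 / (r - t)"] Gu[OF t]] by simp
    then have "sobolev_norm s (\<lambda>x. (1 / (r - t)) *\<^sub>R (apply_bcontfun (u r) x - apply_bcontfun (u t) x)
      - apply_bcontfun (G (u t)) x) \<le> C * norm (?q r)" if "r \<in> I" for r
      using C[of "?q r"] that by simp
    then show "\<forall>\<^sub>F r in at t within I. sobolev_norm s (\<lambda>x. (1 / (r - t)) *\<^sub>R (apply_bcontfun (u r) x - apply_bcontfun (u t) x)
      - apply_bcontfun (G (u t)) x) \<le> C * norm (?q r)"
      unfolding eventually_at_filter by (intro always_eventually allI impI)
  qed
qed

lemma ode_imp_classical_solution: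
  assumes sol: "ode_solution (filtered_field A N) (Bcontfun (low_pass N U0)) J u"
  shows "classical_solution A s N U0 J (\<lambda>t. apply_bcontfun (u t))"
proof -
  have u0: "apply_bcontfun (Bcontfun (low_pass N U0)) = low_pass N U0"
    by (simp add: Bcontfun_inverse trig_vec_bcontfun[OF trig_vec_low_pass])
  have J: "open J" "is_interval J" "0 \<in> J" "u 0 = Bcontfun (low_pass N U0)"
    and u: "\<And>r. r \<in> J \<Longrightarrow> (u has_vector_derivative filtered_field A N (u r)) (at r)"
    using sol unfolding ode_solution_def by auto
  have trig: "trig_vec N (apply_bcontfun (u t))" if "t \<in> J" for t
    by (rule filtered_flow_trig_vec[OF sol _ that]) (simp add: u0 trig_vec_low_pass)
  show ?thesis
    unfolding classical_solution_def
  proof (intro conjI ballI allI)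
    show "sobolev_C0 s J (\<lambda>t. apply_bcontfun (u t))"
      by (rule sobolev_C0_of_continuous[OF trig ode_solution_continuous[OF sol]])
    fix t x assume t: "t \<in> J"
    show "apply_bcontfun (u t) differentiable (at x)" by (rule trig_vec_differentiable[OF trig[OF t]])
    show "((\<lambda>r. apply_bcontfun (u r) x) has_vector_derivative - low_pass N (quasilinear_term A (apply_bcontfun (u t))) x) (at t)"
      using has_vector_derivative_eval[OF u[OF t], of x] by (simp add: filtered_field_on_trig_vec[OF trig[OF t]])
  qed (use J u0 in simp_all)
qed

section \<open>Growth of Sobolev norms\<close>

lemma gronwall_linear:
  fixes y :: "real \<Rightarrow> real"
  assumes "0 \<le> b" and deriv: "\<And>t. t \<in> {0..b} \<Longrightarrow> (y has_real_derivative y' t) (at t)"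
    and le: "\<And>t. t \<in> {0..b} \<Longrightarrow> y' t \<le> a * y t"
  shows "y b \<le> y 0 * exp (a * b)"
proof -
  let ?z = "\<lambda>t. y t * exp (- a * t)"
  have "?z b \<le> ?z 0"
  proof (rule DERIV_nonpos_imp_nonincreasing[OF assms(1)])
    fix t assume "0 \<le> t" "t \<le> b"
    then have t: "t \<in> {0..b}" by simp
    have "(?z has_real_derivative (y' t - a * y t) * exp (- a * t)) (at t)"
      by (rule derivative_eq_intros deriv[OF t] refl)+ (simp add: algebra_simps)
    moreover have "(y' t - a * y t) * exp (- a * t) \<le> 0"
      using le[OF t] by (intro mult_nonpos_nonneg) auto
    ultimately show "\<exists>d. (?z has_real_derivative d) (at t) \<and> d \<le> 0" by blast
  qed
  then have "y b * exp (- a * b) * exp (a * b) \<le> y 0 * exp (a * b)" by (simp add: mult_right_mono)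
  then show ?thesis by (simp add: mult.assoc flip: exp_add)
qed

text \<open>The growth bound holds as long as \<open>y \<le> (3r)\<^sup>2\<close>; until then \<open>y\<close> is at most \<open>(2r)\<^sup>2\<close>, so the first time at which
  \<open>(3r)\<^sup>2\<close> is reached cannot occur.\<close>

lemma quadratic_growth_bootstrap:
  fixes y :: "real \<Rightarrow> real"
  assumes b: "0 \<le> b" and deriv: "\<And>t. t \<in> {0..b} \<Longrightarrow> (y has_real_derivative y' t) (at t)"
    and le: "\<And>t. t \<in> {0..b} \<Longrightarrow> y t \<le> 9 * r\<^sup>2 \<Longrightarrow> y' t \<le> 2 * (C * r) * y t"
    and y0: "y 0 \<le> r\<^sup>2" and r: "r > 0" and C: "C \<ge> 0" and small: "C * r * b \<le> ln 2"
  shows "y b \<le> (r * exp (C * r * b))\<^sup>2"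
proof -
  have cont: "continuous_on {0..t} y" if "t \<le> b" for t
    by (intro continuous_at_imp_continuous_on ballI DERIV_isCont[OF deriv]) (use that in auto)
  have growth: "y t \<le> (r * exp (C * r * t))\<^sup>2"
    if t: "0 \<le> t" "t \<le> b" "\<And>\<tau>. \<tau> \<in> {0..t} \<Longrightarrow> y \<tau> \<le> 9 * r\<^sup>2" for t
  proof -
    have "y t \<le> y 0 * exp (2 * (C * r) * t)"
      by (rule gronwall_linear[where y'=y', OF t(1)]) (use deriv le t in auto)
    also have "\<dots> \<le> r\<^sup>2 * exp (2 * (C * r) * t)" using y0 by (intro mult_right_mono) auto
    also have "\<dots> = (r * exp (C * r * t))\<^sup>2"
      by (simp add: power_mult_distrib mult_ac flip: exp_double)
    finally show ?thesis .
  qed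
  have "y t < 9 * r\<^sup>2" if t: "t \<in> {0..b}" for t
  proof (rule ccontr)
    assume "\<not> y t < 9 * r\<^sup>2"
    define S where "S = {0..b} \<inter> y -` {9 * r\<^sup>2..}"
    have "closed S"
      unfolding S_def
      by (rule continuous_closed_preimage[OF cont[OF order_refl] closed_atLeastAtMost closed_atLeast])
    then have "compact ({0..b} \<inter> S)" by (rule compact_Int_closed[OF compact_Icc])
    then have "compact S" by (simp add: S_def)
    moreover have "S \<noteq> {}" using t \<open>\<not> y t < 9 * r\<^sup>2\<close> by (auto simp: S_def)
    ultimately have "\<exists>t1\<in>S. \<forall>\<tau>\<in>S. t1 \<le> \<tau>" by (rule compact_attains_inf)
    then obtain t1 where t1: "t1 \<in> S" "\<And>\<tau>. \<tau> \<in> S \<Longrightarrow> t1 \<le> \<tau>" by blast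
    have t1b: "0 \<le> t1" "t1 \<le> b" "9 * r\<^sup>2 \<le> y t1" using t1(1) by (auto simp: S_def)
    have "y 0 \<le> 9 * r\<^sup>2" using y0 zero_le_power2[of r] by linarith
    \<comment> \<open>The level is attained exactly at the first time \<open>t1\<close>, so the growth bound applies on the closed interval.\<close>
    then obtain \<tau> where \<tau>: "0 \<le> \<tau>" "\<tau> \<le> t1" "y \<tau> = 9 * r\<^sup>2"
      using IVT'[of y 0 "9 * r\<^sup>2" t1] cont t1b by blast
    then have "\<tau> = t1" using t1(2)[of \<tau>] t1b by (auto simp: S_def)
    have "y \<tau>' \<le> 9 * r\<^sup>2" if "\<tau>' \<in> {0..t1}" for \<tau>'
    proof (cases "\<tau>' = t1")
      case False
      then show ?thesis using t1(2)[of \<tau>'] that t1b by (force simp: S_def)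
    qed (use \<tau> \<open>\<tau> = t1\<close> in simp)
    then have "y t1 \<le> (r * exp (C * r * t1))\<^sup>2" using growth[of t1] t1b by blast
    also have "\<dots> \<le> (r * 2)\<^sup>2"
    proof -
      have "C * r * t1 \<le> ln 2" using mult_left_mono[OF t1b(2), of "C * r"] C r small by simp
      then have "exp (C * r * t1) \<le> exp (ln 2)" by (simp only: exp_le_cancel_iff)
      then show ?thesis using r by (intro power_mono mult_left_mono) auto
    qed
    also have "\<dots> < 9 * r\<^sup>2" using r by (simp add: power_mult_distrib)
    finally show False using t1b(3) by simp
  qed
  then show ?thesis using growth[of b] b by (auto intro: less_imp_le)
qed

lemma sobolev_norm_nonneg: "sobolev_norm s U \<ge> 0"
  by (simp add: sobolev_norm_def infsum_nonneg)

text \<open>The filter is absent on the right-hand side because the solution has no frequencies outside the box.\<close>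

lemma energy_identity:
  fixes A :: "'d::finite \<Rightarrow> real^'n::finite \<Rightarrow> real^'n^'n"
  assumes sol: "ode_solution (filtered_field A N) u0 I u" and u0: "trig_vec N (apply_bcontfun u0)" and t: "t \<in> I"
  shows "((\<lambda>r. (sobolev_norm \<sigma> (apply_bcontfun (u r)))\<^sup>2) has_real_derivative
     - 2 * energy_production A N \<sigma> (apply_bcontfun (u t))) (at t)"
proof -
  have I: "open I" and u: "(u has_vector_derivative filtered_field A N (u t)) (at t)"
    using sol t unfolding ode_solution_def by auto
  note trig = filtered_flow_trig_vec[OF sol u0]
  let ?c = "\<lambda>r k. fourier_coeff (apply_bcontfun (u r)) k"
  let ?q = "\<lambda>k. fourier_coeff (quasilinear_term A (apply_bcontfun (u t))) k"
  have c': "((\<lambda>r. ?c r k) has_vector_derivative - ?q k) (at t)" if k: "k \<in> freq_box N" for k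
  proof -
    have "fourier_coeff (apply_bcontfun (filtered_field A N (u t))) k = - ?q k"
    proof -
      have "fourier_coeff (apply_bcontfun (filtered_field A N (u t))) k $ i =
          (-1) * fourier_coeff (low_pass N (quasilinear_term A (apply_bcontfun (u t)))) k $ i" for i
        unfolding fourier_coeff_nth fcoeff_cmult[symmetric]
        by (simp add: filtered_field_on_trig_vec[OF trig[OF t]])
      then show ?thesis using k by (simp add: vec_eq_iff fourier_coeff_low_pass)
    qed
    then show ?thesis
      using bounded_linear.has_vector_derivative[OF bounded_linear_fourier_coeff u, of k] by simp
  qed
  have "((\<lambda>r. \<Sum>k\<in>freq_box N. japanese_bracket k powr (2 * \<sigma>) * (?c r k \<bullet> ?c r k)) has_vector_derivative
      (\<Sum>k\<in>freq_box N. japanese_bracket k powr (2 * \<sigma>) * (?c t k \<bullet> (- ?q k) + (- ?q k) \<bullet> ?c t k))) (at t)"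
    by (intro has_vector_derivative_sum has_vector_derivative_mult_right
        bounded_bilinear.has_vector_derivative[OF bounded_bilinear_inner] c')
  also have "(\<Sum>k\<in>freq_box N. japanese_bracket k powr (2 * \<sigma>) * (?c t k \<bullet> (- ?q k) + (- ?q k) \<bullet> ?c t k)) =
      - 2 * (\<Sum>k\<in>freq_box N. japanese_bracket k powr (2 * \<sigma>) * (?c t k \<bullet> ?q k))"
    by (simp add: inner_commute sum_distrib_left sum_negf[symmetric] algebra_simps)
  finally have "((\<lambda>r. (sobolev_norm \<sigma> (apply_bcontfun (u r)))\<^sup>2) has_vector_derivative
      - 2 * (\<Sum>k\<in>freq_box N. japanese_bracket k powr (2 * \<sigma>) * (?c t k \<bullet> ?q k))) (at t)"
  proof (rule has_vector_derivative_transform_within_open[OF _ I t])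
    fix r assume "r \<in> I"
    then show "(\<Sum>k\<in>freq_box N. japanese_bracket k powr (2 * \<sigma>) * (?c r k \<bullet> ?c r k)) = (sobolev_norm \<sigma> (apply_bcontfun (u r)))\<^sup>2"
      unfolding sobolev_norm_trig_vec[OF trig[OF \<open>r \<in> I\<close>]]
      by (simp add: sum_nonneg power2_norm_eq_inner)
  qed
  then show ?thesis by (simp only: has_real_derivative_iff_has_vector_derivative energy_production_def)
qed

text \<open>Stated for an arbitrary upper bound \<open>r\<close> of the initial norm, which covers vanishing data by letting \<open>r\<close> tend to
  zero. The factor \<open>3\<close> is the room that the bootstrap needs.\<close>

lemma sobolev_growth_small_data:
  fixes A :: "'d::finite \<Rightarrow> real^'n::finite \<Rightarrow> real^'n^'n"
  assumes energy: "\<And>U :: real^'d \<Rightarrow> real^'n. trig_vec N U \<Longrightarrow> sobolev_norm s U \<le> 3 * M \<Longrightarrow>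
    \<bar>energy_production A N s U\<bar>
      \<le> C * sobolev_norm s U * (sobolev_norm s U)\<^sup>2"
    and C: "C > 0"
    and sol: "ode_solution (filtered_field A N) u0 I u" and u0: "trig_vec N (apply_bcontfun u0)"
    and r: "sobolev_norm s (apply_bcontfun u0) \<le> r" "0 < r" "r \<le> M"
    and t: "t \<in> I" "0 \<le> t" "3 * C * r * t \<le> ln 2"
  shows "sobolev_norm s (apply_bcontfun (u t)) \<le> r * exp (3 * C * r * t)"
proof -
  let ?y = "\<lambda>\<tau>. (sobolev_norm s (apply_bcontfun (u \<tau>)))\<^sup>2"
  let ?E = "\<lambda>\<tau>. energy_production A N s (apply_bcontfun (u \<tau>))"
  have I: "is_interval I" "0 \<in> I" "u 0 = u0" using sol unfolding ode_solution_def by auto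
  have sub: "\<tau> \<in> I" if "\<tau> \<in> {0..t}" for \<tau>
    using mem_is_interval_1_I[OF I(1,2) t(1)] that by simp
  have "?y t \<le> (r * exp ((3 * C) * r * t))\<^sup>2"
  proof (rule quadratic_growth_bootstrap[where y'="\<lambda>\<tau>. - 2 * ?E \<tau>"])
    fix \<tau> assume \<tau>: "\<tau> \<in> {0..t}"
    show "(?y has_real_derivative - 2 * ?E \<tau>) (at \<tau>)"
      by (rule energy_identity[OF sol u0 sub[OF \<tau>]])
    assume "?y \<tau> \<le> 9 * r\<^sup>2"
    then have "?y \<tau> \<le> (3 * r)\<^sup>2" by (simp add: power_mult_distrib)
    then have le: "sobolev_norm s (apply_bcontfun (u \<tau>)) \<le> 3 * r" by (rule power2_le_imp_le) (use r in simp)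
    have "- 2 * ?E \<tau> \<le> 2 * \<bar>?E \<tau>\<bar>" by simp
    also have "\<dots> \<le> 2 * (C * sobolev_norm s (apply_bcontfun (u \<tau>)) * ?y \<tau>)"
      using energy[OF filtered_flow_trig_vec[OF sol u0 sub[OF \<tau>]]] le r(3) by simp
    also have "\<dots> \<le> 2 * (C * (3 * r) * ?y \<tau>)"
      using le C by (intro mult_left_mono mult_right_mono) auto
    also have "\<dots> = 2 * (3 * C * r) * ?y \<tau>" by (simp only: mult_ac)
    finally show "- 2 * ?E \<tau> \<le> 2 * (3 * C * r) * ?y \<tau>" .
  next
    show "?y 0 \<le> r\<^sup>2" using r(1) I(3) by (simp add: power_mono sobolev_norm_nonneg)
  qed (use r t C in auto)
  then show ?thesis by (rule power2_le_imp_le) (use r in simp)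
qed

lemma sobolev_enorm_trig_vec: "trig_vec N U \<Longrightarrow> sobolev_enorm s U = ereal (sobolev_norm s U)"
  by (simp add: sobolev_enorm_def trig_vec_sobolev)

section \<open>Existence, uniqueness and lifespan\<close>

text \<open>Classical solutions and integral curves correspond to each other on every interval, so the maximal integral
  curve is the maximal classical solution.\<close>

lemma filtered_maximal_solution:
  fixes A :: "'d::finite \<Rightarrow> real^'n::finite \<Rightarrow> real^'n^'n"
  assumes polynomial: "\<And>j a b. real_polynomial_function (\<lambda>u. A j u $ a $ b)"
  obtains I u where
    "ode_solution (filtered_field A N) (Bcontfun (low_pass N U0)) I u"
    "\<And>J v. ode_solution (filtered_field A N) (Bcontfun (low_pass N U0)) J v \<Longrightarrow> J \<subseteq> I"
    "maximal_solution A s N U0 I (\<lambda>t. apply_bcontfun (u t))"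
    "\<And>J V. maximal_solution A s N U0 J V \<Longrightarrow> J = I \<and> (\<forall>t\<in>I. V t = apply_bcontfun (u t))"
proof -
  obtain I u where sol: "ode_solution (filtered_field A N) (Bcontfun (low_pass N U0)) I u"
    and max: "\<And>J v. ode_solution (filtered_field A N) (Bcontfun (low_pass N U0)) J v \<Longrightarrow> J \<subseteq> I \<and> (\<forall>t\<in>J. v t = u t)"
    by (rule ode_maximal[where ?u0.0="Bcontfun (low_pass N U0)",
          OF filtered_field_lipschitz[where A=A and N=N, OF polynomial]]) (rule that)
  have classical: "classical_solution A s N U0 I (\<lambda>t. apply_bcontfun (u t))"
    by (rule ode_imp_classical_solution[OF sol])
  have sub: "J \<subseteq> I \<and> (\<forall>t\<in>J. V t = apply_bcontfun (u t))" if V: "classical_solution A s N U0 J V" for J V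
  proof -
    have J: "J \<subseteq> I" "\<And>t. t \<in> J \<Longrightarrow> Bcontfun (V t) = u t"
      using max[OF classical_imp_ode_solution[OF V]] by auto
    have "V t = apply_bcontfun (u t)" if "t \<in> J" for t
      unfolding J(2)[OF that, symmetric]
      by (rule Bcontfun_inverse[OF trig_vec_bcontfun[OF classical_solution_trig_vec[OF V that]], symmetric])
    then show ?thesis using J(1) by blast
  qed
  show ?thesis
  proof (rule that[OF sol])
    show "J \<subseteq> I" if "ode_solution (filtered_field A N) (Bcontfun (low_pass N U0)) J v" for J v
      using max[OF that] by blast
    show "maximal_solution A s N U0 I (\<lambda>t. apply_bcontfun (u t))"
      unfolding maximal_solution_def using classical sub by blast
    fix J V assume V: "maximal_solution A s N U0 J V"
    then have "classical_solution A s N U0 J V" by (simp add: maximal_solution_def)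
    from sub[OF this] have JV: "J \<subseteq> I" "\<And>t. t \<in> J \<Longrightarrow> V t = apply_bcontfun (u t)" by auto
    have "\<not> J \<subset> I"
    proof
      assume "J \<subset> I"
      then have "\<exists>K W. classical_solution A s N U0 K W \<and> J \<subset> K \<and> (\<forall>t\<in>J. W t = V t)"
        using classical JV by (intro exI[of _ I] exI[of _ "\<lambda>t. apply_bcontfun (u t)"]) auto
      then show False using V unfolding maximal_solution_def by blast
    qed
    then have "J = I" using JV(1) by blast
    then show "J = I \<and> (\<forall>t\<in>I. V t = apply_bcontfun (u t))" using JV(2) by blast
  qed
qed

text \<open>On the interval in question the \<open>H\<^sup>s\<close> norm, hence for fixed \<open>N\<close> the supremum norm, stays bounded, so
  the solution cannot stop there.\<close>

lemma filtered_lifespan: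
  fixes A :: "'d::finite \<Rightarrow> real^'n::finite \<Rightarrow> real^'n^'n"
  assumes polynomial: "\<And>j a b. real_polynomial_function (\<lambda>u. A j u $ a $ b)"
    and s: "s \<ge> 0"
    and energy: "\<And>U :: real^'d \<Rightarrow> real^'n. trig_vec N U \<Longrightarrow> sobolev_norm s U \<le> 3 * M \<Longrightarrow>
    \<bar>energy_production A N s U\<bar>
      \<le> C * sobolev_norm s U * (sobolev_norm s U)\<^sup>2"
    and C: "C > 0" and M: "M > 0"
    and sol: "ode_solution (filtered_field A N) u0 I u"
    and max: "\<And>J v. ode_solution (filtered_field A N) u0 J v \<Longrightarrow> J \<subseteq> I"
    and u0: "trig_vec N (apply_bcontfun u0)"
    and r: "sobolev_norm s (apply_bcontfun u0) \<le> r" "0 \<le> r" "r \<le> M"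
    and t: "t \<in> existence_interval (ln 2 / (3 * C)) r"
  shows "t \<in> I" "sobolev_norm s (apply_bcontfun (u t)) \<le> r * exp (3 * C * r * t)"
proof -
  have exist: "\<tau> \<in> existence_interval (ln 2 / (3 * C)) r \<longleftrightarrow> 0 \<le> \<tau> \<and> 3 * C * r * \<tau> \<le> ln 2" for \<tau>
    using C r(2) by (auto simp: existence_interval_def field_simps)
  have bound: "sobolev_norm s (apply_bcontfun (u \<tau>)) \<le> r * exp (3 * C * r * \<tau>)"
    if \<tau>: "\<tau> \<in> I" "0 \<le> \<tau>" "3 * C * r * \<tau> \<le> ln 2" for \<tau>
  proof (cases "r = 0")
    case False
    then show ?thesis
      using sobolev_growth_small_data[OF energy C sol u0 r(1) _ r(3) \<tau>] r(2) by simp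
  next
    case True
    have "sobolev_norm s (apply_bcontfun (u \<tau>)) \<le> 0 + e" if "e > 0" for e
    proof -
      \<comment> \<open>Any small positive bound for vanishing data is admissible; \<open>\<rho>\<close> is small enough for its lifespan to include \<open>\<tau>\<close>.\<close>
      define \<rho> where "\<rho> = min M (min (e / 2) (ln 2 / (3 * C * (\<tau> + 1))))"
      have \<rho>: "0 < \<rho>" "\<rho> \<le> M" "\<rho> \<le> e / 2" "\<rho> \<le> ln 2 / (3 * C * (\<tau> + 1))"
        using C M \<open>e > 0\<close> \<tau>(2) by (auto simp: \<rho>_def)
      have "3 * C * \<rho> * \<tau> \<le> 3 * C * \<rho> * (\<tau> + 1)" using C \<rho>(1) by simp
      also have "\<dots> \<le> ln 2"
      proof -
        have "3 * C * (\<tau> + 1) > 0" using C \<tau>(2) by simp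
        then have "\<rho> * (3 * C * (\<tau> + 1)) \<le> ln 2" using \<rho>(4) by (simp only: pos_le_divide_eq)
        then show ?thesis by (simp only: mult_ac)
      qed
      finally have small: "3 * C * \<rho> * \<tau> \<le> ln 2" .
      have "sobolev_norm s (apply_bcontfun (u \<tau>)) \<le> \<rho> * exp (3 * C * \<rho> * \<tau>)"
        using sobolev_growth_small_data[OF energy C sol u0 _ \<rho>(1,2) \<tau>(1,2) small] r(1) True \<rho>(1) by simp
      also have "\<dots> \<le> \<rho> * exp (ln 2)"
        using \<rho>(1) small by (intro mult_left_mono) (simp_all only: exp_le_cancel_iff less_imp_le)
      also have "\<dots> \<le> e" using \<rho>(3) by simp
      finally show ?thesis by simp
    qed
    then have "sobolev_norm s (apply_bcontfun (u \<tau>)) \<le> 0" by (rule field_le_epsilon)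
    then show ?thesis using True by simp
  qed
  define K where "K = real (CARD('n) * card (freq_box N :: (int^'d) set))"
  have t': "0 \<le> t" "3 * C * r * t \<le> ln 2" using t exist by auto
  have "{0..t} \<subseteq> I"
  proof (rule ode_continuation[OF filtered_field_lipschitz[OF polynomial] sol max _ t'(1)])
    fix \<tau> assume \<tau>: "\<tau> \<in> I" "0 \<le> \<tau>" "\<tau> \<le> t"
    have small: "3 * C * r * \<tau> \<le> ln 2" 
      by (rule order_trans[OF mult_left_mono[OF \<tau>(3)] t'(2)]) (use C r(2) in simp)
    have "norm (u \<tau>) \<le> K * sobolev_norm s (apply_bcontfun (u \<tau>))"
      unfolding K_def by (rule sup_norm_le_sobolev_norm[OF filtered_flow_trig_vec[OF sol u0 \<tau>(1)] s])
    also have "\<dots> \<le> K * (r * exp (ln 2))"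
    proof -
      have "exp (3 * C * r * \<tau>) \<le> exp (ln 2)" using small by (simp only: exp_le_cancel_iff)
      then have "r * exp (3 * C * r * \<tau>) \<le> r * exp (ln 2)" using r(2) by (rule mult_left_mono)
      then show ?thesis using bound[OF \<tau>(1,2) small] by (intro mult_left_mono) (auto simp: K_def)
    qed
    finally show "norm (u \<tau>) \<le> K * (r * exp (ln 2))" .
  qed
  then show "t \<in> I" using t'(1) by auto
  then show "sobolev_norm s (apply_bcontfun (u t)) \<le> r * exp (3 * C * r * t)"
    using bound t' by blast
qed

theorem proposition2p2:
  fixes A :: "'d::finite \<Rightarrow> real^'n::finite \<Rightarrow> real^'n^'n"
    and s :: real
  assumes symmetric: "\<And>j u. transpose (A j u) = A j u"
    and polynomial: "\<And>j a b. real_polynomial_function (\<lambda>u. A j u $ a $ b)"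
    and s_large: "s > real CARD('d) / 2 + 1"
  shows "(\<forall>M>0. \<exists>C>0. \<exists>T>0. \<forall>N\<ge>1. \<forall>U0 \<in> sobolev s. sobolev_norm s U0 \<le> M \<longrightarrow>
            (\<exists>I U. maximal_solution A s N U0 I U \<and>
               (\<forall>J V. maximal_solution A s N U0 J V \<longrightarrow> J = I \<and> (\<forall>t\<in>I. V t = U t)) \<and>
               existence_interval T (sobolev_norm s U0) \<subseteq> I \<and>
               (\<forall>t\<in>existence_interval T (sobolev_norm s U0).
                  sobolev_norm s (U t) \<le> sobolev_norm s U0 * exp (C * sobolev_norm s U0 * t) \<and>
                  sobolev_norm s U0 * exp (C * sobolev_norm s U0 * t) \<le> 2 * sobolev_norm s U0) \<and>
               (\<forall>s'\<ge>s. sobolev_C1 s' I U)))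
       \<and> (\<forall>s'\<ge>s. \<forall>Mstar>0. \<exists>Cstar>0. \<forall>N\<ge>1. \<forall>U0 \<in> sobolev s. \<forall>I U Tstar.
            maximal_solution A s N U0 I U \<and> 0 < Tstar \<and> Tstar \<in> I \<and>
            (SUP t\<in>{0..Tstar}. sobolev_enorm s (U t)) \<le> ereal Mstar \<longrightarrow>
            (\<forall>t\<in>{0..Tstar}. sobolev_enorm s' (U t)
                 \<le> sobolev_enorm s' U0 * ereal (exp (Cstar * Mstar * t))))"
proof (intro conjI allI impI)
  have s1: "s \<ge> 1" by (rule order_trans[OF _ less_imp_le[OF s_large]]) simp
  fix M :: real assume M: "M > 0"
  obtain C where C: "C > 0" "\<And>N (U :: real^'d \<Rightarrow> real^'n). trig_vec N U \<Longrightarrow> sobolev_norm s U \<le> 3 * M \<Longrightarrow>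
    \<bar>energy_production A N s U\<bar>
      \<le> C * sobolev_norm s U * (sobolev_norm s U)\<^sup>2"
    using filtered_energy_estimate[where A=A and R="3 * M", OF symmetric polynomial s_large s1] by blast
  show "\<exists>C>0. \<exists>T>0. \<forall>N\<ge>1. \<forall>U0 \<in> sobolev s. sobolev_norm s U0 \<le> M \<longrightarrow>
            (\<exists>I U. maximal_solution A s N U0 I U \<and>
               (\<forall>J V. maximal_solution A s N U0 J V \<longrightarrow> J = I \<and> (\<forall>t\<in>I. V t = U t)) \<and>
               existence_interval T (sobolev_norm s U0) \<subseteq> I \<and>
               (\<forall>t\<in>existence_interval T (sobolev_norm s U0).
                  sobolev_norm s (U t) \<le> sobolev_norm s U0 * exp (C * sobolev_norm s U0 * t) \<and>
                  sobolev_norm s U0 * exp (C * sobolev_norm s U0 * t) \<le> 2 * sobolev_norm s U0) \<and>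
               (\<forall>s'\<ge>s. sobolev_C1 s' I U))"
  proof (rule exI[of _ "3 * C"], rule conjI, use C(1) in simp,
      rule exI[of _ "ln 2 / (3 * C)"], rule conjI, use C(1) in simp, intro allI ballI impI)
    fix N :: nat and U0 :: "real^'d \<Rightarrow> real^'n"
    assume U0: "U0 \<in> sobolev s" "sobolev_norm s U0 \<le> M"
    define u0 where "u0 = Bcontfun (low_pass N U0)"
    have u0: "apply_bcontfun u0 = low_pass N U0"
      by (simp add: u0_def Bcontfun_inverse trig_vec_bcontfun[OF trig_vec_low_pass])
    have trig0: "trig_vec N (apply_bcontfun u0)" by (simp add: u0 trig_vec_low_pass)
    have norm0: "sobolev_norm s (apply_bcontfun u0) \<le> sobolev_norm s U0"
      unfolding u0 by (rule sobolev_norm_low_pass[OF U0(1)])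
    obtain I u where sol: "ode_solution (filtered_field A N) u0 I u"
      and max: "\<And>J v. ode_solution (filtered_field A N) u0 J v \<Longrightarrow> J \<subseteq> I"
      and maxsol: "maximal_solution A s N U0 I (\<lambda>t. apply_bcontfun (u t))"
      and unique: "\<And>J V. maximal_solution A s N U0 J V \<Longrightarrow> J = I \<and> (\<forall>t\<in>I. V t = apply_bcontfun (u t))"
      by (rule filtered_maximal_solution[where A=A and N=N and ?U0.0=U0 and s=s, OF polynomial, folded u0_def]) (rule that)
    have C1: "sobolev_C1 s' I (\<lambda>t. apply_bcontfun (u t))" for s'
      by (rule sobolev_C1_of_flow[OF sol filtered_field_lipschitz[OF polynomial]
            filtered_flow_trig_vec[OF sol trig0] trig_vec_filtered_field])
    note life = filtered_lifespan[OF polynomial _ C(2) C(1) M sol max trig0 norm0 sobolev_norm_nonneg U0(2)]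
    have double: "sobolev_norm s U0 * exp (3 * C * sobolev_norm s U0 * t) \<le> 2 * sobolev_norm s U0"
      if "t \<in> existence_interval (ln 2 / (3 * C)) (sobolev_norm s U0)" for t
    proof -
      have "3 * C * sobolev_norm s U0 * t \<le> ln 2"
        using that C(1) sobolev_norm_nonneg[of s U0]
        by (auto simp: existence_interval_def field_simps split: if_splits)
      then have "exp (3 * C * sobolev_norm s U0 * t) \<le> exp (ln 2)" by (simp only: exp_le_cancel_iff)
      then show ?thesis using mult_left_mono[OF _ sobolev_norm_nonneg[of s U0]] by fastforce
    qed
    show "\<exists>I U. maximal_solution A s N U0 I U \<and>
               (\<forall>J V. maximal_solution A s N U0 J V \<longrightarrow> J = I \<and> (\<forall>t\<in>I. V t = U t)) \<and>
               existence_interval (ln 2 / (3 * C)) (sobolev_norm s U0) \<subseteq> I \<and>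
               (\<forall>t\<in>existence_interval (ln 2 / (3 * C)) (sobolev_norm s U0).
                  sobolev_norm s (U t) \<le> sobolev_norm s U0 * exp (3 * C * sobolev_norm s U0 * t) \<and>
                  sobolev_norm s U0 * exp (3 * C * sobolev_norm s U0 * t) \<le> 2 * sobolev_norm s U0) \<and>
               (\<forall>s'\<ge>s. sobolev_C1 s' I U)"
    proof (rule exI[of _ I], rule exI[of _ "\<lambda>t. apply_bcontfun (u t)"], intro conjI ballI allI impI subsetI)
      fix t assume t: "t \<in> existence_interval (ln 2 / (3 * C)) (sobolev_norm s U0)"
      show "t \<in> I" "sobolev_norm s (apply_bcontfun (u t)) \<le> sobolev_norm s U0 * exp (3 * C * sobolev_norm s U0 * t)"
        using life[OF _ _ _ _ t] s1 by auto
      show "sobolev_norm s U0 * exp (3 * C * sobolev_norm s U0 * t) \<le> 2 * sobolev_norm s U0"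
        by (rule double[OF t])
    next
      fix J V assume V: "maximal_solution A s N U0 J V"
      show "J = I" using unique[OF V] by blast
      show "V t = apply_bcontfun (u t)" if "t \<in> I" for t using unique[OF V] that by blast
    qed (rule maxsol C1)+
  qed
next
  have s1: "s \<ge> 1" by (rule order_trans[OF _ less_imp_le[OF s_large]]) simp
  fix s' Mstar :: real assume s': "s' \<ge> s" and Mstar: "Mstar > 0"
  have s'1: "s' \<ge> 1" using s' s1 by simp
  obtain C where C: "C > 0" "\<And>N (U :: real^'d \<Rightarrow> real^'n). trig_vec N U \<Longrightarrow> sobolev_norm s U \<le> Mstar \<Longrightarrow>
    \<bar>energy_production A N s' U\<bar>
      \<le> C * sobolev_norm s U * (sobolev_norm s' U)\<^sup>2"
    using filtered_energy_estimate[where A=A and R=Mstar, OF symmetric polynomial s_large s'1] by blast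
  show "\<exists>Cstar>0. \<forall>N\<ge>1. \<forall>U0 \<in> sobolev s. \<forall>I U Tstar.
            maximal_solution A s N U0 I U \<and> 0 < Tstar \<and> Tstar \<in> I \<and>
            (SUP t\<in>{0..Tstar}. sobolev_enorm s (U t)) \<le> ereal Mstar \<longrightarrow>
            (\<forall>t\<in>{0..Tstar}. sobolev_enorm s' (U t)
                 \<le> sobolev_enorm s' U0 * ereal (exp (Cstar * Mstar * t)))"
  proof (intro exI[of _ C] conjI allI ballI impI C(1))
    fix N :: nat and U0 U I Tstar t
    assume "maximal_solution A s N U0 I U \<and> 0 < Tstar \<and> Tstar \<in> I \<and>
            (SUP t\<in>{0..Tstar}. sobolev_enorm s (U t)) \<le> ereal Mstar"
      and t: "t \<in> {0..Tstar}"
    then have U: "classical_solution A s N U0 I U" and Tstar: "0 < Tstar" "Tstar \<in> I"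
      and sup: "(SUP t\<in>{0..Tstar}. sobolev_enorm s (U t)) \<le> ereal Mstar"
      by (auto simp: maximal_solution_def)
    have I: "is_interval I" "0 \<in> I" "U 0 = low_pass N U0" using U by (auto simp: classical_solution_def)
    have sub: "\<tau> \<in> I" if "\<tau> \<in> {0..Tstar}" for \<tau>
      using mem_is_interval_1_I[OF I(1,2) Tstar(2)] that by simp
    note trig = classical_solution_trig_vec[OF U]
    have Ms: "sobolev_norm s (U \<tau>) \<le> Mstar" if "\<tau> \<in> {0..Tstar}" for \<tau>
      using order_trans[OF SUP_upper[OF that, of "\<lambda>\<tau>. sobolev_enorm s (U \<tau>)"] sup]
      by (simp add: sobolev_enorm_trig_vec[OF trig[OF sub[OF that]]])
    define u where "u = (\<lambda>\<tau>. Bcontfun (U \<tau>))"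
    have sol: "ode_solution (filtered_field A N) (Bcontfun (low_pass N U0)) I u"
      unfolding u_def by (rule classical_imp_ode_solution[OF U])
    have u: "apply_bcontfun (u \<tau>) = U \<tau>" if "\<tau> \<in> I" for \<tau>
      unfolding u_def by (rule Bcontfun_inverse[OF trig_vec_bcontfun[OF trig[OF that]]])
    have trig0: "trig_vec N (apply_bcontfun (Bcontfun (low_pass N U0)))"
      by (simp add: Bcontfun_inverse trig_vec_bcontfun[OF trig_vec_low_pass] trig_vec_low_pass)
    let ?y = "\<lambda>\<tau>. (sobolev_norm s' (apply_bcontfun (u \<tau>)))\<^sup>2"
    let ?E = "\<lambda>\<tau>. energy_production A N s' (apply_bcontfun (u \<tau>))"
    have "?y t \<le> ?y 0 * exp (2 * (C * Mstar) * t)"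
    proof (rule gronwall_linear[where y'="\<lambda>\<tau>. - 2 * ?E \<tau>"])
      fix \<tau> assume "\<tau> \<in> {0..t}"
      then have \<tau>: "\<tau> \<in> {0..Tstar}" "\<tau> \<in> I" using t sub by auto
      show "(?y has_real_derivative - 2 * ?E \<tau>) (at \<tau>)"
        by (rule energy_identity[OF sol trig0 \<tau>(2)])
      have "- 2 * ?E \<tau> \<le> 2 * \<bar>?E \<tau>\<bar>" by simp
      also have "\<dots> \<le> 2 * (C * sobolev_norm s (U \<tau>) * ?y \<tau>)"
        using C(2)[OF trig[OF \<tau>(2)] Ms[OF \<tau>(1)]] by (simp add: u[OF \<tau>(2)])
      also have "\<dots> \<le> 2 * (C * Mstar * ?y \<tau>)"
        using Ms[OF \<tau>(1)] C(1) by (intro mult_left_mono mult_right_mono) auto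
      also have "\<dots> = 2 * (C * Mstar) * ?y \<tau>" by (simp only: mult_ac)
      finally show "- 2 * ?E \<tau> \<le> 2 * (C * Mstar) * ?y \<tau>" .
    qed (use t in simp)
    also have "\<dots> = (sobolev_norm s' (low_pass N U0) * exp (C * Mstar * t))\<^sup>2"
    proof -
      have "apply_bcontfun (u 0) = low_pass N U0" using u[OF I(2)] I(3) by simp
      moreover have "exp (2 * (C * Mstar) * t) = (exp (C * Mstar * t))\<^sup>2"
      proof -
        have "2 * (C * Mstar) * t = C * Mstar * t + C * Mstar * t" by simp
        then show ?thesis by (simp only: exp_add power2_eq_square)
      qed
      ultimately show ?thesis by (simp only: power_mult_distrib)
    qed
    finally have "(sobolev_norm s' (U t))\<^sup>2 \<le> (sobolev_norm s' (low_pass N U0) * exp (C * Mstar * t))\<^sup>2"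
      by (simp only: u[OF sub[OF t]])
    then have "sobolev_norm s' (U t) \<le> sobolev_norm s' (low_pass N U0) * exp (C * Mstar * t)"
      by (rule power2_le_imp_le) (simp add: sobolev_norm_nonneg)
    then have bound: "sobolev_enorm s' (U t) \<le> ereal (sobolev_norm s' (low_pass N U0) * exp (C * Mstar * t))"
      by (simp add: sobolev_enorm_trig_vec[OF trig[OF sub[OF t]]])
    show "sobolev_enorm s' (U t) \<le> sobolev_enorm s' U0 * ereal (exp (C * Mstar * t))"
    proof (cases "U0 \<in> sobolev s'")
      case True
      have "sobolev_norm s' (low_pass N U0) * exp (C * Mstar * t) \<le> sobolev_norm s' U0 * exp (C * Mstar * t)"
        by (intro mult_right_mono sobolev_norm_low_pass[OF True]) simp
      then show ?thesis using bound True by (simp add: sobolev_enorm_def[of s' U0] order_trans)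
    next
      case False
      then show ?thesis by (simp add: sobolev_enorm_def[of s' U0])
    qed
  qed
qed

end
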